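(* Let $\mathcal{F}$ be a simply generated family of trees with weight sequence $(\phi_m)_{m\ge0}$ of integers (each member of $\mathcal{F}$ contributing weight one, so that the total weight $y_n$ of plane trees of size $n$ equals the number of trees of size $n$ in $\mathcal{F}$), $\Phi(x)=\sum_m\phi_mx^m$ with radius of convergence $R$, and suppose there is $\tau\in(0,R]$ with $\tau\Phi'(\tau)=\Phi(\tau)$ and that the offspring distribution $\xi$ of the corresponding Galton--Watson process satisfies $\mathbb{V}(\xi)<\infty$. Let $H_n$ be the number of distinct fringe subtrees (distinct as members of $\mathcal{F}$) of a random tree $T_n$ of size $n$ from $\mathcal{F}$. With $c=2\tau^{-1}(\Phi(\tau)\log(\Phi'(\tau)))^{1/2}(2\pi\Phi''(\tau))^{-1/2}$: (i) $\mathbb{E}(H_n)=c\frac{n}{\sqrt{\log n}}(1+o(1))$; (ii) $H_n=c\frac{n}{\sqrt{\log n}}(1+o(1))$ with probability tending to $1$.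
   Context: A simply generated family: a plane tree $t$ has weight $w(t)=\prod_{v}\phi_{\deg(v)}$ ($\deg$ = number of children), and a random tree of size $n$ (number of vertices) has underlying plane tree chosen with probability proportional to its weight; with integer weights, $\phi_m$ counts the types of vertices of degree $m$ and the random tree is uniform among the members of $\mathcal{F}$ of size $n$. The corresponding Galton--Watson offspring distribution is $\mathbb{P}(\xi=m)=\phi_m\tau^m/\Phi(\tau)$. A fringe subtree is a vertex with all its descendants. *)

theory Defs
  imports "HOL-Probability.Probability" "HOL-Library.Landau_Symbols"
begin

text \<open>Plane trees and the weight \<open>w(t) = \<Prod>\<^sub>v \<phi>\<^bsub>deg v\<^esub>\<close>.\<close>

datatype plane_tree = PNode "plane_tree list"

primrec plane_size :: "plane_tree \<Rightarrow> nat" where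
  "plane_size (PNode ts) = Suc (sum_list (map plane_size ts))"

primrec weight :: "(nat \<Rightarrow> nat) \<Rightarrow> plane_tree \<Rightarrow> nat" where
  "weight \<phi> (PNode ts) = \<phi> (length ts) * prod_list (map (weight \<phi>) ts)"

text \<open>
  A member of the family is a plane tree in which every vertex of degree \<open>m\<close> carries one of
  \<open>\<phi> m\<close> types, represented by the numbers below \<open>\<phi> m\<close>. Two members are equal iff they agree as
  plane trees and in the types of all vertices.
\<close>

datatype typed_tree = Node nat "typed_tree list"

primrec family_member :: "(nat \<Rightarrow> nat) \<Rightarrow> typed_tree \<Rightarrow> bool" where
  "family_member \<phi> (Node k ts) \<longleftrightarrow>
     k < \<phi> (length ts) \<and> list_all (family_member \<phi>) ts"

text \<open>The number of vertices (the function \<open>size\<close> generated by the datatype package differs).\<close>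

primrec tree_size :: "typed_tree \<Rightarrow> nat" where
  "tree_size (Node k ts) = Suc (sum_list (map tree_size ts))"

primrec shape :: "typed_tree \<Rightarrow> plane_tree" where
  "shape (Node k ts) = PNode (map shape ts)"

primrec fringe_subtrees :: "typed_tree \<Rightarrow> typed_tree set" where
  "fringe_subtrees (Node k ts) = insert (Node k ts) (\<Union> (set (map fringe_subtrees ts)))"

definition num_distinct_fringe :: "typed_tree \<Rightarrow> nat" where
  "num_distinct_fringe t = card (fringe_subtrees t)"

definition family_trees :: "(nat \<Rightarrow> nat) \<Rightarrow> nat \<Rightarrow> typed_tree set" where
  "family_trees \<phi> n = {t. family_member \<phi> t \<and> tree_size t = n}"

definition random_tree :: "(nat \<Rightarrow> nat) \<Rightarrow> nat \<Rightarrow> typed_tree pmf" where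
  "random_tree \<phi> n = pmf_of_set (family_trees \<phi> n)"

text \<open>
  There need not be trees of every size (for instance, \<open>n\<close> has to be odd for full binary trees).
  Limits as \<open>n \<longlongrightarrow> \<infinity>\<close> are taken along those \<open>n\<close> for which a random tree of size \<open>n\<close> exists.
\<close>

definition admissible_sizes :: "(nat \<Rightarrow> nat) \<Rightarrow> nat filter" where
  "admissible_sizes \<phi> = inf sequentially (principal {n. family_trees \<phi> n \<noteq> {}})"

definition weight_fps :: "(nat \<Rightarrow> nat) \<Rightarrow> real fps" where
  "weight_fps \<phi> = Abs_fps (\<lambda>m. real (\<phi> m))"

text \<open>
  Derivatives are taken coefficientwise, so that they also make sense on the circle of convergence.
\<close>

definition fringe_const :: "(nat \<Rightarrow> nat) \<Rightarrow> real \<Rightarrow> real" where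
  "fringe_const \<phi> \<tau> =
     2 / \<tau> * sqrt (eval_fps (weight_fps \<phi>) \<tau> * ln (eval_fps (fps_deriv (weight_fps \<phi>)) \<tau>))
       / sqrt (2 * pi * eval_fps (fps_deriv (fps_deriv (weight_fps \<phi>))) \<tau>)"


text \<open>
  The typed trees with a given underlying plane tree are counted by its weight, and so the uniform
  distribution on \<^term>\<open>family_trees \<phi> n\<close> induces the distribution proportional to the weights on
  the plane trees of size \<open>n\<close>.
\<close>

lemma plane_size_shape: "plane_size (shape t) = tree_size t"
proof (induction t)
  case (Node k ts)
  have "map (plane_size \<circ> shape) ts = map tree_size ts"
    using Node by (auto intro: map_cong)
  then show ?case by (simp only: shape.simps plane_size.simps tree_size.simps map_map)
qed

lemma shape_lists:
  "{us. list_all (family_member \<phi>) us \<and> map shape us = ps} =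
     listset (map (\<lambda>p. {t. family_member \<phi> t \<and> shape t = p}) ps)"
  by (induction ps) (auto simp: set_Cons_def)

lemma card_listset': 
  "(\<And>A. A \<in> set As \<Longrightarrow> finite A) \<Longrightarrow>
     finite (listset As) \<and> card (listset As) = prod_list (map card As)"
proof (induction As)
  case (Cons A As)
  have "set_Cons A (listset As) = (\<lambda>(x, xs). x # xs) ` (A \<times> listset As)"
    by (auto simp: set_Cons_def)
  moreover have "inj_on (\<lambda>(x, xs). x # xs) (A \<times> listset As)"
    by (auto simp: inj_on_def)
  ultimately show ?case
    using Cons by (simp add: card_image card_cartesian_product)
qed simp

lemma card_shape:
  "finite {t. family_member \<phi> t \<and> shape t = p} \<and>
   card {t. family_member \<phi> t \<and> shape t = p} = weight \<phi> p"
proof (induction p)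
  case (PNode ps)
  define L where "L = listset (map (\<lambda>p. {t. family_member \<phi> t \<and> shape t = p}) ps)"
  have L: "L = {us. list_all (family_member \<phi>) us \<and> map shape us = ps}"
    unfolding L_def by (rule shape_lists [symmetric])
  have "finite L \<and> card L = prod_list (map card (map (\<lambda>p. {t. family_member \<phi> t \<and> shape t = p}) ps))"
    unfolding L_def by (rule card_listset') (use PNode in auto)
  moreover have "map card (map (\<lambda>p. {t. family_member \<phi> t \<and> shape t = p}) ps) = map (weight \<phi>) ps"
    using PNode by auto
  ultimately have "finite L \<and> card L = prod_list (map (weight \<phi>) ps)"
    by (simp only:)
  then have fin: "finite L" and card: "card L = prod_list (map (weight \<phi>) ps)"
    by blast+
  have eq: "{t. family_member \<phi> t \<and> shape t = PNode ps} =
          (\<lambda>(k, us). Node k us) ` ({..<\<phi> (length ps)} \<times> L)"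
  proof (intro equalityI subsetI)
    fix t assume "t \<in> {t. family_member \<phi> t \<and> shape t = PNode ps}"
    then show "t \<in> (\<lambda>(k, us). Node k us) ` ({..<\<phi> (length ps)} \<times> L)"
      by (cases t) (auto simp: L image_iff)
  qed (auto simp: L)
  have "inj_on (\<lambda>(k, us). Node k us) ({..<\<phi> (length ps)} \<times> L)"
    by (auto simp: inj_on_def)
  then show ?case
    using fin card by (simp add: eq card_image card_cartesian_product)
qed

lemma length_le_sum_list:
  fixes xs :: "nat list"
  shows "(\<And>x. x \<in> set xs \<Longrightarrow> 1 \<le> x) \<Longrightarrow> length xs \<le> sum_list xs"
  by (induction xs) fastforce+

lemma plane_size_pos: "1 \<le> plane_size p"
  by (cases p) simp

lemma finite_plane_size_le: "finite {p. plane_size p \<le> n}"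
proof (induction n)
  case 0
  have "\<not> plane_size p \<le> 0" for p
    using plane_size_pos [of p] by linarith
  then have "{p. plane_size p \<le> 0} = {}" by blast
  then show ?case by (simp only: finite.emptyI)
next
  case (Suc n)
  have "{p. plane_size p \<le> Suc n} \<subseteq>
          PNode ` {ps. set ps \<subseteq> {p. plane_size p \<le> n} \<and> length ps \<le> n}"
  proof
    fix p assume p: "p \<in> {p. plane_size p \<le> Suc n}"
    obtain ps where ps: "p = PNode ps" by (cases p)
    have sum: "sum_list (map plane_size ps) \<le> n" using p ps by simp
    have "length (map plane_size ps) \<le> sum_list (map plane_size ps)"
      by (rule length_le_sum_list) (use plane_size_pos in auto)
    moreover have "plane_size q \<le> n" if "q \<in> set ps" for q
      using member_le_sum_list [of "plane_size q" "map plane_size ps"] that sum by simp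
    ultimately show "p \<in> PNode ` {ps. set ps \<subseteq> {p. plane_size p \<le> n} \<and> length ps \<le> n}"
      using ps sum by auto
  qed
  then show ?case
    using finite_lists_length_le [OF Suc.IH] by (meson finite_imageI finite_subset)
qed

lemma finite_card_family_trees:
  "finite (family_trees \<phi> n)"
  "card (family_trees \<phi> n) = (\<Sum>p | plane_size p = n. weight \<phi> p)"
proof -
  have fin: "finite {p. plane_size p = n}"
    by (rule finite_subset [OF _ finite_plane_size_le [of n]]) auto
  have eq: "family_trees \<phi> n =
          (\<Union>p \<in> {p. plane_size p = n}. {t. family_member \<phi> t \<and> shape t = p})"
    by (auto simp: family_trees_def plane_size_shape)
  show "finite (family_trees \<phi> n)"
    unfolding eq using fin card_shape by blast
  have "card (\<Union>p \<in> {p. plane_size p = n}. {t. family_member \<phi> t \<and> shape t = p}) =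
          (\<Sum>p | plane_size p = n. card {t. family_member \<phi> t \<and> shape t = p})"
    by (rule card_UN_disjoint) (use fin card_shape in auto)
  then show "card (family_trees \<phi> n) = (\<Sum>p | plane_size p = n. weight \<phi> p)"
    unfolding eq using card_shape by simp
qed

end

theory Submission
  imports Defs "HOL-Real_Asymp.Real_Asymp"
begin

text \<open>
  A tree of size \<open>n\<close> is coded by the depth-first word of the (type, degree) pairs of its vertices;
  fringe subtrees are the factors that are themselves words of trees. By the cycle lemma, the
  rotations of all words of trees of size \<open>n\<close> run exactly once through all words of length \<open>n\<close> and
  degree sum \<open>n - 1\<close>, so that moments of the number of fringe subtrees with a size in a given set are
  products and quotients of the probabilities \<open>q m j\<close> that \<open>m\<close> independent copies of \<open>\<xi>\<close> add up to
  \<open>j\<close>. A local limit theorem, obtained by Fourier inversion, gives \<open>q m j\<close> for \<open>j\<close> near \<open>m\<close>, and with it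
  \<open>\<P>(|T| = k) = q k (k - 1) / k\<close> for the unconditioned Galton--Watson tree \<open>T\<close>.

  There are \<open>\<tau> \<P>(|T| = k) b\<^sup>k\<close> trees of size \<open>k\<close>, where \<open>b = \<Phi>'(\<tau>) > 1\<close>. Hence the trees smaller than
  \<open>(ln n - sqrt (ln n)) / ln b\<close> are too few to matter, and the expected number of pairs of equal fringe
  subtrees larger than \<open>(ln n + sqrt (ln n)) / ln b\<close> is negligible. So the number of distinct fringe
  subtrees is close to the number of fringe subtrees of size about \<open>ln n / ln b\<close> or more, whose expectation
  is asymptotically \<open>n \<P>(|T| \<ge> ln n / ln b)\<close> and which is concentrated by a second moment bound.
  All errors are controlled in \<open>L\<^sup>1\<close>, which gives both parts of the theorem at once.
\<close>

section \<open>Words of trees and the cycle lemma\<close>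

text \<open>The obstacle is dependence: the fringe subtrees of a tree of fixed size constrain one
  another through the condition on prefixes. Averaging over rotations removes that condition. Only
  length and letter sum of a word stay prescribed, cutting out the word of a tree leaves a word of
  the same kind, and the exponential factors of the counts combine into simple ratios. The price is
  a boundary effect, bounded by the largest block size considered. Three things complicate the
  estimates. The support of \<xi> may lie in a proper sublattice, so the local limit holds only
  along multiples of a period. With a second moment alone the local limit has no rate, and its
  ratios have to be made uniform over a window of sizes. These ratios are of no use for fringe
  subtrees of size comparable to n, which are bounded crudely. The constant comes from summing
  \<open>\<kappa> / k powr (3/2)\<close> over the sizes congruent to 1 modulo the period: the tail
  is about \<open>2 * \<kappa> / (period * sqrt k)\<close>, taken at k = ln n / ln b, and the period
  cancels.\<close>

primrec dfs :: "typed_tree \<Rightarrow> (nat \<times> nat) list" where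
  "dfs (Node k ts) = (k, length ts) # concat (map dfs ts)"

lemma length_dfs [simp]: "length (dfs t) = tree_size t"
proof (induction t)
  case (Node k ts)
  then have "map (length \<circ> dfs) ts = map tree_size ts" by simp
  then show ?case by (simp only: dfs.simps tree_size.simps length_Cons length_concat map_map)
qed

lemma tree_size_pos: "0 < tree_size t"
  by (cases t) simp

text \<open>The degree in the first letter says how many subtree words follow, so decoding is
  deterministic. The remainders \<open>r\<close> and \<open>r'\<close> make this a statement about
  prefixes: the code is prefix-free.\<close>

lemma dfs_append_inj: "dfs t @ r = dfs t' @ r' \<Longrightarrow> t = t' \<and> r = r'"
proof (induction t arbitrary: t' r r')
  case (Node k ts)
  obtain k' ts' where t': "t' = Node k' ts'" by (cases t')
  have forest: "concat (map dfs us) @ r = concat (map dfs us') @ r' \<Longrightarrow> us = us' \<and> r = r'"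
    if "length us = length us'" "set us \<subseteq> set ts" for us us'
    using that
  proof (induction us us' rule: list_induct2)
    case (Cons u us u' us')
    have "u = u' \<and> concat (map dfs us) @ r = concat (map dfs us') @ r'"
      using Node.IH [of u "concat (map dfs us) @ r" u' "concat (map dfs us') @ r'"] Cons by auto
    then show ?case using Cons by auto
  qed simp
  show ?case
    using Node.prems forest [of ts ts'] by (auto simp: t')
qed

lemma inj_dfs: "inj dfs"
  using dfs_append_inj [of _ "[]" _ "[]"] by (auto intro: injI)

text \<open>The walk with steps degree minus one. While the word of one tree is read, its value plus
  one is the number of subtrees still to come.\<close>

definition word_sum :: "(nat \<times> nat) list \<Rightarrow> int" where
  "word_sum w = (\<Sum>x\<leftarrow>w. int (snd x) - 1)"

lemma word_sum_simps [simp]: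
  "word_sum [] = 0" "word_sum (x # w) = int (snd x) - 1 + word_sum w"
  "word_sum (v @ w) = word_sum v + word_sum w"
  by (simp_all add: word_sum_def)

lemma word_sum_eq: "word_sum w = int (sum_list (map snd w)) - int (length w)"
  by (induction w) auto

text \<open>The Lukasiewicz condition, which characterizes the words of trees.\<close>

definition luk :: "(nat \<times> nat) list \<Rightarrow> bool" where
  "luk w \<longleftrightarrow> word_sum w = -1 \<and> (\<forall>i<length w. 0 \<le> word_sum (take i w))"

lemma word_sum_concat_dfs: "(\<And>t. t \<in> set ts \<Longrightarrow> word_sum (dfs t) = -1) \<Longrightarrow>
    word_sum (concat (map dfs ts)) = - int (length ts)"
  by (induction ts) auto

lemma word_sum_dfs: "word_sum (dfs t) = -1"
  by (induction t) (simp add: word_sum_concat_dfs)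

lemma luk_dfs: "luk (dfs t)"
proof -
  have "\<forall>i<length (dfs t). 0 \<le> word_sum (take i (dfs t))"
  proof (induction t)
    case (Node k ts)
    \<comment> \<open>A proper prefix contains at most \<open>length us - 1\<close> complete trees,
      each lowering the sum by one. The root letter adds \<open>length ts - 1\<close>, which
      compensates exactly.\<close>
    have forest: "set us \<subseteq> set ts \<Longrightarrow> i < length (concat (map dfs us)) \<Longrightarrow>
        1 - int (length us) \<le> word_sum (take i (concat (map dfs us)))" for us i
    proof (induction us arbitrary: i)
      case (Cons u us)
      show ?case
      proof (cases "i < tree_size u")
        case True
        then have "0 \<le> word_sum (take i (dfs u))" using Node.IH [of u] Cons.prems(1) by simp
        then show ?thesis using True by simp
      next
        case False
        then have "1 - int (length us) \<le> word_sum (take (i - tree_size u) (concat (map dfs us)))"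
          using Cons.prems by (intro Cons.IH) auto
        then show ?thesis
          using False word_sum_dfs [of u] by simp
      qed
    qed simp
    show ?case
    proof (intro allI impI)
      fix i assume i: "i < length (dfs (Node k ts))"
      show "0 \<le> word_sum (take i (dfs (Node k ts)))"
        using i forest [of ts "i - 1"] by (cases i) auto
    qed
  qed
  then show ?thesis by (simp add: luk_def word_sum_dfs)
qed

text \<open>A letter of degree \<open>d\<close> replaces \<open>m\<close> pending trees by
  \<open>m + d - 1\<close>, so the induction over letters has to speak of forests even if one tree
  is wanted.\<close>

lemma forest_of_word:
  assumes "word_sum w = - int m" "\<And>i. i < length w \<Longrightarrow> - int m < word_sum (take i w)"
  shows "\<exists>ts. length ts = m \<and> w = concat (map dfs ts)"
  using assms
proof (induction w arbitrary: m)
  case Nil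
  then show ?case by simp
next
  case (Cons x w)
  have m: "0 < m" using Cons.prems(2) [of 0] by simp
  obtain k d where x: "x = (k, d)" by (cases x)
  have "\<exists>ts. length ts = m + d - 1 \<and> w = concat (map dfs ts)"
  proof (rule Cons.IH)
    show "word_sum w = - int (m + d - 1)" using Cons.prems(1) m x by simp
    show "- int (m + d - 1) < word_sum (take i w)" if "i < length w" for i
      using Cons.prems(2) [of "Suc i"] that m x by simp
  qed
  then obtain ts where ts: "length ts = m + d - 1" "w = concat (map dfs ts)" by blast
  \<comment> \<open>The first \<open>d\<close> trees of the remaining forest become the children of
    the new root.\<close>
  have "x # w = concat (map dfs (Node k (take d ts) # drop d ts))"
    using ts m by (simp add: x flip: concat_append map_append)
  moreover have "length (Node k (take d ts) # drop d ts) = m"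
    using ts m by simp
  ultimately show ?case by blast
qed

lemma luk_iff: "luk w \<longleftrightarrow> w \<in> range dfs"
proof
  assume w: "luk w"
  have "\<exists>ts. length ts = 1 \<and> w = concat (map dfs ts)"
  proof (rule forest_of_word)
    show "- int 1 < word_sum (take i w)" if "i < length w" for i
      using w that by (fastforce simp: luk_def)
  qed (use w in \<open>simp add: luk_def\<close>)
  then show "w \<in> range dfs" by (auto simp: length_Suc_conv)
qed (auto simp: luk_dfs)

lemma luk_suffix:
  assumes "luk (a @ b)" "b \<noteq> []" shows "word_sum b \<le> -1"
proof -
  have "0 \<le> word_sum (take (length a) (a @ b))"
    using assms unfolding luk_def by (auto dest!: spec [of _ "length a"])
  then show ?thesis using assms(1) by (simp add: luk_def)
qed

lemma luk_prefix:
  assumes "luk (a @ b)" "b \<noteq> []" shows "0 \<le> word_sum a"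
  using luk_suffix [OF assms] assms by (simp add: luk_def)

section \<open>The cycle lemma: existence and uniqueness of a Lukasiewicz rotation\<close>

lemma luk_rotate_unique:
  assumes "luk u" "luk (rotate e u)" "e < length u" shows "e = 0"
proof (rule ccontr)
  assume "e \<noteq> 0"
  \<comment> \<open>The rotation exchanges two pieces, each of which is then a proper prefix of a
    Lukasiewicz word. Both sums are nonnegative, although they add up to -1.\<close>
  have r: "rotate e u = drop e u @ take e u" using assms(3) by (simp add: rotate_drop_take)
  have "0 \<le> word_sum (take e u)" using luk_prefix [of "take e u" "drop e u"] assms by simp
  moreover have "0 \<le> word_sum (drop e u)"
    using luk_prefix [OF assms(2) [unfolded r]] assms(3) \<open>e \<noteq> 0\<close> by (cases u) auto
  moreover have "word_sum (take e u) + word_sum (drop e u) = -1"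
    using assms(1) by (simp add: luk_def flip: word_sum_simps(3))
  ultimately show False by linarith
qed

lemma luk_rotate_exists:
  assumes "word_sum w = -1" shows "\<exists>r<length w. luk (rotate r w)"
proof -
  define s where "s i = word_sum (take i w)" for i
  define n where "n = length w"
  have sn: "s n = -1" by (simp add: s_def n_def assms)
  have "\<exists>r. r \<le> n \<and> (\<forall>i\<le>n. s r \<le> s i)"
    using arg_min_least [of "{..n}" _ s] arg_min_if_finite(1) [of "{..n}" s]
    by (intro exI [of _ "arg_min_on s {..n}"]) auto
  \<comment> \<open>The rotation starts at the first minimum of the walk. Taking the first one makes
    all earlier partial sums strictly larger, as the part that wraps around requires.\<close>
  define r where "r = (LEAST r. r \<le> n \<and> (\<forall>i\<le>n. s r \<le> s i))"
  have r: "r \<le> n" "\<And>i. i \<le> n \<Longrightarrow> s r \<le> s i"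
    using LeastI_ex [OF \<open>\<exists>r. _\<close>] by (auto simp: r_def)
  have less: "s r < s i" if "i < r" for i
  proof -
    have "\<not> (i \<le> n \<and> (\<forall>j\<le>n. s i \<le> s j))" using not_less_Least that unfolding r_def by blast
    then obtain j where "j \<le> n" "s j < s i" using \<open>i < r\<close> r(1) by (auto simp: not_le)
    then show ?thesis using r(2) [of j] by simp
  qed
  have "r \<noteq> 0" using r(2) [of n] sn by (cases r) (auto simp: s_def)
  have rot: "rotate r w = drop r w @ take r w"
    using r(1) by (cases "r = n") (auto simp: rotate_drop_take n_def)
  have "luk (rotate r w)"
    unfolding luk_def
  proof (intro conjI allI impI)
    show "word_sum (rotate r w) = - 1"
      using assms by (metis rot add.commute append_take_drop_id word_sum_simps(3))
    fix i assume i: "i < length (rotate r w)"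
    then have "i < n" by (simp add: n_def)
    have sr: "s r + word_sum (drop r w) = -1"
      using assms by (simp add: s_def flip: word_sum_simps(3))
    show "0 \<le> word_sum (take i (rotate r w))"
    proof (cases "i \<le> n - r")
      case True
      then have "take (r + i) w = take r w @ take i (drop r w)" by (simp add: take_add)
      then have "s (r + i) = s r + word_sum (take i (drop r w))" by (simp add: s_def)
      then show ?thesis using r(2) [of "r + i"] True r(1) by (simp add: rot n_def)
    next
      case False
      then have "take i (rotate r w) = drop r w @ take (i - (n - r)) w"
        using \<open>i < n\<close> r(1) by (simp add: rot n_def)
      moreover have "s r < s (i - (n - r))" using False \<open>i < n\<close> r(1) by (intro less) simp
      ultimately show ?thesis using sr by (simp add: s_def)
    qed
  qed
  then show ?thesis
  proof (cases "r = n")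
    \<comment> \<open>The minimum may be reached only at the very end. Rotation by \<open>n\<close>
      is the identity, so the witness becomes 0.\<close>
    case True
    then have "luk (rotate 0 w)" using \<open>luk (rotate r w)\<close> by (simp add: n_def)
    then show ?thesis using assms by (intro exI [of _ 0]) auto
  next
    case False
    then show ?thesis using \<open>luk (rotate r w)\<close> r(1) n_def by (intro exI [of _ r]) auto
  qed
qed

text \<open>Their number is the coefficient of x^j in \<Phi>(x)^m. A tree with \<open>n\<close>
  vertices has \<open>n - 1\<close> edges, which explains the case \<open>j = n - 1\<close>
  below.\<close>

definition words :: "(nat \<Rightarrow> nat) \<Rightarrow> nat \<Rightarrow> nat \<Rightarrow> (nat \<times> nat) list set" where
  "words \<phi> m j = {w. length w = m \<and> (\<forall>(k, d) \<in> set w. k < \<phi> d) \<and> sum_list (map snd w) = j}"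

lemma words_0: "words \<phi> 0 j = (if j = 0 then {[]} else {})"
  by (auto simp: words_def)

lemma words_Suc:
  "words \<phi> (Suc m) j =
     (\<lambda>((d, k), w). (k, d) # w) ` (SIGMA (d, k) : (SIGMA d:{..j}. {..<\<phi> d}). words \<phi> m (j - d))"
  (is "_ = ?R")
proof (intro equalityI subsetI)
  fix w assume "w \<in> words \<phi> (Suc m) j"
  then obtain k d v where w: "w = (k, d) # v" "length v = m" "k < \<phi> d" "\<forall>(k, d) \<in> set v. k < \<phi> d"
      "d + sum_list (map snd v) = j"
    by (auto simp: words_def length_Suc_conv)
  then show "w \<in> ?R"
    by (intro image_eqI [of _ _ "((d, k), v)"]) (auto simp: words_def)
qed (auto simp: words_def)

lemma finite_words: "finite (words \<phi> m j)"
  by (induction m arbitrary: j) (auto simp: words_0 words_Suc intro!: finite_imageI finite_SigmaI)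

lemma card_words_Suc:
  "card (words \<phi> (Suc m) j) = (\<Sum>d\<le>j. \<phi> d * card (words \<phi> m (j - d)))"
proof -
  have inj: "inj_on (\<lambda>((d, k), w). (k, d) # w) A" for A :: "((nat \<times> nat) \<times> (nat \<times> nat) list) set"
    by (auto simp: inj_on_def)
  have "card (words \<phi> (Suc m) j) =
      (\<Sum>(d, k) \<in> (SIGMA d:{..j}. {..<\<phi> d}). card (words \<phi> m (j - d)))"
    unfolding words_Suc by (subst card_image [OF inj]) (auto simp: finite_words split_def)
  also have "\<dots> = (\<Sum>d\<le>j. \<Sum>k<\<phi> d. card (words \<phi> m (j - d)))"
    by (subst sum.Sigma) auto
  finally show ?thesis by simp
qed

lemma word_sum_words: "w \<in> words \<phi> m j \<Longrightarrow> word_sum w = int j - int m"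
  by (auto simp: words_def word_sum_eq)

lemma family_member_iff_dfs: "family_member \<phi> t \<longleftrightarrow> (\<forall>(k, d) \<in> set (dfs t). k < \<phi> d)"
proof (induction t)
  case (Node k ts)
  then show ?case by (auto simp: list_all_iff)
qed

lemma dfs_family_trees: "dfs ` family_trees \<phi> n = {w \<in> words \<phi> n (n - 1). luk w}"
proof (intro equalityI subsetI)
  fix w assume "w \<in> dfs ` family_trees \<phi> n"
  then obtain t where t: "w = dfs t" "family_member \<phi> t" "tree_size t = n"
    by (auto simp: family_trees_def)
  have "int (sum_list (map snd w)) = int n - 1"
    using word_sum_dfs [of t] t by (simp add: word_sum_eq)
  then show "w \<in> {w \<in> words \<phi> n (n - 1). luk w}"
    using t by (auto simp: words_def luk_dfs family_member_iff_dfs)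
next
  fix w assume "w \<in> {w \<in> words \<phi> n (n - 1). luk w}"
  then show "w \<in> dfs ` family_trees \<phi> n"
    by (auto simp: luk_iff words_def family_trees_def family_member_iff_dfs)
qed

lemma rotate_words: "rotate i w \<in> words \<phi> m j \<longleftrightarrow> w \<in> words \<phi> m j"
proof -
  have "sum_list (rotate1 xs) = sum_list xs" for xs :: "nat list" by (cases xs) auto
  then have "sum_list (map snd (rotate i w)) = sum_list (map snd w)"
    by (induction i) (auto simp flip: rotate1_map)
  then show ?thesis by (simp add: words_def)
qed

text \<open>Injectivity is the uniqueness of the Lukasiewicz rotation together with injectivity of
  the code; surjectivity is its existence.\<close>

lemma bij_betw_rotate_dfs:
  assumes "0 < n"
  shows "bij_betw (\<lambda>(t, i). rotate i (dfs t)) (family_trees \<phi> n \<times> {..<n}) (words \<phi> n (n - 1))"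
  unfolding bij_betw_def
proof
  show "inj_on (\<lambda>(t, i). rotate i (dfs t)) (family_trees \<phi> n \<times> {..<n})"
  proof (rule inj_onI, clarify)
    fix t i t' i'
    assume t: "t \<in> family_trees \<phi> n" "t' \<in> family_trees \<phi> n" and i: "i < n" "i' < n"
      and eq: "rotate i (dfs t) = rotate i' (dfs t')"
    have len: "length (dfs t) = n" "length (dfs t') = n" using t by (auto simp: family_trees_def)
    have *: "t = t' \<and> i = i'"
      if "i \<le> i'" "i < n" "i' < n" "rotate i (dfs t) = rotate i' (dfs t')" "length (dfs t') = n" for i i' t t'
    proof -
      have "rotate i (dfs t) = rotate i (rotate (i' - i) (dfs t'))" using that by (simp add: rotate_rotate)
      then have "dfs t = rotate (i' - i) (dfs t')" using injD [OF inj_fn [OF inj_rotate1, of i]] by (simp add: rotate_def)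
      moreover from this have "i' - i = 0"
        using luk_rotate_unique [of "dfs t'" "i' - i"] that luk_dfs by (metis less_imp_diff_less)
      ultimately show ?thesis using that inj_dfs by (simp add: inj_eq)
    qed
    show "t = t' \<and> i = i'"
    proof (cases "i \<le> i'")
      case True
      then show ?thesis using * i eq len by blast
    next
      case False
      then show ?thesis using *[OF _ i(2,1) eq [symmetric] len(1)] by simp
    qed
  qed
  show "(\<lambda>(t, i). rotate i (dfs t)) ` (family_trees \<phi> n \<times> {..<n}) = words \<phi> n (n - 1)"
  proof (intro equalityI subsetI)
    fix w assume "w \<in> (\<lambda>(t, i). rotate i (dfs t)) ` (family_trees \<phi> n \<times> {..<n})"
    then obtain t i where "w = rotate i (dfs t)" "t \<in> family_trees \<phi> n" by auto
    then show "w \<in> words \<phi> n (n - 1)" using dfs_family_trees [of \<phi> n] by (auto simp: rotate_words)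
  next
    fix w assume w: "w \<in> words \<phi> n (n - 1)"
    then have "word_sum w = -1" using word_sum_words [OF w] assms by simp
    then obtain r where r: "r < length w" "luk (rotate r w)" using luk_rotate_exists by blast
    have len: "length w = n" using w by (simp add: words_def)
    obtain t where t: "t \<in> family_trees \<phi> n" "rotate r w = dfs t"
      using dfs_family_trees [of \<phi> n] r(2) w rotate_words by blast
    \<comment> \<open>The reduction modulo \<open>n\<close> matters for \<open>r = 0\<close>, where
      \<open>n - r\<close> is not an index below \<open>n\<close>.\<close>
    have "rotate ((n - r) mod n) (dfs t) = rotate (n - r) (rotate r w)"
      using rotate_conv_mod [of "n - r" "rotate r w"] len by (simp flip: t(2))
    also have "\<dots> = rotate (n - r + r) w" by (rule rotate_rotate)
    also have "\<dots> = w" using r len by simp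
    finally show "w \<in> (\<lambda>(t, i). rotate i (dfs t)) ` (family_trees \<phi> n \<times> {..<n})"
      using t(1) assms by (intro image_eqI [of _ _ "(t, (n - r) mod n)"]) auto
  qed
qed

text \<open>The tool for all moments: a statistic summed over the positions of all trees becomes a
  sum over words without any condition on prefixes.\<close>

lemma sum_family_trees_rotate:
  assumes "0 < n"
  shows "(\<Sum>t\<in>family_trees \<phi> n. \<Sum>i<n. f (rotate i (dfs t))) = (\<Sum>w\<in>words \<phi> n (n - 1). f w)"
proof -
  have "(\<Sum>t\<in>family_trees \<phi> n. \<Sum>i<n. f (rotate i (dfs t))) =
     (\<Sum>(t, i)\<in>family_trees \<phi> n \<times> {..<n}. f (rotate i (dfs t)))"
    by (rule sum.cartesian_product)
  also have "\<dots> = (\<Sum>w\<in>words \<phi> n (n - 1). f w)"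
    using sum.reindex_bij_betw [OF bij_betw_rotate_dfs [OF assms], of f \<phi>] by (simp add: split_def)
  finally show ?thesis .
qed

lemma card_words_trees:
  assumes "0 < n" shows "card (words \<phi> n (n - 1)) = n * card (family_trees \<phi> n)"
  using bij_betw_same_card [OF bij_betw_rotate_dfs [OF assms, of \<phi>]] by (simp add: card_cartesian_product mult.commute)

section \<open>Fringe subtrees as factors of words\<close>

lemma dfs_drop_fringe:
  "i < tree_size t \<Longrightarrow> \<exists>s\<in>fringe_subtrees t. \<exists>r. drop i (dfs t) = dfs s @ r"
proof (induction t arbitrary: i)
  case (Node k ts)
  have forest: "\<exists>s\<in>\<Union>(fringe_subtrees ` set us). \<exists>r. drop i (concat (map dfs us)) = dfs s @ r"
    if "set us \<subseteq> set ts" "i < length (concat (map dfs us))" for us i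
    using that
  proof (induction us arbitrary: i)
    case (Cons u us)
    show ?case
    proof (cases "i < tree_size u")
      case True
      then obtain s r where "s \<in> fringe_subtrees u" "drop i (dfs u) = dfs s @ r"
        using Node.IH [of u i] Cons.prems(1) by auto
      then show ?thesis using True by auto
    next
      case False
      then have *: "\<exists>s\<in>\<Union>(fringe_subtrees ` set us). \<exists>r.
          drop (i - tree_size u) (concat (map dfs us)) = dfs s @ r"
        using Cons.prems by (intro Cons.IH) auto
      then obtain s r where "s \<in> \<Union>(fringe_subtrees ` set us)"
          "drop (i - tree_size u) (concat (map dfs us)) = dfs s @ r"
        using * by blast
      then show ?thesis using False by auto
    qed
  qed simp
  show ?case
  proof (cases i)
    case 0
    then show ?thesis by (intro bexI [of _ "Node k ts"]) auto
  next
    case (Suc j)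
    then have "j < length (concat (map dfs ts))"
      using Node.prems length_dfs [of "Node k ts"] by simp
    then show ?thesis using forest [of ts j] Suc by auto
  qed
qed

lemma fringe_dfs_drop:
  "s \<in> fringe_subtrees t \<Longrightarrow> \<exists>i<tree_size t. \<exists>r. drop i (dfs t) = dfs s @ r"
proof (induction t)
  case (Node k ts)
  show ?case
  proof (cases "s = Node k ts")
    case True
    then show ?thesis by (intro exI [of _ 0]) auto
  next
    case False
    then obtain u where u: "u \<in> set ts" "s \<in> fringe_subtrees u" using Node.prems by auto
    then obtain i r where i: "i < tree_size u" "drop i (dfs u) = dfs s @ r"
      using Node.IH by blast
    obtain us vs where ts: "ts = us @ u # vs" using u(1) by (meson split_list)
    define j where "j = length (concat (map dfs us))"
    have "tree_size (Node k ts) = length (dfs (Node k ts))" by (rule length_dfs [symmetric])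
    also have "\<dots> \<ge> Suc (j + tree_size u)" by (simp add: ts j_def del: length_concat)
    finally have "Suc (j + i) < tree_size (Node k ts)" using i(1) by linarith
    moreover have "drop (Suc (j + i)) (dfs (Node k ts)) = dfs s @ r @ concat (map dfs vs)"
      using i by (simp add: ts j_def del: length_concat)
    ultimately show ?thesis by blast
  qed
qed

text \<open>The fringe subtree rooted at the i-th vertex in depth-first order. The description is
  unique because the code is prefix-free.\<close>

definition fringe_at :: "typed_tree \<Rightarrow> nat \<Rightarrow> typed_tree" where
  "fringe_at t i = (THE s. \<exists>r. drop i (dfs t) = dfs s @ r)"

lemma fringe_at_eq: "drop i (dfs t) = dfs s @ r \<Longrightarrow> fringe_at t i = s"
  unfolding fringe_at_def by (rule the_equality) (auto dest: dfs_append_inj)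

lemma fringe_at_dfs:
  assumes "i < tree_size t" obtains r where "drop i (dfs t) = dfs (fringe_at t i) @ r"
  using dfs_drop_fringe [OF assms] by (metis fringe_at_eq)

lemma fringe_subtrees_eq_image: "fringe_subtrees t = fringe_at t ` {..<tree_size t}"
proof (intro equalityI subsetI)
  fix s assume "s \<in> fringe_subtrees t"
  then obtain i r where "i < tree_size t" "drop i (dfs t) = dfs s @ r"
    using fringe_dfs_drop by blast
  then show "s \<in> fringe_at t ` {..<tree_size t}" using fringe_at_eq by blast
next
  fix s assume "s \<in> fringe_at t ` {..<tree_size t}"
  then obtain i where i: "i < tree_size t" "s = fringe_at t i" by blast
  then show "s \<in> fringe_subtrees t" using dfs_drop_fringe [OF i(1)] fringe_at_eq by metis
qed

lemma size_fringe_at: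
  assumes "i < tree_size t" shows "i + tree_size (fringe_at t i) \<le> tree_size t"
proof -
  obtain r where "drop i (dfs t) = dfs (fringe_at t i) @ r" using assms by (rule fringe_at_dfs)
  then have "length (drop i (dfs t)) = length (dfs (fringe_at t i) @ r)" by (rule arg_cong)
  then show ?thesis using assms by simp
qed

lemma take_drop_fringe_at:
  assumes "i < tree_size t"
  shows "take (tree_size (fringe_at t i)) (drop i (dfs t)) = dfs (fringe_at t i)"
  using assms by (rule fringe_at_dfs) simp

lemma family_member_fringe_at:
  assumes "family_member \<phi> t" "i < tree_size t" shows "family_member \<phi> (fringe_at t i)"
proof -
  have "set (dfs (fringe_at t i)) \<subseteq> set (dfs t)"
    using take_drop_fringe_at [OF assms(2)] by (metis set_drop_subset set_take_subset subset_trans)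
  then show ?thesis using assms(1) by (auto simp: family_member_iff_dfs)
qed

definition starts :: "nat \<Rightarrow> (nat \<times> nat) list \<Rightarrow> bool" where
  "starts k w \<longleftrightarrow> k \<le> length w \<and> luk (take k w)"

text \<open>Otherwise the shorter word is a proper prefix of the longer one and should have
  nonnegative sum, but its sum is -1.\<close>

lemma starts_unique: assumes "starts k w" "starts l w" shows "k = l"
proof -
  have False if "k < l" "starts k w" "starts l w" for k l
  proof -
    have "\<forall>i<length (take l w). 0 \<le> word_sum (take i (take l w))"
      using that(3) by (auto simp only: starts_def luk_def)
    then have "0 \<le> word_sum (take k (take l w))"
      using that by (auto simp: starts_def)
    then show False using that by (simp add: starts_def luk_def)
  qed
  then show ?thesis using assms by (metis linorder_neqE_nat)
qed

lemma starts_pos: "starts k w \<Longrightarrow> 0 < k"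
  by (cases k) (auto simp: starts_def luk_def)

lemma starts_fringe_at:
  assumes "i < tree_size t" shows "starts (tree_size (fringe_at t i)) (rotate i (dfs t))"
proof -
  have "take (tree_size (fringe_at t i)) (rotate i (dfs t)) = dfs (fringe_at t i)"
    using take_drop_fringe_at [OF assms] size_fringe_at [OF assms] assms
    by (simp add: rotate_drop_take)
  then show ?thesis using size_fringe_at [OF assms] by (simp add: starts_def luk_dfs)
qed

lemma take_rotate: "i + k \<le> length w \<Longrightarrow> take k (rotate i w) = take k (drop i w)"
  by (cases "i = length w") (auto simp: rotate_drop_take)

lemma fringe_at_of_starts:
  assumes "i + k \<le> tree_size t" "starts k (rotate i (dfs t))"
  shows "tree_size (fringe_at t i) = k"
proof -
  have "0 < k" using assms(2) by (rule starts_pos)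
  then have "i < tree_size t" using assms(1) by simp
  from starts_unique [OF starts_fringe_at [OF this] assms(2)] show ?thesis .
qed

text \<open>The positions of the cyclic word \<open>dfs t\<close> at which a word of a tree starts. They can differ
  from the vertices of \<open>t\<close> with a fringe subtree of this size only near the end of the word.\<close>

definition cyc_pos :: "nat set \<Rightarrow> typed_tree \<Rightarrow> nat set" where
  "cyc_pos A t = {i. i < tree_size t \<and> (\<exists>k\<in>A. starts k (rotate i (dfs t)))}"

definition fringe_pos :: "nat set \<Rightarrow> typed_tree \<Rightarrow> nat set" where
  "fringe_pos A t = {i. i < tree_size t \<and> tree_size (fringe_at t i) \<in> A}"

lemma finite_pos [simp]: "finite (cyc_pos A t)" "finite (fringe_pos A t)"
  by (auto simp: cyc_pos_def fringe_pos_def)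

lemma fringe_pos_subset: "fringe_pos A t \<subseteq> cyc_pos A t"
  using starts_fringe_at by (auto simp: cyc_pos_def fringe_pos_def)

lemma card_cyc_pos_le:
  assumes "A \<subseteq> {..K}" shows "card (cyc_pos A t) \<le> card (fringe_pos A t) + K"
proof -
  have "cyc_pos A t \<subseteq> fringe_pos A t \<union> {tree_size t - K..<tree_size t}"
  proof
    fix i assume "i \<in> cyc_pos A t"
    then obtain k where k: "i < tree_size t" "k \<in> A" "starts k (rotate i (dfs t))"
      by (auto simp: cyc_pos_def)
    show "i \<in> fringe_pos A t \<union> {tree_size t - K..<tree_size t}"
    proof (cases "i + k \<le> tree_size t")
      case True
      then show ?thesis using fringe_at_of_starts k by (auto simp: fringe_pos_def)
    next
      case False
      then show ?thesis using k assms by auto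
    qed
  qed
  then have "card (cyc_pos A t) \<le> card (fringe_pos A t \<union> {tree_size t - K..<tree_size t})"
    by (intro card_mono) auto
  also have "\<dots> \<le> card (fringe_pos A t) + card {tree_size t - K..<tree_size t}"
    by (rule card_Un_le)
  finally show ?thesis by simp
qed

text \<open>Below \<open>k0\<close>, all trees of the family are counted, whether they occur or not;
  from \<open>k0\<close> on, every position is counted, repeated or not. Sizes above
  \<open>K\<close> are kept apart because their contribution will only be bounded, not
  evaluated.\<close>

lemma num_distinct_fringe_le:
  assumes "t \<in> family_trees \<phi> n"
  shows "num_distinct_fringe t \<le>
     (\<Sum>k<k0. card (family_trees \<phi> k)) + card (cyc_pos {k0..K} t) + card (cyc_pos {K<..n} t)"
proof -
  have n: "tree_size t = n" "family_member \<phi> t" using assms by (auto simp: family_trees_def)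
  have "fringe_subtrees t \<subseteq> (\<Union>k<k0. family_trees \<phi> k) \<union>
      (fringe_at t ` fringe_pos {k0..K} t \<union> fringe_at t ` fringe_pos {K<..n} t)"
  proof
    fix s assume "s \<in> fringe_subtrees t"
    then obtain i where i: "i < n" "s = fringe_at t i" by (auto simp: fringe_subtrees_eq_image n)
    have "family_member \<phi> s" using family_member_fringe_at n i by simp
    moreover have "tree_size s \<le> n" using size_fringe_at [of i t] i n by simp
    ultimately show "s \<in> (\<Union>k<k0. family_trees \<phi> k) \<union>
      (fringe_at t ` fringe_pos {k0..K} t \<union> fringe_at t ` fringe_pos {K<..n} t)"
      using i n by (cases "tree_size s < k0"; cases "tree_size s \<le> K")
        (auto simp: family_trees_def fringe_pos_def)
  qed
  then have "num_distinct_fringe t \<le> card ((\<Union>k<k0. family_trees \<phi> k) \<union>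
      (fringe_at t ` fringe_pos {k0..K} t \<union> fringe_at t ` fringe_pos {K<..n} t))"
    unfolding num_distinct_fringe_def by (intro card_mono) (auto simp: finite_card_family_trees)
  also have "\<dots> \<le> card (\<Union>k<k0. family_trees \<phi> k) +
      (card (fringe_at t ` fringe_pos {k0..K} t) + card (fringe_at t ` fringe_pos {K<..n} t))"
    by (meson card_Un_le add_left_mono order_trans)
  also have "\<dots> \<le> (\<Sum>k<k0. card (family_trees \<phi> k)) + (card (cyc_pos {k0..K} t) + card (cyc_pos {K<..n} t))"
    by (intro add_mono card_UN_le order_trans [OF card_image_le] card_mono fringe_pos_subset) auto
  finally show ?thesis by simp
qed

text \<open>The distances from a block at the start of \<open>w\<close> to later equal blocks.
  Requiring \<open>k \<le> e\<close> costs nothing for fringe subtrees, as equal ones are disjoint,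
  and \<open>e + k \<le> length w\<close> keeps the copy from wrapping around.\<close>

definition twins :: "nat set \<Rightarrow> (nat \<times> nat) list \<Rightarrow> nat set" where
  "twins A w = {e. \<exists>k\<in>A. k \<le> e \<and> e + k \<le> length w \<and> starts k w \<and> take k (rotate e w) = take k w}"

lemma finite_twins: "finite (twins A w)"
proof -
  have "twins A w \<subseteq> {..<length w}" using starts_pos by (fastforce simp: twins_def)
  then show "finite (twins A w)" by (rule finite_subset) simp
qed

text \<open>Keep the first index of every fibre. Each other index is the second component of a
  colliding pair.\<close>

lemma card_le_card_image_plus_collisions:
  fixes I :: "nat set"
  assumes "finite I"
  shows "card I \<le> card (f ` I) + card {(i, j). i \<in> I \<and> j \<in> I \<and> i < j \<and> f i = f j}"
proof -
  define C where "C = {(i, j). i \<in> I \<and> j \<in> I \<and> i < j \<and> f i = f j}"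
  have "finite C" using finite_subset [of C "I \<times> I"] assms by (auto simp: C_def)
  define J where "J = {j \<in> I. \<forall>i\<in>I. i < j \<longrightarrow> f i \<noteq> f j}"
  have "I \<subseteq> J \<union> snd ` C" by (force simp: J_def C_def image_iff)
  then have "card I \<le> card (J \<union> snd ` C)" using \<open>finite C\<close> assms by (intro card_mono) (auto simp: J_def)
  also have "\<dots> \<le> card J + card C"
    by (meson card_Un_le card_image_le \<open>finite C\<close> add_left_mono order_trans)
  also have "card J = card (f ` J)"
  proof (rule card_image [symmetric], rule inj_onI)
    fix i j assume "i \<in> J" "j \<in> J" "f i = f j"
    moreover have "f i \<noteq> f j" if "i \<in> J" "j \<in> J" "i < j" for i j
      using that by (simp add: J_def)
    ultimately show "i = j" by (metis linorder_neqE_nat)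
  qed
  also have "\<dots> \<le> card (f ` I)" using assms by (intro card_mono) (auto simp: J_def)
  finally show ?thesis by (simp add: C_def)
qed

text \<open>Words of trees have no border, and so two equal fringe subtrees are disjoint.\<close>

lemma equal_fringe_disjoint:
  assumes "i < j" "j < tree_size t" "fringe_at t i = fringe_at t j"
  shows "i + tree_size (fringe_at t i) \<le> j"
proof (rule ccontr)
  define s where "s = fringe_at t i"
  define e where "e = j - i"
  assume "\<not> ?thesis"
  then have e: "0 < e" "e < tree_size s" using assms(1) by (auto simp: s_def e_def)
  obtain r where r: "drop i (dfs t) = dfs s @ r"
    using fringe_at_dfs [of i t] assms(1,2) unfolding s_def by (metis order.strict_trans)
  obtain r' where r': "drop j (dfs t) = dfs s @ r'"
    using assms(2) unfolding s_def assms(3) by (rule fringe_at_dfs)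
  have "dfs s @ r' = drop e (drop i (dfs t))" using assms(1) by (simp add: e_def flip: r')
  also have "\<dots> = drop e (dfs s) @ r" using e by (simp add: r)
  finally have "take (tree_size s - e) (dfs s @ r') = take (tree_size s - e) (drop e (dfs s) @ r)"
    by (rule arg_cong)
  then have eq: "take (tree_size s - e) (dfs s) = drop e (dfs s)" using e by simp
  have "0 \<le> word_sum (take (tree_size s - e) (dfs s))"
    using luk_dfs [of s] e by (auto simp: luk_def)
  moreover have "word_sum (drop e (dfs s)) \<le> -1"
    using luk_suffix [of "take e (dfs s)" "drop e (dfs s)"] luk_dfs [of s] e by simp
  ultimately show False by (simp add: eq)
qed

text \<open>The summand \<open>K\<close> pays for the positions whose block wraps around. A pair of
  equal fringe subtrees at i < j is recorded as the distance j - i in the rotation that starts at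
  i.\<close>

lemma num_distinct_fringe_ge:
  assumes "tree_size t = n" "A \<subseteq> {..K}"
  shows "card (cyc_pos A t) \<le> num_distinct_fringe t + K + (\<Sum>i<n. card (twins A (rotate i (dfs t))))"
proof -
  define I where "I = fringe_pos A t"
  define C where "C = {(i, j). i \<in> I \<and> j \<in> I \<and> i < j \<and> fringe_at t i = fringe_at t j}"
  have "C \<subseteq> (\<lambda>(i, e). (i, i + e)) ` (SIGMA i:{..<n}. twins A (rotate i (dfs t)))"
  proof (clarify, rule image_eqI)
    fix i j assume "(i, j) \<in> C"
    then have ij: "i < n" "j < n" "i < j" "fringe_at t i = fringe_at t j"
        "tree_size (fringe_at t i) \<in> A"
      using assms(1) by (auto simp: C_def I_def fringe_pos_def)
    define k where "k = tree_size (fringe_at t i)"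
    have k: "i + k \<le> j" using equal_fringe_disjoint [of i j t] ij assms(1) by (simp add: k_def)
    have j: "j + k \<le> n" using size_fringe_at [of j t] ij assms(1) by (simp add: k_def)
    have ti: "take k (rotate i (dfs t)) = dfs (fringe_at t i)"
      using take_drop_fringe_at [of i t] ij(1) k j assms(1) by (simp add: take_rotate k_def)
    have tj: "take k (rotate j (dfs t)) = dfs (fringe_at t i)"
      using take_drop_fringe_at [of j t] ij k j assms(1) by (simp add: take_rotate k_def)
    have "starts k (rotate i (dfs t))" using starts_fringe_at [of i t] ij assms(1) by (simp add: k_def)
    moreover have "rotate (j - i) (rotate i (dfs t)) = rotate j (dfs t)"
      using ij by (simp add: rotate_rotate)
    ultimately have "j - i \<in> twins A (rotate i (dfs t))"
      unfolding twins_def using k j ij assms(1) ti tj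
      by (intro CollectI bexI [of _ k]) (auto simp: k_def)
    then show "(i, j - i) \<in> (SIGMA i:{..<n}. twins A (rotate i (dfs t)))" using ij by simp
    show "(i, j) = (case (i, j - i) of (i, e) \<Rightarrow> (i, i + e))" using ij by simp
  qed
  then have "card C \<le> card (SIGMA i:{..<n}. twins A (rotate i (dfs t)))"
    by (intro surj_card_le) (auto simp: finite_twins)
  also have "\<dots> = (\<Sum>i<n. card (twins A (rotate i (dfs t))))"
    by (simp add: finite_twins)
  finally have C: "card C \<le> \<dots>" .
  have "card I \<le> card (fringe_at t ` I) + card C"
    unfolding C_def by (rule card_le_card_image_plus_collisions) (simp add: I_def)
  also have "card (fringe_at t ` I) \<le> num_distinct_fringe t"
    unfolding num_distinct_fringe_def fringe_subtrees_eq_image I_def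
    by (intro card_mono) (auto simp: fringe_pos_def)
  finally show ?thesis using C card_cyc_pos_le [OF assms(2), of t] by (simp add: I_def)
qed

section \<open>Moments over all words\<close>

lemma sum_of_bool_card: "finite A \<Longrightarrow> (\<Sum>x\<in>A. of_bool (P x)) = card {x \<in> A. P x}"
  by (simp add: Int_def)

lemma words_iff:
  "w \<in> words \<phi> m j \<longleftrightarrow>
     length w = m \<and> (\<forall>(k, d) \<in> set w. k < \<phi> d) \<and> word_sum w = int j - int m"
  by (auto simp: words_def word_sum_eq)

text \<open>At most one block size can start at a given position, so the events for different
  \<open>k\<close> are disjoint and their counts add up.\<close>

lemma sum_card_cyc_pos:
  assumes "0 < n" "A \<subseteq> {..n}"
  shows "(\<Sum>t\<in>family_trees \<phi> n. card (cyc_pos A t)) =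
     (\<Sum>k\<in>A. card {w \<in> words \<phi> n (n - 1). starts k w})"
proof -
  have "finite A" using assms(2) finite_subset by blast
  have "(\<Sum>t\<in>family_trees \<phi> n. card (cyc_pos A t)) =
     (\<Sum>t\<in>family_trees \<phi> n. \<Sum>i<n. of_bool (\<exists>k\<in>A. starts k (rotate i (dfs t))))"
    by (intro sum.cong) (auto simp: cyc_pos_def family_trees_def Int_def)
  also have "\<dots> = (\<Sum>w\<in>words \<phi> n (n - 1). of_bool (\<exists>k\<in>A. starts k w))"
    by (rule sum_family_trees_rotate) (rule assms(1))
  also have "\<dots> = card (\<Union>k\<in>A. {w \<in> words \<phi> n (n - 1). starts k w})"
    by (auto simp: finite_words intro!: arg_cong [where f = card])
  also have "\<dots> = (\<Sum>k\<in>A. card {w \<in> words \<phi> n (n - 1). starts k w})"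
    using \<open>finite A\<close> starts_unique by (intro card_UN_disjoint) (auto simp: finite_words)
  finally show ?thesis .
qed

text \<open>Removing a block of sum -1 from a word of sum -1 leaves a word of sum 0, on which no
  further condition is imposed.\<close>

lemma card_starts:
  assumes "0 < k" "k \<le> n"
  shows "card {w \<in> words \<phi> n (n - 1). starts k w} =
     card (family_trees \<phi> k) * card (words \<phi> (n - k) (n - k))"
proof -
  have "{w \<in> words \<phi> n (n - 1). starts k w} =
      (\<lambda>(u, v). u @ v) ` (dfs ` family_trees \<phi> k \<times> words \<phi> (n - k) (n - k))"
  proof (intro equalityI subsetI)
    fix w assume w: "w \<in> {w \<in> words \<phi> n (n - 1). starts k w}"
    have "word_sum (take k w) + word_sum (drop k w) = word_sum w"
      by (simp flip: word_sum_simps(3))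
    moreover have "set (take k w) \<subseteq> set w" "set (drop k w) \<subseteq> set w"
      by (rule set_take_subset set_drop_subset)+
    ultimately have "(take k w, drop k w) \<in> dfs ` family_trees \<phi> k \<times> words \<phi> (n - k) (n - k)"
      using w assms by (auto simp: dfs_family_trees words_iff starts_def luk_def)
    then show "w \<in> (\<lambda>(u, v). u @ v) ` (dfs ` family_trees \<phi> k \<times> words \<phi> (n - k) (n - k))"
      by (intro image_eqI [of _ _ "(take k w, drop k w)"]) auto
  next
    fix w assume "w \<in> (\<lambda>(u, v). u @ v) ` (dfs ` family_trees \<phi> k \<times> words \<phi> (n - k) (n - k))"
    then show "w \<in> {w \<in> words \<phi> n (n - 1). starts k w}"
      using assms by (auto simp: dfs_family_trees words_iff starts_def)
  qed
  moreover have "inj_on (\<lambda>(u, v). u @ v) (dfs ` family_trees \<phi> k \<times> words \<phi> (n - k) (n - k))"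
    by (auto simp: inj_on_def dfs_family_trees words_iff)
  ultimately show ?thesis
    using inj_dfs by (simp add: card_image card_cartesian_product inj_on_subset)
qed

text \<open>Two blocks of sum -1 leave a rest of sum 1, hence the degree sum
  \<open>n - k - l + 1\<close>. The offset \<open>e - k\<close> says where in the rest the second
  block has to be inserted again.\<close>

lemma two_blocks:
  fixes w :: "(nat \<times> nat) list"
  assumes w: "w \<in> words \<phi> n (n - 1)" "starts k w" "starts l (rotate e w)"
    and kl: "k \<le> e" "e + l \<le> n"
  defines "r \<equiv> drop k (take e w) @ drop (e + l) w"
  shows "take k w \<in> dfs ` family_trees \<phi> k" "take l (drop e w) \<in> dfs ` family_trees \<phi> l"
    "r \<in> words \<phi> (n - k - l) (n - k - l + 1)"
    "w = take k w @ take (e - k) r @ take l (drop e w) @ drop (e - k) r"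
proof -
  have len: "length w = n" using w(1) by (simp add: words_def)
  have l: "take l (rotate e w) = take l (drop e w)" using kl len by (simp add: take_rotate)
  have "0 < k" "0 < l" using starts_pos w(2,3) by auto
  show w_eq: "w = take k w @ take (e - k) r @ take l (drop e w) @ drop (e - k) r"
  proof -
    have "length (drop k (take e w)) = e - k" using len kl by simp
    then have "take k w @ take (e - k) r @ take l (drop e w) @ drop (e - k) r =
        take k w @ drop k (take e w) @ take l (drop e w) @ drop (e + l) w" by (simp add: r_def)
    also have "\<dots> = take k (take e w) @ drop k (take e w) @ take l (drop e w) @ drop l (drop e w)"
      using kl by (simp add: add.commute min_def)
    also have "\<dots> = w" by (simp only: append_assoc [symmetric] append_take_drop_id)
    finally show ?thesis ..
  qed
  have "word_sum r = word_sum (take (e - k) r @ drop (e - k) r)" by simp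
  also have "\<dots> = word_sum w - word_sum (take k w) - word_sum (take l (drop e w))"
    using arg_cong [OF w_eq, of word_sum] by (simp del: append_take_drop_id)
  also have "\<dots> = 1"
    using w l \<open>0 < k\<close> len kl by (simp add: starts_def luk_def words_iff)
  finally have "word_sum r = 1" .
  moreover have "length r = n - k - l" using len kl by (simp add: r_def)
  moreover have sub: "set r \<subseteq> set w" "set (take k w) \<subseteq> set w" "set (take l (drop e w)) \<subseteq> set w"
    by (auto simp: r_def dest: in_set_takeD in_set_dropD)
  ultimately show "r \<in> words \<phi> (n - k - l) (n - k - l + 1)"
    using w(1) by (auto simp: words_iff)
  show "take k w \<in> dfs ` family_trees \<phi> k" 
    using w sub \<open>0 < k\<close> by (auto simp: dfs_family_trees words_iff starts_def luk_def)
  show "take l (drop e w) \<in> dfs ` family_trees \<phi> l"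
    using w sub \<open>0 < l\<close> l len kl by (auto simp: dfs_family_trees words_iff starts_def luk_def)
qed

lemma card_two_starts:
  assumes "k \<le> e" "e + l \<le> n"
  shows "card {w \<in> words \<phi> n (n - 1). starts k w \<and> starts l (rotate e w)} \<le>
     card (family_trees \<phi> k) * card (family_trees \<phi> l) *
       card (words \<phi> (n - k - l) (n - k - l + 1))" (is "card ?S \<le> _")
proof -
  let ?F = "dfs ` family_trees \<phi> k \<times> dfs ` family_trees \<phi> l \<times>
    words \<phi> (n - k - l) (n - k - l + 1)"
  have "?S \<subseteq> (\<lambda>(u, v, r). u @ take (e - k) r @ v @ drop (e - k) r) ` ?F"
  proof
    fix w assume "w \<in> ?S"
    then have w: "w \<in> words \<phi> n (n - 1)" "starts k w" "starts l (rotate e w)" by auto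
    show "w \<in> (\<lambda>(u, v, r). u @ take (e - k) r @ v @ drop (e - k) r) ` ?F"
      using two_blocks [OF w assms]
      by (intro image_eqI [of _ _ "(take k w, take l (drop e w), drop k (take e w) @ drop (e + l) w)"]) auto
  qed
  then have "card ?S \<le> card ?F"
    by (intro surj_card_le) (auto simp: finite_words finite_card_family_trees)
  also have "\<dots> = card (family_trees \<phi> k) * card (family_trees \<phi> l) *
       card (words \<phi> (n - k - l) (n - k - l + 1))"
    using inj_dfs by (simp add: card_image card_cartesian_product inj_on_subset)
  finally show ?thesis .
qed

text \<open>The second block is dictated by the first, so one factor
  \<open>card (family_trees \<phi> k)\<close> is saved compared with two independent blocks. This
  exponential saving makes repetitions of large trees rare.\<close>

lemma card_equal_blocks:
  assumes "k \<le> e" "e + k \<le> n"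
  shows "card {w \<in> words \<phi> n (n - 1). starts k w \<and> take k (rotate e w) = take k w} \<le>
     card (family_trees \<phi> k) * card (words \<phi> (n - 2 * k) (n - 2 * k + 1))" (is "card ?S \<le> _")
proof -
  let ?F = "dfs ` family_trees \<phi> k \<times> words \<phi> (n - 2 * k) (n - 2 * k + 1)"
  have "?S \<subseteq> (\<lambda>(u, r). u @ take (e - k) r @ u @ drop (e - k) r) ` ?F"
  proof
    fix w assume "w \<in> ?S"
    then have w: "w \<in> words \<phi> n (n - 1)" "starts k w" "take k (rotate e w) = take k w" by auto
    have "starts k (rotate e w)" using w by (simp add: starts_def)
    note b = two_blocks [OF w(1,2) this assms]
    have "take k (drop e w) = take k w"
      using w assms by (simp add: take_rotate words_def)
    then show "w \<in> (\<lambda>(u, r). u @ take (e - k) r @ u @ drop (e - k) r) ` ?F"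
      using b
      by (intro image_eqI [of _ _ "(take k w, drop k (take e w) @ drop (e + k) w)"])
        (auto simp: mult_2)
  qed
  then have "card ?S \<le> card ?F"
    by (intro surj_card_le) (auto simp: finite_words finite_card_family_trees)
  also have "\<dots> = card (family_trees \<phi> k) * card (words \<phi> (n - 2 * k) (n - 2 * k + 1))"
    using inj_dfs by (simp add: card_image card_cartesian_product inj_on_subset)
  finally show ?thesis .
qed

lemma sum_twins_le:
  assumes "0 < n" "finite A"
  shows "(\<Sum>t\<in>family_trees \<phi> n. \<Sum>i<n. card (twins A (rotate i (dfs t)))) \<le>
     n * (\<Sum>k\<in>A. card (family_trees \<phi> k) * card (words \<phi> (n - 2 * k) (n - 2 * k + 1)))"
proof -
  let ?W = "words \<phi> n (n - 1)"
  let ?P = "\<lambda>e k w. k \<le> e \<and> e + k \<le> n \<and> starts k w \<and> take k (rotate e w) = take k w"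
  have "(\<Sum>t\<in>family_trees \<phi> n. \<Sum>i<n. card (twins A (rotate i (dfs t)))) = (\<Sum>w\<in>?W. card (twins A w))"
    using assms(1) by (rule sum_family_trees_rotate)
  also have "\<dots> \<le> (\<Sum>w\<in>?W. \<Sum>e<n. \<Sum>k\<in>A. of_bool (?P e k w))"
  proof (rule sum_mono)
    fix w assume "w \<in> ?W"
    then have n: "length w = n" by (simp add: words_def)
    have "twins A w \<subseteq> (\<Union>e\<in>{..<n}. \<Union>k\<in>A. if ?P e k w then {e} else {})"
    proof
      fix e assume "e \<in> twins A w"
      then obtain k where "k \<in> A" "?P e k w" by (auto simp: twins_def n)
      moreover from this have "e < n" using starts_pos [of k w] by linarith
      ultimately show "e \<in> (\<Union>e\<in>{..<n}. \<Union>k\<in>A. if ?P e k w then {e} else {})" by auto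
    qed
    then have "card (twins A w) \<le> card (\<Union>e\<in>{..<n}. \<Union>k\<in>A. if ?P e k w then {e} else {})"
      using assms(2) by (intro card_mono) auto
    also have "\<dots> \<le> (\<Sum>e<n. card (\<Union>k\<in>A. if ?P e k w then {e} else {}))"
      by (rule card_UN_le) simp
    also have "\<dots> \<le> (\<Sum>e<n. \<Sum>k\<in>A. card (if ?P e k w then {e} else {}))"
      using assms(2) by (intro sum_mono card_UN_le)
    also have "\<dots> = (\<Sum>e<n. \<Sum>k\<in>A. of_bool (?P e k w))"
      by (intro sum.cong) auto
    finally show "card (twins A w) \<le> \<dots>" .
  qed
  also have "\<dots> = (\<Sum>e<n. \<Sum>k\<in>A. \<Sum>w\<in>?W. of_bool (?P e k w))"
    by (subst sum.swap, rule sum.cong [OF refl], rule sum.swap)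
  also have "\<dots> \<le> (\<Sum>e<n. \<Sum>k\<in>A. card (family_trees \<phi> k) * card (words \<phi> (n - 2 * k) (n - 2 * k + 1)))"
  proof (intro sum_mono)
    fix e k
    show "(\<Sum>w\<in>?W. of_bool (?P e k w)) \<le> card (family_trees \<phi> k) * card (words \<phi> (n - 2 * k) (n - 2 * k + 1))"
    proof (cases "k \<le> e \<and> e + k \<le> n")
      case True
      then show ?thesis
        using card_equal_blocks [of k e n \<phi>]
        by (simp add: sum_of_bool_card finite_words del: sum_of_bool_eq)
    qed auto
  qed
  finally show ?thesis by simp
qed

text \<open>Pairs of positions are indexed by a position and a cyclic offset \<open>e\<close>. For
  the at most \<open>2 * K + 1\<close> offsets at which blocks could overlap or wrap around, each
  word counts at most once; for all others the blocks are disjoint and can be removed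
  independently.\<close>

lemma sum_card_cyc_pos_squared:
  assumes "0 < n" "finite A" "A \<subseteq> {..K}"
  shows "(\<Sum>t\<in>family_trees \<phi> n. (card (cyc_pos A t))\<^sup>2) \<le>
     (2 * K + 1) * card (words \<phi> n (n - 1)) +
     n * (\<Sum>k\<in>A. \<Sum>l\<in>A. card (family_trees \<phi> k) * card (family_trees \<phi> l) *
       card (words \<phi> (n - k - l) (n - k - l + 1)))" (is "_ \<le> _ + n * ?B")
proof -
  let ?W = "words \<phi> n (n - 1)"
  define g :: "(nat \<times> nat) list \<Rightarrow> nat" where "g w = of_bool (\<exists>k\<in>A. starts k w)" for w
  have g: "g w = (\<Sum>k\<in>A. of_bool (starts k w))" for w
  proof (cases "\<exists>k\<in>A. starts k w")
    case True
    then obtain k where k: "k \<in> A" "starts k w" by blast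
    have "(\<Sum>l\<in>A. of_bool (starts l w) :: nat) = (\<Sum>l\<in>A. of_bool (l = k))"
      using k starts_unique by (intro sum.cong) (auto simp: of_bool_def)
    then show ?thesis using k assms(2) by (auto simp: g_def of_bool_def)
  qed (auto simp: g_def)
  have "(\<Sum>t\<in>family_trees \<phi> n. (card (cyc_pos A t))\<^sup>2) =
     (\<Sum>t\<in>family_trees \<phi> n. \<Sum>i<n. (\<Sum>e<n. g (rotate i (dfs t)) * g (rotate e (rotate i (dfs t)))))"
  proof (rule sum.cong [OF refl])
    fix t assume "t \<in> family_trees \<phi> n"
    then have n: "length (dfs t) = n" by (simp add: family_trees_def)
    have c: "card (cyc_pos A t) = (\<Sum>i<n. g (rotate i (dfs t)))"
      using n by (simp add: cyc_pos_def g_def Int_def)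
    \<comment> \<open>A sum over all positions of a cyclic word does not depend on the starting
      point; this is what allows offsets in place of second positions.\<close>
    have shift: "(\<Sum>e<n. g (rotate e (rotate i (dfs t)))) = (\<Sum>i<n. g (rotate i (dfs t)))"
      if "i < n" for i
    proof (rule sum.reindex_bij_witness [of _ "\<lambda>j. (j + n - i) mod n" "\<lambda>e. (e + i) mod n"])
      fix e assume e: "e \<in> {..<n}"
      show "((e + i) mod n + n - i) mod n = e"
        using e that by (cases "e + i < n") (auto simp: mod_if)
      show "(e + i) mod n \<in> {..<n}" using assms(1) by simp
      show "g (rotate ((e + i) mod n) (dfs t)) = g (rotate e (rotate i (dfs t)))"
        using n rotate_conv_mod [of "e + i" "dfs t"] by (simp add: rotate_rotate)
    next
      fix j assume j: "j \<in> {..<n}"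
      show "((j + n - i) mod n + i) mod n = j"
        using j that by (cases "j < i") (auto simp: mod_if)
      show "(j + n - i) mod n \<in> {..<n}" using assms(1) by simp
    qed
    have "(card (cyc_pos A t))\<^sup>2 = (\<Sum>i<n. g (rotate i (dfs t)) * (\<Sum>i<n. g (rotate i (dfs t))))"
      by (simp add: c power2_eq_square sum_distrib_right)
    also have "\<dots> = (\<Sum>i<n. g (rotate i (dfs t)) * (\<Sum>e<n. g (rotate e (rotate i (dfs t)))))"
      using shift by (intro sum.cong) auto
    finally show "(card (cyc_pos A t))\<^sup>2 =
        (\<Sum>i<n. (\<Sum>e<n. g (rotate i (dfs t)) * g (rotate e (rotate i (dfs t)))))"
      by (simp add: sum_distrib_left)
  qed
  also have "\<dots> = (\<Sum>w\<in>?W. \<Sum>e<n. g w * g (rotate e w))"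
    using assms(1) by (rule sum_family_trees_rotate)
  also have "\<dots> = (\<Sum>e<n. \<Sum>w\<in>?W. g w * g (rotate e w))" by (rule sum.swap)
  also have "\<dots> \<le> (\<Sum>e<n. of_bool (e < K \<or> n < e + K) * card ?W + ?B)"
  proof (rule sum_mono)
    fix e assume "e \<in> {..<n}"
    show "(\<Sum>w\<in>?W. g w * g (rotate e w)) \<le> of_bool (e < K \<or> n < e + K) * card ?W + ?B"
    proof (cases "e < K \<or> n < e + K")
      case True
      have "(\<Sum>w\<in>?W. g w * g (rotate e w)) \<le> (\<Sum>w\<in>?W. 1)"
        by (intro sum_mono) (auto simp: g_def)
      then show ?thesis using True by simp
    next
      case False
      have "(\<Sum>w\<in>?W. g w * g (rotate e w)) =
          (\<Sum>w\<in>?W. \<Sum>k\<in>A. \<Sum>l\<in>A. of_bool (starts k w \<and> starts l (rotate e w)))"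
        by (simp add: g sum_product of_bool_conj)
      also have "\<dots> = (\<Sum>k\<in>A. \<Sum>l\<in>A. \<Sum>w\<in>?W. of_bool (starts k w \<and> starts l (rotate e w)))"
        by (subst sum.swap, rule sum.cong [OF refl], rule sum.swap)
      also have "\<dots> \<le> ?B"
      proof (intro sum_mono)
        fix k l assume "k \<in> A" "l \<in> A"
        then have "k \<le> e" "e + l \<le> n" using False assms(3) by fastforce+
        then show "(\<Sum>w\<in>?W. of_bool (starts k w \<and> starts l (rotate e w))) \<le>
          card (family_trees \<phi> k) * card (family_trees \<phi> l) *
            card (words \<phi> (n - k - l) (n - k - l + 1))"
          using card_two_starts [of k e l n \<phi>]
          by (simp add: sum_of_bool_card finite_words del: sum_of_bool_eq)
      qed
      finally show ?thesis by simp
    qed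
  qed
  also have "\<dots> = card ({..<n} \<inter> {e. e < K \<or> n < e + K}) * card ?W + n * ?B"
    by (simp only: sum.distrib sum_constant card_lessThan sum_of_bool_eq finite_lessThan
        of_nat_id flip: sum_distrib_right)
  also have "card ({..<n} \<inter> {e. e < K \<or> n < e + K}) \<le> card ({..<K} \<union> {n - K..<n})"
    by (intro card_mono) auto
  also have "card ({..<K} \<union> {n - K..<n}) \<le> card {..<K} + card {n - K..<n}" by (rule card_Un_le)
  also have "\<dots> \<le> 2 * K + 1" by simp
  finally show ?thesis by (simp add: mult_right_mono add_right_mono)
qed

section \<open>The offspring distribution\<close>

lemma integrable_measure_pmf_nat_iff:
  fixes f :: "nat \<Rightarrow> 'a::{banach, second_countable_topology}"
  shows "integrable (measure_pmf p) f \<longleftrightarrow> summable (\<lambda>n. norm (pmf p n *\<^sub>R f n))"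
  unfolding measure_pmf_eq_density
  by (subst integrable_density) (auto simp: integrable_count_space_nat_iff)

lemma sums_integral_measure_pmf_nat:
  fixes f :: "nat \<Rightarrow> 'a::{banach, second_countable_topology}"
  assumes "integrable (measure_pmf p) f"
  shows "(\<lambda>n. pmf p n *\<^sub>R f n) sums integral\<^sup>L (measure_pmf p) f"
proof -
  have s: "summable (\<lambda>n. norm (pmf p n *\<^sub>R f n))"
    using assms by (simp only: integrable_measure_pmf_nat_iff)
  have "integral\<^sup>L (measure_pmf p) f = integral\<^sup>L (count_space UNIV) (\<lambda>n. pmf p n *\<^sub>R f n)"
    unfolding measure_pmf_eq_density by (subst integral_density) auto
  also have "\<dots> = (\<Sum>n. pmf p n *\<^sub>R f n)"
    using s by (intro integral_count_space_nat) (simp add: integrable_count_space_nat_iff)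
  finally show ?thesis using summable_sums [OF summable_norm_cancel [OF s]] by simp
qed

text \<open>The condition \<open>leaves\<close> is added because without it the family is empty;
  that case is settled separately in the final theorem.\<close>

locale simply_generated =
  fixes \<phi> :: "nat \<Rightarrow> nat" and \<tau> :: real and \<xi> :: "nat pmf"
  assumes tau: "0 < \<tau>"
    and summable: "summable (\<lambda>m. fps_nth (weight_fps \<phi>) m * \<tau> ^ m)"
      "summable (\<lambda>m. fps_nth (fps_deriv (weight_fps \<phi>)) m * \<tau> ^ m)"
    and critical: "\<tau> * eval_fps (fps_deriv (weight_fps \<phi>)) \<tau> = eval_fps (weight_fps \<phi>) \<tau>"
    and offspring: "\<And>m. pmf \<xi> m = real (\<phi> m) * \<tau> ^ m / eval_fps (weight_fps \<phi>) \<tau>"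
    and variance_finite:
      "integrable (measure_pmf \<xi>) (\<lambda>m. (real m - measure_pmf.expectation \<xi> real)\<^sup>2)"
    and leaves: "0 < \<phi> 0"
begin

definition "\<Phi> = eval_fps (weight_fps \<phi>) \<tau>"

text \<open>The probability that \<open>m\<close> independent copies of \<open>\<xi>\<close> have sum \<open>j\<close>.\<close>

definition "q m j = real (card (words \<phi> m j)) * \<tau> ^ j / \<Phi> ^ m"

lemma Phi_pos: "0 < \<Phi>"
proof -
  have "0 < real (\<phi> 0) * \<tau> ^ 0" using leaves by simp
  also have "\<dots> \<le> \<Phi>"
    using sum_le_suminf [OF summable(1), of "{0}"] tau
    by (simp add: \<Phi>_def eval_fps_def weight_fps_def)
  finally show ?thesis .
qed

lemma pmf_xi: "pmf \<xi> m = real (\<phi> m) * \<tau> ^ m / \<Phi>"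
  by (simp add: offspring \<Phi>_def)

lemma pmf_xi_0_pos: "0 < pmf \<xi> 0"
  using leaves Phi_pos by (simp add: pmf_xi)

lemma pmf_sums: "pmf \<xi> sums 1"
proof -
  have "(\<lambda>m. real (\<phi> m) * \<tau> ^ m) sums \<Phi>"
    using summable_sums [OF summable(1)] by (simp add: \<Phi>_def eval_fps_def weight_fps_def)
  from sums_divide [OF this, of \<Phi>] show ?thesis
    using Phi_pos by (simp add: pmf_xi [abs_def])
qed

lemma Phi_deriv: "eval_fps (fps_deriv (weight_fps \<phi>)) \<tau> = \<Phi> / \<tau>"
  using critical tau by (simp add: \<Phi>_def field_simps)

text \<open>Criticality \<open>\<tau> \<Phi>'(\<tau>) = \<Phi>(\<tau>)\<close> says exactly that
  \<xi> has mean one.\<close>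

lemma mean_sums: "(\<lambda>m. real m * pmf \<xi> m) sums 1"
proof -
  have "(\<lambda>m. real (Suc m) * real (\<phi> (Suc m)) * \<tau> ^ m) sums (\<Phi> / \<tau>)"
    using summable_sums [OF summable(2)] Phi_deriv
    by (simp add: eval_fps_def weight_fps_def del: of_nat_Suc)
  from sums_mult [OF this, of "\<tau> / \<Phi>"]
  have "(\<lambda>m. real (Suc m) * pmf \<xi> (Suc m)) sums 1"
    using Phi_pos tau by (simp add: pmf_xi field_simps)
  then show ?thesis by (subst (asm) sums_Suc_iff) simp
qed

lemma integrable_xi: "integrable (measure_pmf \<xi>) real"
  using mean_sums by (simp add: integrable_measure_pmf_nat_iff sums_iff mult.commute)

lemma expectation_xi: "measure_pmf.expectation \<xi> real = 1"
  using sums_integral_measure_pmf_nat [OF integrable_xi] mean_sums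
  by (simp add: sums_iff mult.commute)

definition "\<sigma>2 = measure_pmf.expectation \<xi> (\<lambda>m. (real m - 1)\<^sup>2)"

lemma integrable_variance: "integrable (measure_pmf \<xi>) (\<lambda>m. (real m - 1)\<^sup>2)"
  using variance_finite by (simp add: expectation_xi)

lemma variance_sums: "(\<lambda>m. pmf \<xi> m * (real m - 1)\<^sup>2) sums \<sigma>2"
  using sums_integral_measure_pmf_nat [OF integrable_variance] by (simp add: \<sigma>2_def)

lemma sigma2_pos: "0 < \<sigma>2"
proof -
  have "pmf \<xi> 0 * (real 0 - 1)\<^sup>2 \<le> \<sigma>2"
    using sum_le_suminf [OF sums_summable [OF variance_sums], of "{0}"] sums_unique [OF variance_sums]
    by simp
  then show ?thesis using pmf_xi_0_pos by simp
qed

text \<open>The second derivative gives the factorial moment of \<xi>. It equals the variance since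
  (m - 1)^2 + m - 1 = m (m - 1) and the mean is one.\<close>

lemma Phi_deriv2: "eval_fps (fps_deriv (fps_deriv (weight_fps \<phi>))) \<tau> = \<Phi> * \<sigma>2 / \<tau>\<^sup>2"
proof -
  have "(\<lambda>m. pmf \<xi> m * (real m - 1)\<^sup>2 + real m * pmf \<xi> m - pmf \<xi> m) sums (\<sigma>2 + 1 - 1)"
    by (intro sums_diff sums_add variance_sums mean_sums pmf_sums)
  then have "(\<lambda>m. real m * (real m - 1) * pmf \<xi> m) sums \<sigma>2"
    by (simp add: power2_eq_square algebra_simps)
  then have "(\<lambda>m. real (Suc (Suc m)) * (real (Suc (Suc m)) - 1) * pmf \<xi> (Suc (Suc m))) sums \<sigma>2"
    by (subst sums_Suc_iff, subst sums_Suc_iff) simp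
  moreover have "\<Phi> / \<tau>\<^sup>2 * (real (Suc (Suc m)) * (real (Suc (Suc m)) - 1) * pmf \<xi> (Suc (Suc m))) =
      real (Suc (Suc m)) * real (Suc m) * real (\<phi> (Suc (Suc m))) * \<tau> ^ m" for m
    using Phi_pos tau by (simp add: pmf_xi power2_eq_square)
  ultimately have "(\<lambda>m. real (Suc (Suc m)) * real (Suc m) * real (\<phi> (Suc (Suc m))) * \<tau> ^ m) sums (\<Phi> * \<sigma>2 / \<tau>\<^sup>2)"
    using sums_mult [of _ \<sigma>2 "\<Phi> / \<tau>\<^sup>2"] by fastforce
  then show ?thesis
    by (simp add: eval_fps_def weight_fps_def sums_iff algebra_simps)
qed

text \<open>A distribution on {0, 1} with mean one is concentrated at 1, but 0 has positive
  mass.\<close>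

lemma exists_branching: "\<exists>m\<ge>2. 0 < \<phi> m"
proof (rule ccontr)
  assume "\<not> ?thesis"
  then have "real m * pmf \<xi> m = (if m = 1 then pmf \<xi> 1 else 0)" for m
    by (cases "m \<le> 1") (auto simp: pmf_xi le_Suc_eq)
  then have "(\<lambda>m. if m = 1 then pmf \<xi> 1 else 0) sums 1" using mean_sums by simp
  then have "pmf \<xi> 1 = 1" using sums_unique2 [OF _ sums_single [of 1 "\<lambda>_. pmf \<xi> 1"]] by simp
  moreover have "pmf \<xi> 0 + pmf \<xi> 1 \<le> 1"
    using sum_le_suminf [OF sums_summable [OF pmf_sums], of "{0, 1}"] sums_unique [OF pmf_sums] by simp
  ultimately show False using pmf_xi_0_pos by simp
qed

text \<open>Integrality of the weights enters here: positive weights are at least 1, so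
  \<Phi>(\<tau>) is at least 1 + \<tau>^m for some m \<ge> 2, which exceeds \<tau>.\<close>

lemma Phi_over_tau_gt_1: "1 < \<Phi> / \<tau>"
proof -
  obtain m where m: "2 \<le> m" "0 < \<phi> m" using exists_branching by blast
  have "1 + \<tau> ^ m \<le> real (\<phi> 0) * \<tau> ^ 0 + real (\<phi> m) * \<tau> ^ m"
    using leaves m(2) tau by (intro add_mono mult_right_mono [of 1 _ "\<tau> ^ m", unfolded mult_1_left]) auto
  also have "\<dots> \<le> \<Phi>"
    using sum_le_suminf [OF summable(1), of "{0, m}"] tau m
    by (simp add: \<Phi>_def eval_fps_def weight_fps_def)
  finally have "1 + \<tau> ^ m \<le> \<Phi>" .
  moreover have "\<tau> < 1 + \<tau> ^ m"
  proof (cases "\<tau> \<le> 1")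
    case True
    then show ?thesis using tau by (meson le_less_trans less_add_same_cancel1 zero_less_power)
  next
    case False
    then have "\<tau> ^ 1 \<le> \<tau> ^ m" using m by (intro power_increasing) auto
    then show ?thesis by simp
  qed
  ultimately show ?thesis using tau by (simp add: field_simps)
qed

section \<open>Distribution and generating function of sums of offspring numbers\<close>

lemma q_0: "q 0 j = of_bool (j = 0)"
  by (simp add: q_def words_0)

lemma q_Suc: "q (Suc m) j = (\<Sum>d\<le>j. pmf \<xi> d * q m (j - d))"
proof -
  have "pmf \<xi> d * q m (j - d) =
      real (\<phi> d) * real (card (words \<phi> m (j - d))) * \<tau> ^ j / \<Phi> ^ Suc m" if "d \<le> j" for d
    using that by (simp add: pmf_xi q_def field_simps flip: power_add)
  then show ?thesis
    by (simp add: q_def card_words_Suc sum_divide_distrib sum_distrib_right)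
qed

lemma q_nonneg: "0 \<le> q m j"
  using tau Phi_pos by (simp add: q_def)

definition "F z = (\<Sum>d. complex_of_real (pmf \<xi> d) * z ^ d)"

lemma summable_norm_F: "norm z \<le> 1 \<Longrightarrow> summable (\<lambda>d. norm (complex_of_real (pmf \<xi> d) * z ^ d))"
  by (rule summable_comparison_test [OF _ sums_summable [OF pmf_sums]])
    (auto simp: norm_mult norm_power power_le_one mult_left_le intro!: exI [of _ 0])

text \<open>The row \<open>q m\<close> has generating function F^m, by repeated Cauchy products.
  Absolute summability is carried along because the next product needs it.\<close>

lemma q_sums:
  assumes "norm z \<le> 1"
  shows "(\<lambda>j. complex_of_real (q m j) * z ^ j) sums (F z ^ m) \<and>
    summable (\<lambda>j. norm (complex_of_real (q m j) * z ^ j))"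
proof (induction m)
  case 0
  have "(\<lambda>j. complex_of_real (q 0 j) * z ^ j) = (\<lambda>j. if j = 0 then 1 else 0)"
    by (auto simp: q_0)
  moreover have "(\<lambda>j. norm (complex_of_real (q 0 j) * z ^ j)) = (\<lambda>j. if j = 0 then 1 else 0)"
    by (auto simp: q_0)
  ultimately show ?case
    using sums_single [of 0 "\<lambda>_. 1 :: complex"] sums_single [of 0 "\<lambda>_. 1 :: real"]
    by (auto simp: sums_iff)
next
  case (Suc m)
  let ?a = "\<lambda>d. complex_of_real (pmf \<xi> d) * z ^ d" and ?b = "\<lambda>j. complex_of_real (q m j) * z ^ j"
  have s: "summable (\<lambda>j. norm (?b j))" "(\<Sum>j. ?b j) = F z ^ m"
    using Suc by (auto simp: sums_iff)
  have eq: "(\<Sum>d\<le>j. ?a d * ?b (j - d)) = complex_of_real (q (Suc m) j) * z ^ j" for j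
  proof -
    have "?a d * ?b (j - d) = complex_of_real (pmf \<xi> d * q m (j - d)) * z ^ j" if "d \<le> j" for d
    proof -
      have "z ^ j = z ^ d * z ^ (j - d)" using that by (simp flip: power_add)
      then show ?thesis by simp
    qed
    then have "(\<Sum>d\<le>j. ?a d * ?b (j - d)) = (\<Sum>d\<le>j. complex_of_real (pmf \<xi> d * q m (j - d)) * z ^ j)"
      by (intro sum.cong) auto
    then show ?thesis by (simp only: q_Suc of_real_sum sum_distrib_right)
  qed
  have "(\<lambda>j. \<Sum>d\<le>j. ?a d * ?b (j - d)) sums ((\<Sum>d. ?a d) * (\<Sum>j. ?b j))"
    by (rule Cauchy_product_sums [OF summable_norm_F [OF assms] s(1)])
  moreover have "summable (\<lambda>j. norm (\<Sum>d\<le>j. ?a d * ?b (j - d)))"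
  proof (rule summable_comparison_test [OF _ summable_Cauchy_product])
    show "summable (\<lambda>d. norm (norm (?a d)))" "summable (\<lambda>j. norm (norm (?b j)))"
      using summable_norm_F [OF assms] s(1) by simp_all
    show "\<exists>N. \<forall>j\<ge>N. norm (norm (\<Sum>d\<le>j. ?a d * ?b (j - d))) \<le> (\<Sum>d\<le>j. norm (?a d) * norm (?b (j - d)))"
      by (auto intro!: sum_norm_le simp: norm_mult)
  qed
  ultimately show ?case unfolding eq s(2) by (simp add: F_def)
qed

lemma F_1: "F 1 = 1"
  using sums_of_real [OF pmf_sums, where 'a = complex] by (simp add: F_def sums_iff)

lemma q_le_1: "q m j \<le> 1"
proof -
  have "(\<lambda>j. complex_of_real (q m j)) sums 1" using q_sums [of 1 m] by (simp add: F_1)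
  then have "q m sums 1" using sums_of_real_iff [of "q m" 1, where 'a = complex] by simp
  then show ?thesis
    using sum_le_suminf [of "q m" "{j}"] q_nonneg by (simp add: sums_iff)
qed

end

section \<open>The local limit theorem\<close>

lemma integral_cis_Icc:
  fixes L k :: real
  assumes "0 \<le> L"
  shows "(LBINT t. indicator {-L..L} t *\<^sub>R cis (k * t)) =
     (if k = 0 then complex_of_real (2 * L) else complex_of_real (2 * sin (k * L) / k))"
proof (cases "k = 0")
  case True
  then show ?thesis using assms by (simp add: scaleR_conv_of_real)
next
  case False
  have "(LBINT t. indicator {-L..L} t *\<^sub>R cis (k * t)) =
      cis (k * L) / (\<i> * k) - cis (k * - L) / (\<i> * k)"
  proof (rule integral_FTC_Icc)
    fix t
    have "((\<lambda>z. exp (\<i> * (k * z)) / (\<i> * k)) has_field_derivative exp (\<i> * (k * complex_of_real t)))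
        (at (complex_of_real t))"
      using False by (auto intro!: derivative_eq_intros simp: mult_ac)
    from has_vector_derivative_real_field [OF this]
    show "((\<lambda>t. cis (k * t) / (\<i> * k)) has_vector_derivative cis (k * t)) (at t within {-L..L})"
      by (simp add: cis_conv_exp has_vector_derivative_at_within)
  qed (use assms in \<open>auto intro!: continuous_intros simp: cis_conv_exp\<close>)
  also have "\<dots> = complex_of_real (2 * sin (k * L) / k)"
    using False by (auto simp: complex_eq_iff Re_divide Im_divide power2_eq_square)
  finally show ?thesis using False by simp
qed

lemma tendsto_of_diff:
  fixes f g :: "'a \<Rightarrow> 'b::real_normed_vector"
  assumes "((\<lambda>x. f x - g x) \<longlongrightarrow> a) F" "(g \<longlongrightarrow> b) F" shows "(f \<longlongrightarrow> a + b) F"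
  using tendsto_add [OF assms] by simp

lemma cis_power_mult: "cis t ^ m * cis x = cis (real m * t + x)"
  by (simp only: Complex.DeMoivre cis_mult)

lemma integral_gauss:
  fixes c :: real assumes "0 < c"
  shows "integrable lborel (\<lambda>x. exp (- (c * x\<^sup>2)))" "(LBINT x. exp (- (c * x\<^sup>2))) = sqrt (pi / c)"
proof -
  define s where "s = 1 / sqrt (2 * c)"
  have s: "0 < s" "2 * s\<^sup>2 = 1 / c" using assms by (auto simp: s_def power_divide)
  have eq: "exp (- (c * x\<^sup>2)) = sqrt (pi / c) * normal_density 0 s x" for x
  proof -
    have "2 * pi * s\<^sup>2 = pi / c" using s(2) by (simp add: field_simps)
    moreover have "- (x - 0)\<^sup>2 / (2 * s\<^sup>2) = - (c * x\<^sup>2)" by (simp add: s(2))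
    ultimately show ?thesis using assms by (simp add: normal_density_def)
  qed
  show "integrable lborel (\<lambda>x. exp (- (c * x\<^sup>2)))"
    unfolding eq using s(1) by (intro integrable_mult_right) simp
  show "(LBINT x. exp (- (c * x\<^sup>2))) = sqrt (pi / c)"
    unfolding eq using s(1) by simp
qed

lemma norm_weighted_add_less:
  fixes w :: complex
  assumes "0 < a" "0 < b" "norm w = 1" "w \<noteq> 1"
  shows "norm (complex_of_real a + complex_of_real b * w) < a + b"
proof -
  have w: "(Re w)\<^sup>2 + (Im w)\<^sup>2 = 1" using assms(3) by (simp add: norm_complex_def)
  have "Re w < 1"
  proof (rule ccontr)
    assume "\<not> Re w < 1"
    then have "1 \<le> (Re w)\<^sup>2" by (simp add: one_le_power)
    then have "(Im w)\<^sup>2 \<le> 0" using w by linarith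
    then have "Im w = 0" "(Re w)\<^sup>2 = 1" using w by auto
    then show False using assms(4) \<open>\<not> Re w < 1\<close> by (auto simp: power2_eq_1_iff complex_eq_iff)
  qed
  have "(norm (complex_of_real a + complex_of_real b * w))\<^sup>2 = a\<^sup>2 + 2 * (a * b) * Re w + b\<^sup>2 * ((Re w)\<^sup>2 + (Im w)\<^sup>2)"
    by (simp add: cmod_power2) (simp add: power2_eq_square algebra_simps)
  also have "\<dots> < (a + b)\<^sup>2"
    using mult_strict_left_mono [OF \<open>Re w < 1\<close>, of "2 * (a * b)"] assms(1,2) w
    by (simp add: power2_sum)
  finally show ?thesis using assms(1,2) by (intro power_less_imp_less_base [of _ 2 "a + b"]) auto
qed

section \<open>The characteristic function of the offspring distribution\<close>

context simply_generated
begin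

text \<open>Since 0 belongs to the support of \<xi>, this gcd is the span of the lattice on which
  \<xi> lives.\<close>

definition "period = Gcd {m. 0 < \<phi> m}"

lemma period_pos: "0 < period"
proof -
  obtain m where "2 \<le> m" "0 < \<phi> m" using exists_branching by blast
  then have "period dvd m" by (simp add: period_def)
  then show ?thesis using \<open>2 \<le> m\<close> by (auto intro: Nat.gr0I)
qed

lemma period_dvd:
  assumes "q m j \<noteq> 0" shows "period dvd j"
proof -
  have "words \<phi> m j \<noteq> {}" using assms by (auto simp: q_def)
  then obtain w where w: "w \<in> words \<phi> m j" by blast
  then have "\<forall>x\<in>set (map snd w). period dvd x" by (fastforce simp: words_def period_def)
  then have "period dvd sum_list (map snd w)" by (induction w) auto
  then show ?thesis using w by (simp add: words_def)
qed

definition "\<psi> = char (distr (measure_pmf \<xi>) borel (\<lambda>m. real m - 1))"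

lemma real_distribution_psi: "real_distribution (distr (measure_pmf \<xi>) borel (\<lambda>m. real m - 1))"
  by (rule prob_space.real_distribution_distr [OF prob_space_measure_pmf]) simp

lemma psi_eq: "\<psi> t = cis (- t) * F (cis t)"
proof -
  have int: "integrable (measure_pmf \<xi>) (\<lambda>m. cis (t * (real m - 1)))"
    by (rule measure_pmf.integrable_const_bound [of _ 1]) auto
  have "\<psi> t = measure_pmf.expectation \<xi> (\<lambda>m. cis (t * (real m - 1)))"
    unfolding \<psi>_def char_def by (subst integral_distr) (auto simp: cis_conv_exp)
  also have "\<dots> = (\<Sum>m. pmf \<xi> m *\<^sub>R cis (t * (real m - 1)))"
    using sums_integral_measure_pmf_nat [OF int] by (rule sums_unique)
  also have "\<dots> = (\<Sum>m. cis (- t) * (complex_of_real (pmf \<xi> m) * cis t ^ m))"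
  proof (rule suminf_cong)
    fix m
    have "cis (t * (real m - 1)) = cis (- t) * cis t ^ m"
      unfolding mult.commute [of "cis (- t)"] cis_power_mult by (simp add: algebra_simps)
    then show "pmf \<xi> m *\<^sub>R cis (t * (real m - 1)) = cis (- t) * (complex_of_real (pmf \<xi> m) * cis t ^ m)"
      by (simp add: scaleR_conv_of_real)
  qed
  also have "\<dots> = cis (- t) * F (cis t)"
    unfolding F_def by (rule suminf_mult, rule summable_norm_cancel, rule summable_norm_F) simp
  finally show ?thesis .
qed

lemma norm_psi_le_1: "norm (\<psi> t) \<le> 1"
  unfolding \<psi>_def by (rule real_distribution.cmod_char_le_1 [OF real_distribution_psi])

lemma isCont_psi: "isCont \<psi> t"
  unfolding \<psi>_def by (rule real_distribution.isCont_char [OF real_distribution_psi])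

lemma cis_period_ne_1:
  assumes "t \<noteq> 0" "\<bar>t\<bar> \<le> pi / period" shows "cis (t * period) \<noteq> 1"
proof
  assume "cis (t * period) = 1"
  then have "cos \<bar>t * period\<bar> = 1" by (simp add: complex_eq_iff)
  moreover have "\<bar>t * period\<bar> \<le> pi" "0 < \<bar>t * period\<bar>"
    using assms period_pos by (auto simp: abs_mult field_simps)
  ultimately show False using cos_monotone_0_pi [of 0 "\<bar>t * period\<bar>"] by simp
qed

text \<open>Since \<open>0\<close> is in the support of \<open>\<xi>\<close>, equality would force \<open>cis (t m) = 1\<close> for all \<open>m\<close> in the support.\<close>

lemma norm_psi_less_1:
  assumes "t \<noteq> 0" "\<bar>t\<bar> \<le> pi / period" shows "norm (\<psi> t) < 1"
proof -
  have "\<exists>m. 0 < \<phi> m \<and> cis (t * real m) \<noteq> 1"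
  proof (rule ccontr)
    assume "\<not> ?thesis"
    then have supp: "cis (t * real m) = 1" if "0 < \<phi> m" for m using that by blast
    \<comment> \<open>The least positive solution divides all others, by division with remainder.
      Hence it divides the whole support and thereby the period, which the range of \<open>t\<close>
      excludes.\<close>
    define g where "g = (LEAST g. 0 < g \<and> cis (t * real g) = 1)"
    obtain m where "2 \<le> m" "0 < \<phi> m" using exists_branching by blast
    then have "\<exists>g>0. cis (t * real g) = 1" using supp by (intro exI [of _ m]) auto
    then have g: "0 < g" "cis (t * real g) = 1" unfolding g_def by (metis (mono_tags, lifting) LeastI_ex)+
    have mult: "cis (t * real (g * k)) = 1" for k
      using g(2) by (metis Complex.DeMoivre mult.assoc mult.commute of_nat_mult power_one)
    have "g dvd m" if "0 < \<phi> m" for m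
    proof (rule ccontr)
      assume "\<not> g dvd m"
      then have "0 < m mod g" "m mod g < g" using g(1) by (auto simp: dvd_eq_mod_eq_0)
      moreover have "cis (t * real (m mod g)) = 1"
      proof -
        have "t * real m = t * real (g * (m div g)) + t * real (m mod g)"
          by (metis distrib_left mult_div_mod_eq of_nat_add)
        then show ?thesis using supp [OF that] mult [of "m div g"] by (simp flip: cis_mult)
      qed
      ultimately show False using not_less_Least unfolding g_def by blast
    qed
    then have "g dvd period" unfolding period_def by (intro Gcd_greatest) auto
    then have "cis (t * real period) = 1" using mult by (metis dvdE)
    then show False using cis_period_ne_1 [OF assms] by simp
  qed
  then obtain m where m: "0 < \<phi> m" "cis t ^ m \<noteq> 1" by (auto simp: Complex.DeMoivre mult.commute)
  then have "m \<noteq> 0" by (cases m) auto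
  define a where "a n = complex_of_real (pmf \<xi> n) * cis t ^ n" for n
  have "a sums F (cis t)"
    unfolding F_def a_def
    by (rule summable_sums, rule summable_norm_cancel, rule summable_norm_F) simp
  \<comment> \<open>The two terms 0 and \<open>m\<close> point in different directions and give the
    strict gain; the triangle inequality suffices for the rest.\<close>
  from sums_diff [OF this sums_If_finite_set [of "{0, m}" a]]
  have rest: "(\<lambda>n. if n \<in> {0, m} then 0 else a n) sums (F (cis t) - (a 0 + a m))"
    using \<open>m \<noteq> 0\<close> by (simp add: if_distrib cong: if_cong)
  from sums_diff [OF pmf_sums sums_If_finite_set [of "{0, m}" "pmf \<xi>"]]
  have rest': "(\<lambda>n. if n \<in> {0, m} then 0 else pmf \<xi> n) sums (1 - (pmf \<xi> 0 + pmf \<xi> m))"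
    using \<open>m \<noteq> 0\<close> by (simp add: if_distrib cong: if_cong)
  have "norm (F (cis t) - (a 0 + a m)) \<le> 1 - (pmf \<xi> 0 + pmf \<xi> m)"
    unfolding sums_unique [OF rest] sums_unique [OF rest']
    using sums_summable [OF rest'] by (intro norm_suminf_le) (auto simp: a_def norm_mult norm_power)
  moreover have "norm (a 0 + a m) < pmf \<xi> 0 + pmf \<xi> m"
    using norm_weighted_add_less [of "pmf \<xi> 0" "pmf \<xi> m" "cis t ^ m"] m pmf_xi_0_pos tau Phi_pos
    by (simp add: a_def norm_power pmf_xi)
  ultimately have "norm (F (cis t)) < 1"
    using norm_triangle_ineq [of "F (cis t) - (a 0 + a m)" "a 0 + a m"] by simp
  then show ?thesis by (simp add: psi_eq norm_mult)
qed

text \<open>The remainder of the second-order expansion of a characteristic function. The minimum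
  keeps it finite under a second moment alone, and makes it vanish as t tends to 0 by dominated
  convergence.\<close>

definition "err t = measure_pmf.expectation \<xi> (\<lambda>m. min (6 * (real m - 1)\<^sup>2) (\<bar>t\<bar> * \<bar>real m - 1\<bar> ^ 3)) / 6"

lemma psi_approx: "norm (\<psi> t - complex_of_real (1 - t\<^sup>2 * \<sigma>2 / 2)) \<le> t\<^sup>2 * err t"
proof -
  have "measure_pmf.expectation \<xi> (\<lambda>m. real m - 1) = 0"
    using integrable_xi by (simp add: expectation_xi)
  moreover from this have "measure_pmf.variance \<xi> (\<lambda>m. real m - 1) = \<sigma>2"
    by (simp add: \<sigma>2_def)
  ultimately show ?thesis
    using prob_space.char_approx3' [OF prob_space_measure_pmf, of "\<lambda>m. real m - 1" \<xi> \<sigma>2 _ t]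
      integrable_xi integrable_variance
    by (simp add: \<psi>_def err_def)
qed

lemma err_tendsto_0: "(err \<longlongrightarrow> 0) (at 0)"
  unfolding tendsto_at_iff_sequentially
proof (intro allI impI)
  fix X :: "nat \<Rightarrow> real" assume X: "X \<longlonglongrightarrow> 0"
  have "(\<lambda>i. measure_pmf.expectation \<xi> (\<lambda>m. min (6 * (real m - 1)\<^sup>2) (\<bar>X i\<bar> * \<bar>real m - 1\<bar> ^ 3)))
      \<longlonglongrightarrow> measure_pmf.expectation \<xi> (\<lambda>m. 0)"
  proof (rule integral_dominated_convergence [where w = "\<lambda>m. 6 * (real m - 1)\<^sup>2"])
    show "AE m in measure_pmf \<xi>. (\<lambda>i. min (6 * (real m - 1)\<^sup>2) (\<bar>X i\<bar> * \<bar>real m - 1\<bar> ^ 3)) \<longlonglongrightarrow> 0"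
    proof (rule AE_I2)
      fix m
      have "(\<lambda>i. min (6 * (real m - 1)\<^sup>2) (\<bar>X i\<bar> * \<bar>real m - 1\<bar> ^ 3)) \<longlonglongrightarrow>
          min (6 * (real m - 1)\<^sup>2) (\<bar>0\<bar> * \<bar>real m - 1\<bar> ^ 3)"
        by (intro tendsto_intros X)
      then show "(\<lambda>i. min (6 * (real m - 1)\<^sup>2) (\<bar>X i\<bar> * \<bar>real m - 1\<bar> ^ 3)) \<longlonglongrightarrow> 0" by simp
    qed
  qed (use integrable_variance in auto)
  from tendsto_divide [OF this tendsto_const [of 6]] show "(err \<circ> X) \<longlonglongrightarrow> 0"
    by (simp add: err_def comp_def)
qed

text \<open>This will dominate the rescaled integrands. Near 0 the expansion holds with an error of
  at most half of the quadratic term; on the compact rest of the interval the modulus stays below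
  some \<rho> < 1.\<close>

lemma psi_gauss_bound: "\<exists>c>0. \<forall>t. \<bar>t\<bar> \<le> pi / period \<longrightarrow> norm (\<psi> t) \<le> exp (- (c * t\<^sup>2))"
proof -
  have "eventually (\<lambda>t. err t < \<sigma>2 / 4) (at 0)"
    using err_tendsto_0 sigma2_pos by (intro order_tendstoD) auto
  then obtain \<delta>0 where \<delta>0: "0 < \<delta>0" "\<And>t. t \<noteq> 0 \<Longrightarrow> \<bar>t\<bar> < \<delta>0 \<Longrightarrow> err t < \<sigma>2 / 4"
    by (auto simp: eventually_at dist_real_def)
  \<comment> \<open>The bound \<open>1 / sqrt \<sigma>2\<close> keeps
    \<open>1 - t\<^sup>2 * \<sigma>2 / 2\<close> nonnegative, so that its norm is the number
    itself.\<close>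
  define \<delta> where "\<delta> = min \<delta>0 (1 / sqrt \<sigma>2)"
  have \<delta>: "0 < \<delta>" using \<delta>0(1) sigma2_pos by (simp add: \<delta>_def)
  have small: "norm (\<psi> t) \<le> exp (- (\<sigma>2 / 4 * t\<^sup>2))" if "t \<noteq> 0" "\<bar>t\<bar> < \<delta>" for t
  proof -
    have "\<bar>t\<bar> * sqrt \<sigma>2 \<le> 1" using that sigma2_pos by (simp add: \<delta>_def field_simps)
    then have "(\<bar>t\<bar> * sqrt \<sigma>2)\<^sup>2 \<le> 1\<^sup>2" using sigma2_pos by (intro power_mono) auto
    then have "t\<^sup>2 * \<sigma>2 \<le> 1" using sigma2_pos by (simp add: power_mult_distrib)
    then have "norm (complex_of_real (1 - t\<^sup>2 * \<sigma>2 / 2)) = 1 - t\<^sup>2 * \<sigma>2 / 2"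
      unfolding norm_of_real by (intro abs_of_nonneg) simp
    moreover have "t\<^sup>2 * err t \<le> t\<^sup>2 * (\<sigma>2 / 4)"
      using \<delta>0(2) [of t] that by (intro mult_left_mono) (auto simp: \<delta>_def)
    ultimately have "norm (\<psi> t) \<le> 1 - \<sigma>2 / 4 * t\<^sup>2"
      using psi_approx [of t] norm_triangle_sub [of "\<psi> t" "complex_of_real (1 - t\<^sup>2 * \<sigma>2 / 2)"]
      by (simp add: algebra_simps)
    also have "\<dots> \<le> exp (- (\<sigma>2 / 4 * t\<^sup>2))" using exp_ge_add_one_self [of "- (\<sigma>2 / 4 * t\<^sup>2)"] by simp
    finally show ?thesis .
  qed
  define S where "S = {- (pi / period)..- \<delta>} \<union> {\<delta>..pi / period}"
  have "\<exists>\<rho>. 0 < \<rho> \<and> \<rho> < 1 \<and> (\<forall>t\<in>S. norm (\<psi> t) \<le> \<rho>)"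
  proof (cases "S = {}")
    case True
    then show ?thesis by (intro exI [of _ "1/2"]) auto
  next
    case False
    have "continuous_on S (\<lambda>t. norm (\<psi> t))"
      using isCont_psi by (intro continuous_on_norm continuous_at_imp_continuous_on) auto
    moreover have "compact S" unfolding S_def by (intro compact_Un compact_Icc)
    ultimately obtain s where s: "s \<in> S" "\<forall>t\<in>S. norm (\<psi> t) \<le> norm (\<psi> s)"
      using continuous_attains_sup [of S "\<lambda>t. norm (\<psi> t)"] False by blast
    have "norm (\<psi> s) < 1" using s(1) \<delta> by (intro norm_psi_less_1) (auto simp: S_def)
    then show ?thesis using s(2) by (intro exI [of _ "max (norm (\<psi> s)) (1/2)"]) auto
  qed
  then obtain \<rho> where \<rho>: "0 < \<rho>" "\<rho> < 1" "\<And>t. t \<in> S \<Longrightarrow> norm (\<psi> t) \<le> \<rho>" by blast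
  \<comment> \<open>As |t| is at most \<open>pi / period\<close>, the second entry makes
    \<open>exp (- (c * t\<^sup>2))\<close> at least \<rho> on the outer part.\<close>
  define c where "c = min (\<sigma>2 / 4) (- ln \<rho> / (pi / period)\<^sup>2)"
  have "0 < - ln \<rho> / (pi / period)\<^sup>2" using \<rho> period_pos by (intro divide_pos_pos) auto
  then have "0 < c" using sigma2_pos by (simp add: c_def)
  moreover have "norm (\<psi> t) \<le> exp (- (c * t\<^sup>2))" if t: "\<bar>t\<bar> \<le> pi / period" for t
  proof (cases "\<bar>t\<bar> < \<delta>")
    case True
    show ?thesis
    proof (cases "t = 0")
      case True
      then show ?thesis using norm_psi_le_1 [of t] by simp
    next
      case False
      then have "norm (\<psi> t) \<le> exp (- (\<sigma>2 / 4 * t\<^sup>2))" using small True by blast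
      also have "\<dots> \<le> exp (- (c * t\<^sup>2))"
        unfolding exp_le_cancel_iff neg_le_iff_le c_def
        by (intro mult_right_mono min.cobounded1) simp
      finally show ?thesis .
    qed
  next
    case False
    have "norm (\<psi> t) \<le> \<rho>" using False t by (intro \<rho>(3)) (auto simp: S_def)
    also have "\<rho> = exp (ln \<rho>)" using \<rho>(1) by simp
    also have "\<dots> \<le> exp (- (c * t\<^sup>2))"
    proof -
      have "c \<le> - ln \<rho> / (pi / period)\<^sup>2" unfolding c_def by (rule min.cobounded2)
      moreover have "t\<^sup>2 \<le> (pi / period)\<^sup>2" using t by (simp flip: abs_le_square_iff)
      ultimately have "c * t\<^sup>2 \<le> (- ln \<rho> / (pi / period)\<^sup>2) * (pi / period)\<^sup>2"
        using \<open>0 < c\<close> by (intro mult_mono) auto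
      also have "\<dots> = - ln \<rho>" using period_pos by simp
      finally show ?thesis by simp
    qed
    finally show ?thesis .
  qed
  ultimately show ?thesis by blast
qed

section \<open>Fourier inversion and the limit of the rescaled integrals\<close>

definition "I m k = (LBINT t. indicator {-(pi / period)..pi / period} t *\<^sub>R (\<psi> t ^ m * cis (k * t)))"

text \<open>Integration over this interval isolates the index \<open>j\<close>: other multiples of
  the period contribute an integral over full oscillations, which is zero, and coefficients off the
  lattice vanish themselves.\<close>

lemma q_eq_integral:
  assumes "period dvd j"
  shows "complex_of_real (q m j) = period / (2 * pi) * I m (real m - real j)"
proof -
  define L where "L = pi / period"
  have L: "0 < L" using period_pos by (simp add: L_def)
  define f where "f i t = indicator {-L..L} t *\<^sub>R (complex_of_real (q m i) * cis ((real i - real j) * t))" for i t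
  have f_eq: "f i t = complex_of_real (q m i) * (indicator {-L..L} t *\<^sub>R cis ((real i - real j) * t))" for i t
    by (simp add: f_def)
  have f_int: "integrable lborel (\<lambda>t. indicator {-L..L} t *\<^sub>R cis ((real i - real j) * t))" for i
    by (rule borel_integrable_compact) (auto intro!: continuous_intros simp: cis_conv_exp)
  have sums_t: "(\<lambda>i. f i t) sums (indicator {-L..L} t *\<^sub>R (\<psi> t ^ m * cis ((real m - real j) * t)))" for t
  proof -
    have "(\<lambda>i. complex_of_real (q m i) * cis t ^ i) sums (F (cis t) ^ m)" using q_sums [of "cis t" m] by simp
    have eq: "real i * t + - (real j * t) = (real i - real j) * t" for i by (simp add: algebra_simps)
    from sums_mult2 [OF \<open>_ sums _\<close>, of "cis (- (real j * t))"]
    have "(\<lambda>i. complex_of_real (q m i) * cis ((real i - real j) * t)) sums (F (cis t) ^ m * cis (- (real j * t)))"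
      by (simp only: mult.assoc cis_power_mult eq)
    moreover have "F (cis t) ^ m * cis (- (real j * t)) = \<psi> t ^ m * cis ((real m - real j) * t)"
    proof -
      have "cis (- (real j * t)) = cis (- t) ^ m * cis ((real m - real j) * t)"
        unfolding cis_power_mult by (simp add: algebra_simps)
      then show ?thesis by (simp add: psi_eq power_mult_distrib)
    qed
    ultimately have "(\<lambda>i. complex_of_real (q m i) * cis ((real i - real j) * t)) sums
        (\<psi> t ^ m * cis ((real m - real j) * t))" by simp
    then show ?thesis unfolding f_def by (rule sums_scaleR_right)
  qed
  have int_f: "integral\<^sup>L lborel (f i) =
      complex_of_real (q m i) * (LBINT t. indicator {-L..L} t *\<^sub>R cis ((real i - real j) * t))" for i
    unfolding f_eq by (rule integral_mult_right_zero)
  have norm_f: "norm (f i t) = q m i * indicator {-L..L} t" for i t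
    using q_nonneg by (simp add: f_def norm_mult)
  have q_summable: "summable (q m)" using q_sums [of 1 m] q_nonneg by simp
  have "(\<lambda>i. integral\<^sup>L lborel (f i)) sums (LBINT t. (\<Sum>i. f i t))"
  proof (rule sums_integral)
    show "integrable lborel (f i)" for i unfolding f_eq using f_int by (intro integrable_mult_right)
    show "AE t in lborel. summable (\<lambda>i. norm (f i t))"
      unfolding norm_f using q_summable by (intro AE_I2 summable_mult2)
    show "summable (\<lambda>i. LBINT t. norm (f i t))"
      unfolding norm_f using q_summable by (simp add: summable_mult2)
  qed
  moreover have "(LBINT t. (\<Sum>i. f i t)) = I m (real m - real j)"
    using sums_unique [OF sums_t] by (simp add: I_def L_def)
  moreover have "integral\<^sup>L lborel (f i) = (if i = j then complex_of_real (q m j * (2 * L)) else 0)" for i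
  proof (cases "i = j \<or> q m i = 0")
    case True
    then show ?thesis
      using int_f [of i] integral_cis_Icc [of L 0] L by (auto simp: scaleR_conv_of_real mult_ac)
  next
    case False
    then have "period dvd i" using period_dvd by blast
    then obtain a b where ab: "i = period * a" "j = period * b" using assms by (auto elim!: dvdE)
    have "(real i - real j) * L = pi * of_int (int a - int b)"
      using period_pos by (simp add: ab L_def field_simps)
    then have "sin ((real i - real j) * L) = 0" using sin_integer_2pi sin_npi_int by metis
    then show ?thesis using int_f [of i] integral_cis_Icc [of L "real i - real j"] L False by auto
  qed
  ultimately have "(\<lambda>i. if i = j then complex_of_real (q m j * (2 * L)) else 0) sums I m (real m - real j)"
    by simp
  then have "I m (real m - real j) = complex_of_real (q m j * (2 * L))"
    by (rule sums_unique2 [OF _ sums_single])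
  then show ?thesis using period_pos by (simp add: L_def)
qed

text \<open>With u = t sqrt m the integrand tends to a Gaussian. The offset \<open>k\<close> is
  fixed, so its phase tends to 1 and does not show in the limit.\<close>

lemma sqrt_I_tendsto:
  "(\<lambda>m. complex_of_real (sqrt m) * I m k) \<longlonglongrightarrow> complex_of_real (sqrt (2 * pi / \<sigma>2))"
proof -
  define L where "L = pi / period"
  have L: "0 < L" using period_pos by (simp add: L_def)
  obtain c where c: "0 < c" "\<And>t. \<bar>t\<bar> \<le> L \<Longrightarrow> norm (\<psi> t) \<le> exp (- (c * t\<^sup>2))"
    using psi_gauss_bound by (auto simp: L_def)
  \<comment> \<open>\<open>Suc m\<close> avoids a division by zero; the shift of the index is undone
    at the end.\<close>
  define g where "g m u = indicator {-L..L} (u / sqrt (Suc m)) *\<^sub>R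
      (\<psi> (u / sqrt (Suc m)) ^ Suc m * cis (k * (u / sqrt (Suc m))))" for m u
  have [measurable]: "\<psi> \<in> borel_measurable borel"
    using isCont_psi by (intro borel_measurable_continuous_onI continuous_at_imp_continuous_on) auto
  have [measurable]: "cis \<in> borel_measurable borel"
    by (intro borel_measurable_continuous_onI) (auto intro!: continuous_intros simp: cis_conv_exp)
  have "(\<lambda>m. LBINT u. g m u) \<longlonglongrightarrow> (LBINT u. complex_of_real (exp (- (\<sigma>2 / 2 * u\<^sup>2))))"
  proof (rule integral_dominated_convergence [where w = "\<lambda>u. exp (- (c * u\<^sup>2))"])
    show "integrable lborel (\<lambda>u. exp (- (c * u\<^sup>2)))" by (rule integral_gauss) (rule c)
    show "AE u in lborel. norm (g m u) \<le> exp (- (c * u\<^sup>2))" for m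
    proof (rule AE_I2)
      fix u
      have "norm (\<psi> (u / sqrt (Suc m)) ^ Suc m) \<le> exp (- (c * u\<^sup>2))" if "\<bar>u / sqrt (Suc m)\<bar> \<le> L"
      proof -
        have "norm (\<psi> (u / sqrt (Suc m)) ^ Suc m) \<le> exp (- (c * (u / sqrt (Suc m))\<^sup>2)) ^ Suc m"
          unfolding norm_power using c(2) [OF that] by (intro power_mono) auto
        also have "\<dots> = exp (- (c * u\<^sup>2))"
          unfolding exp_of_nat_mult [symmetric] by (simp add: power_divide)
        finally show ?thesis .
      qed
      then show "norm (g m u) \<le> exp (- (c * u\<^sup>2))"
        by (auto simp: g_def indicator_def norm_mult abs_le_iff)
    qed
    show "AE u in lborel. (\<lambda>m. g m u) \<longlonglongrightarrow> complex_of_real (exp (- (\<sigma>2 / 2 * u\<^sup>2)))"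
    proof (rule AE_I2)
      fix u
      define s where "s m = u / sqrt (Suc m)" for m
      have s_lim: "s \<longlonglongrightarrow> 0"
        unfolding s_def by real_asymp
      have "eventually (\<lambda>m. \<bar>s m\<bar> \<le> L) sequentially"
        using order_tendstoD(2) [OF tendsto_rabs [OF s_lim], of L] L by (auto elim: eventually_mono)
      then have ind: "eventually (\<lambda>m. \<psi> (s m) ^ Suc m * cis (k * s m) = g m u) sequentially"
      proof (rule eventually_mono)
        fix m assume "\<bar>s m\<bar> \<le> L"
        then have "s m \<in> {-L..L}" unfolding atLeastAtMost_iff abs_le_iff by linarith
        then show "\<psi> (s m) ^ Suc m * cis (k * s m) = g m u"
          unfolding g_def s_def [symmetric] by simp
      qed
      \<comment> \<open>Powers of numbers in the closed unit disc differ by at most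
        \<open>Suc m\<close> times the difference of the bases, and this factor turns
        \<open>(s m)\<^sup>2\<close> into \<open>u\<^sup>2\<close>.\<close>
      have "(\<lambda>m. \<psi> (s m) ^ Suc m - complex_of_real ((1 + - (\<sigma>2 / 2 * u\<^sup>2) / Suc m) ^ Suc m)) \<longlonglongrightarrow> 0"
      proof (rule Lim_null_comparison)
        have "(\<lambda>m. err (s m)) \<longlonglongrightarrow> 0"
        proof (cases "u = 0")
          case True
          then show ?thesis by (simp add: s_def err_def)
        next
          case False
          then have "filterlim s (at 0) sequentially"
            using s_lim by (auto simp: filterlim_at s_def)
          then show ?thesis by (rule filterlim_compose [OF err_tendsto_0])
        qed
        then show "(\<lambda>m. u\<^sup>2 * err (s m)) \<longlonglongrightarrow> 0" by (rule tendsto_mult_right_zero)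
        have "eventually (\<lambda>m. (s m)\<^sup>2 * \<sigma>2 / 2 < 1) sequentially"
        proof (rule order_tendstoD)
          show "(\<lambda>m. (s m)\<^sup>2 * \<sigma>2 / 2) \<longlonglongrightarrow> 0\<^sup>2 * \<sigma>2 / 2" by (intro tendsto_intros s_lim) simp
        qed simp
        then show "eventually (\<lambda>m. norm (\<psi> (s m) ^ Suc m -
            complex_of_real ((1 + - (\<sigma>2 / 2 * u\<^sup>2) / Suc m) ^ Suc m)) \<le> u\<^sup>2 * err (s m)) sequentially"
        proof (rule eventually_mono)
          fix m assume m: "(s m)\<^sup>2 * \<sigma>2 / 2 < 1"
          have sm: "(s m)\<^sup>2 = u\<^sup>2 / Suc m" by (simp add: s_def power_divide)
          have eq: "1 + - (\<sigma>2 / 2 * u\<^sup>2) / Suc m = 1 - (s m)\<^sup>2 * \<sigma>2 / 2" by (simp add: sm mult_ac)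
          have "norm (complex_of_real (1 - (s m)\<^sup>2 * \<sigma>2 / 2)) \<le> 1"
            unfolding norm_of_real using m sigma2_pos by (simp add: abs_le_iff)
          then have "norm (\<psi> (s m) ^ Suc m - complex_of_real (1 - (s m)\<^sup>2 * \<sigma>2 / 2) ^ Suc m)
              \<le> Suc m * norm (\<psi> (s m) - complex_of_real (1 - (s m)\<^sup>2 * \<sigma>2 / 2))"
            by (rule norm_power_diff [OF norm_psi_le_1])
          also have "\<dots> \<le> Suc m * ((s m)\<^sup>2 * err (s m))"
            by (intro mult_left_mono psi_approx) simp
          also have "\<dots> = u\<^sup>2 * err (s m)" by (simp add: sm)
          finally show "norm (\<psi> (s m) ^ Suc m -
            complex_of_real ((1 + - (\<sigma>2 / 2 * u\<^sup>2) / Suc m) ^ Suc m)) \<le> u\<^sup>2 * err (s m)"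
            unfolding eq of_real_power .
        qed
      qed
      moreover have "(\<lambda>m. complex_of_real ((1 + - (\<sigma>2 / 2 * u\<^sup>2) / Suc m) ^ Suc m)) \<longlonglongrightarrow>
          complex_of_real (exp (- (\<sigma>2 / 2 * u\<^sup>2)))"
        by (intro tendsto_of_real LIMSEQ_Suc [OF tendsto_exp_limit_sequentially])
      ultimately have "(\<lambda>m. \<psi> (s m) ^ Suc m) \<longlonglongrightarrow> 0 + complex_of_real (exp (- (\<sigma>2 / 2 * u\<^sup>2)))"
        by (rule tendsto_of_diff)
      then have "(\<lambda>m. \<psi> (s m) ^ Suc m) \<longlonglongrightarrow> complex_of_real (exp (- (\<sigma>2 / 2 * u\<^sup>2)))"
        by simp
      moreover have "(\<lambda>m. cis (k * s m)) \<longlonglongrightarrow> cis (k * 0)"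
        unfolding cis_conv_exp by (intro tendsto_intros s_lim)
      ultimately have "(\<lambda>m. \<psi> (s m) ^ Suc m * cis (k * s m)) \<longlonglongrightarrow>
          complex_of_real (exp (- (\<sigma>2 / 2 * u\<^sup>2))) * cis (k * 0)"
        by (rule tendsto_mult)
      then show "(\<lambda>m. g m u) \<longlonglongrightarrow> complex_of_real (exp (- (\<sigma>2 / 2 * u\<^sup>2)))"
        using Lim_transform_eventually [OF _ ind] by simp
    qed
    show "(\<lambda>u. complex_of_real (exp (- (\<sigma>2 / 2 * u\<^sup>2)))) \<in> borel_measurable lborel" by measurable
    show "g m \<in> borel_measurable lborel" for m unfolding g_def by measurable
  qed
  also have "(LBINT u. complex_of_real (exp (- (\<sigma>2 / 2 * u\<^sup>2)))) = complex_of_real (sqrt (2 * pi / \<sigma>2))"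
    using integral_gauss(2) [of "\<sigma>2 / 2"] sigma2_pos by (simp add: mult.commute)
  also have "(\<lambda>m. LBINT u. g m u) = (\<lambda>m. complex_of_real (sqrt (Suc m)) * I (Suc m) k)"
  proof
    fix m
    have "I (Suc m) k = \<bar>1 / sqrt (Suc m)\<bar> *\<^sub>R (LBINT u. g m u)"
      unfolding I_def g_def L_def
      by (subst lborel_integral_real_affine [of "1 / sqrt (Suc m)" _ 0]) auto
    then show "(LBINT u. g m u) = complex_of_real (sqrt (Suc m)) * I (Suc m) k"
      by (simp add: scaleR_conv_of_real del: of_nat_Suc)
  qed
  finally show ?thesis by (rule LIMSEQ_imp_Suc)
qed

text \<open>The lattice span times the density at 0 of the centred Gaussian of variance
  \<open>\<sigma>2\<close>.\<close>

definition "\<kappa> = period / sqrt (2 * pi * \<sigma>2)"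

text \<open>Unlike \<open>sqrt m * q m j\<close>, this converges along all \<open>m\<close>. The two
  agree where the period divides \<open>j\<close>, so divisibility can be kept out of the limit
  arguments.\<close>

definition "J m k = sqrt m * (period / (2 * pi) * Re (I m k))"

lemma kappa_pos: "0 < \<kappa>"
  using period_pos sigma2_pos by (simp add: \<kappa>_def)

lemma J_tendsto: "(\<lambda>m. J m k) \<longlonglongrightarrow> \<kappa>"
proof -
  have "(\<lambda>m. period / (2 * pi) * Re (complex_of_real (sqrt m) * I m k)) \<longlonglongrightarrow>
      period / (2 * pi) * Re (complex_of_real (sqrt (2 * pi / \<sigma>2)))"
    by (intro tendsto_intros sqrt_I_tendsto)
  moreover have "period / (2 * pi) * sqrt (2 * pi / \<sigma>2) = \<kappa>"
    using sigma2_pos by (simp add: \<kappa>_def real_sqrt_divide real_sqrt_mult field_simps)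
  ultimately show ?thesis by (simp add: J_def mult_ac)
qed

lemma sqrt_q_eq: "period dvd j \<Longrightarrow> sqrt m * q m j = J m (real m - real j)"
  using arg_cong [OF q_eq_integral [of j m], of Re] by (simp add: J_def)

end

section \<open>Sizes of Galton--Watson trees\<close>

lemma inverse_three_halves_le:
  fixes x :: real assumes "1 \<le> x"
  shows "1 / ((x + 1) * sqrt (x + 1)) \<le> 2 / sqrt x - 2 / sqrt (x + 1)"
proof -
  define a b where "a = sqrt x" and "b = sqrt (x + 1)"
  have ab: "0 < a" "a \<le> b" "x + 1 = b\<^sup>2" "b\<^sup>2 - a\<^sup>2 = 1" using assms by (auto simp: a_def b_def)
  have "(b - a) * (b + a) = 1" using ab(4) by (simp add: power2_eq_square algebra_simps)
  then have "2 / a - 2 / b = 2 / ((b + a) * a * b)" using ab by (simp add: divide_simps) (simp add: algebra_simps)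
  also have "\<dots> \<ge> 2 / ((b + b) * b * b)"
    using ab by (intro divide_left_mono mult_mono) auto
  finally show ?thesis using ab by (simp add: power2_eq_square flip: a_def b_def)
qed

lemma sum_inverse_three_halves_le:
  assumes "1 \<le> a"
  shows "(\<Sum>k\<in>{a<..n}. 1 / (real k * sqrt k)) \<le> 2 / sqrt a"
proof -
  have "(\<Sum>k\<in>{a<..n}. 1 / (real k * sqrt k)) \<le> 2 / sqrt a - 2 / sqrt (max a n)"
  proof (induction n)
    case (Suc n)
    show ?case
    proof (cases "a \<le> n")
      case True
      then have "{a<..Suc n} = insert (Suc n) {a<..n}" by auto
      then show ?thesis
        using Suc inverse_three_halves_le [of "real n"] True assms by (simp add: add.commute max_def)
    next
      case False
      then show ?thesis by (auto simp: max_def le_Suc_eq)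
    qed
  qed simp
  then show ?thesis by (rule order_trans) simp
qed

lemma sum_inverse_sqrt_le: "(\<Sum>k=1..n. 1 / sqrt (real k)) \<le> 2 * sqrt n"
proof (induction n)
  case (Suc n)
  define a b where "a = sqrt (real n)" and "b = sqrt (real (Suc n))"
  have ab: "0 \<le> a" "a \<le> b" "0 < b" "b\<^sup>2 - a\<^sup>2 = 1" by (auto simp: a_def b_def)
  have "1 = (b - a) * (b + a)" using ab(4) by (simp add: power2_eq_square algebra_simps)
  also have "\<dots> \<le> (b - a) * (b + b)" using ab by (intro mult_left_mono) auto
  finally have "1 / b \<le> 2 * b - 2 * a" using ab by (simp add: field_simps)
  then show ?case using Suc by (simp add: a_def b_def)
qed simp

lemma three_halves_asymp:
  fixes c :: real assumes "0 < c"
  shows "(\<lambda>k::nat. real k * sqrt k * (2 / sqrt (real k) - 2 / sqrt (real k + c))) \<longlonglongrightarrow> c"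
  using assms by real_asymp

lemma sqrt_shift_asymp:
  fixes c :: real
  shows "((\<lambda>x. sqrt x * (2 / sqrt (x + c))) \<longlongrightarrow> 2) at_top"
  by real_asymp

text \<open>Select a maximizer in every \<open>S n\<close>: the limit along that one selector is the
  uniform limit.\<close>

lemma bounded_selectors_imp_uniform:
  fixes f :: "'a \<Rightarrow> 'b \<Rightarrow> real"
  assumes S: "\<And>n. finite (S n)" "\<And>n. S n \<noteq> {}"
    and lim: "\<And>g. (\<And>n. g n \<in> S n) \<Longrightarrow> ((\<lambda>n. f n (g n)) \<longlongrightarrow> 0) F"
  shows "\<exists>\<delta>. (\<delta> \<longlongrightarrow> 0) F \<and> (\<forall>n. \<forall>y\<in>S n. \<bar>f n y\<bar> \<le> \<delta> n)"
proof -
  define \<delta> where "\<delta> n = Max ((\<lambda>y. \<bar>f n y\<bar>) ` S n)" for n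
  have "\<delta> n \<in> (\<lambda>y. \<bar>f n y\<bar>) ` S n" for n
    unfolding \<delta>_def using S by (intro Max_in) auto
  then have "\<exists>y\<in>S n. \<delta> n = \<bar>f n y\<bar>" for n by blast
  then obtain g where g: "\<And>n. g n \<in> S n" "\<And>n. \<delta> n = \<bar>f n (g n)\<bar>" by metis
  have "((\<lambda>n. \<bar>f n (g n)\<bar>) \<longlongrightarrow> 0) F" using tendsto_rabs [OF lim [OF g(1)]] by simp
  then have "(\<delta> \<longlongrightarrow> 0) F" using g(2) by presburger
  moreover have "\<bar>f n y\<bar> \<le> \<delta> n" if "y \<in> S n" for n y
    using that S by (auto simp: \<delta>_def)
  ultimately show ?thesis by blast
qed

lemma eventually_admissible:
  "eventually P (admissible_sizes \<phi>) \<longleftrightarrow>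
     eventually (\<lambda>n. family_trees \<phi> n \<noteq> {} \<longrightarrow> P n) sequentially"
  by (simp add: admissible_sizes_def eventually_inf_principal)

lemma admissible_le: "admissible_sizes \<phi> \<le> sequentially"
  by (simp add: admissible_sizes_def)

context simply_generated
begin

text \<open>By the cycle lemma, this is the probability that a Galton--Watson tree has size \<open>k\<close>.\<close>

definition "size_prob k = q k (k - 1) / real k"

lemma size_prob_nonneg: "0 \<le> size_prob k"
  using q_nonneg by (simp add: size_prob_def)

lemma size_prob_le_1: "size_prob k \<le> 1"
proof (cases "k = 0")
  case False
  then have "size_prob k \<le> q k (k - 1) / 1" unfolding size_prob_def using q_nonneg by (intro divide_left_mono) auto
  then show ?thesis using q_le_1 [of k "k - 1"] by simp
qed (simp add: size_prob_def)

lemma admissible_period: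
  assumes "family_trees \<phi> n \<noteq> {}" shows "0 < n" "period dvd n - 1" "0 < q n (n - 1)"
proof -
  obtain t where t: "t \<in> family_trees \<phi> n" using assms by blast
  then show "0 < n" using tree_size_pos [of t] by (auto simp: family_trees_def)
  then have "0 < card (words \<phi> n (n - 1))"
    using card_words_trees [of n \<phi>] assms finite_card_family_trees(1) by (simp add: card_gt_0_iff)
  then show "0 < q n (n - 1)" using tau Phi_pos by (simp add: q_def)
  then show "period dvd n - 1" using period_dvd [of n "n - 1"] by simp
qed

lemma tendsto_sqrt_q_admissible: "((\<lambda>n. sqrt n * q n (n - 1)) \<longlongrightarrow> \<kappa>) (admissible_sizes \<phi>)"
proof (rule Lim_transform_eventually)
  show "((\<lambda>n. J n 1) \<longlongrightarrow> \<kappa>) (admissible_sizes \<phi>)"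
    by (rule tendsto_mono [OF admissible_le J_tendsto])
  have "J n 1 = sqrt n * q n (n - 1)" if "family_trees \<phi> n \<noteq> {}" for n
    using sqrt_q_eq [of "n - 1" n] admissible_period [OF that] by (simp add: of_nat_diff)
  then show "eventually (\<lambda>n. J n 1 = sqrt n * q n (n - 1)) (admissible_sizes \<phi>)"
    by (simp add: eventually_admissible)
qed

text \<open>Removing blocks of total size o(n) leaves m asymptotic to n, so numerator and
  denominator have the same local limit. The values \<open>s = 0\<close> and \<open>s = 1\<close>
  belong to one and two removed blocks.\<close>

lemma ratio_uniform:
  fixes K :: "nat \<Rightarrow> nat"
  assumes K: "(\<lambda>n. real (K n) / real n) \<longlonglongrightarrow> 0"
  shows "\<exists>\<delta>. (\<delta> \<longlongrightarrow> 0) (admissible_sizes \<phi>) \<and>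
    (\<forall>n m s. n - K n \<le> m \<longrightarrow> m \<le> n \<longrightarrow> s \<le> 1 \<longrightarrow> period dvd m + s \<longrightarrow>
       \<bar>q m (m + s) / q n (n - 1) - 1\<bar> \<le> \<delta> n)"
proof -
  define S where "S n = {n - K n..n} \<times> {0..1::nat}" for n
  define f where "f n = (\<lambda>(m, s). if period dvd m + s then q m (m + s) / q n (n - 1) - 1 else 0)" for n
  have "\<exists>\<delta>. (\<delta> \<longlongrightarrow> 0) (admissible_sizes \<phi>) \<and> (\<forall>n. \<forall>y\<in>S n. \<bar>f n y\<bar> \<le> \<delta> n)"
  proof (rule bounded_selectors_imp_uniform)
    show "finite (S n)" "S n \<noteq> {}" for n by (auto simp: S_def)
    fix g assume g: "\<And>n. g n \<in> S n"
    define m s where "m n = fst (g n)" and "s n = snd (g n)" for n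
    have ms: "n - K n \<le> m n" "m n \<le> n" "s n = 0 \<or> s n = 1" for n
      using g [of n] by (auto simp: S_def m_def s_def)
    have gn: "g n = (m n, s n)" for n by (simp add: m_def s_def)
    have low: "1 - real (K n) / real n \<le> real (m n) / real n" if "0 < n" for n
    proof -
      have "real n / real n \<le> (real (K n) + real (m n)) / real n"
        using ms(1) [of n] by (intro divide_right_mono) linarith+
      then show ?thesis using that by (simp add: add_divide_distrib)
    qed
    have mn: "(\<lambda>n. real (m n) / real n) \<longlonglongrightarrow> 1"
    proof (rule tendsto_sandwich)
      show "(\<lambda>n. 1 - real (K n) / real n) \<longlonglongrightarrow> 1" using tendsto_diff [OF tendsto_const K] by simp
      show "(\<lambda>n. 1) \<longlonglongrightarrow> (1::real)" by simp
      show "eventually (\<lambda>n. 1 - real (K n) / real n \<le> real (m n) / real n) sequentially"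
        using eventually_gt_at_top [of 0] by eventually_elim (rule low)
      show "eventually (\<lambda>n. real (m n) / real n \<le> 1) sequentially"
        using ms(2) by (auto simp: divide_le_eq_1 intro!: always_eventually)
    qed
    have "filterlim (\<lambda>n. real (m n) / real n * real n) at_top sequentially"
      by (rule filterlim_tendsto_pos_mult_at_top [OF mn]) (auto simp: filterlim_real_sequentially)
    then have "filterlim (\<lambda>n. real (m n)) at_top sequentially"
    proof (rule filterlim_mono_eventually)
      show "eventually (\<lambda>n. real (m n) / real n * real n = real (m n)) sequentially"
        using eventually_gt_at_top [of 0] by eventually_elim simp
    qed auto
    then have m_top: "filterlim m at_top sequentially"
      by (simp add: filterlim_sequentially_iff_filterlim_real)
    \<comment> \<open>The default value is the limit \<open>\<kappa>\<close>, so that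
      \<open>U\<close> converges along all \<open>n\<close> although the formula is meaningful only
      on the lattice.\<close>
    define U where "U n = (if period dvd m n + s n then sqrt (m n) * q (m n) (m n + s n) else \<kappa>)" for n
    have "U \<longlonglongrightarrow> \<kappa>"
    proof -
      have "(\<lambda>n. \<bar>J (m n) 0 - \<kappa>\<bar> + \<bar>J (m n) (-1) - \<kappa>\<bar>) \<longlonglongrightarrow> \<bar>\<kappa> - \<kappa>\<bar> + \<bar>\<kappa> - \<kappa>\<bar>"
        by (intro tendsto_intros filterlim_compose [OF J_tendsto m_top])
      moreover have "norm (U n - \<kappa>) \<le> \<bar>J (m n) 0 - \<kappa>\<bar> + \<bar>J (m n) (-1) - \<kappa>\<bar>" for n
        using ms(3) [of n] sqrt_q_eq [of "m n + s n" "m n"] by (auto simp: U_def)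
      ultimately have "(\<lambda>n. U n - \<kappa>) \<longlonglongrightarrow> 0"
        by (intro Lim_null_comparison [of "\<lambda>n. U n - \<kappa>"]) auto
      then show ?thesis by (rule Lim_null [THEN iffD2])
    qed
    then have "((\<lambda>n. U n / (sqrt n * q n (n - 1)) * inverse (sqrt (real (m n) / real n)) - 1)
        \<longlongrightarrow> \<kappa> / \<kappa> * inverse (sqrt 1) - 1) (admissible_sizes \<phi>)"
      using kappa_pos
      by (intro tendsto_intros tendsto_sqrt_q_admissible tendsto_mono [OF admissible_le] mn) auto
    then have lim: "((\<lambda>n. U n / (sqrt n * q n (n - 1)) * inverse (sqrt (real (m n) / real n)) - 1)
        \<longlongrightarrow> 0) (admissible_sizes \<phi>)"
      using kappa_pos by simp
    show "((\<lambda>n. f n (g n)) \<longlongrightarrow> 0) (admissible_sizes \<phi>)"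
    proof (rule Lim_null_comparison [OF _ tendsto_rabs_zero [OF lim]])
      have "eventually (\<lambda>n. 1 \<le> m n) sequentially" using m_top by (simp add: filterlim_at_top)
      then show "eventually (\<lambda>n. norm (f n (g n)) \<le>
          \<bar>U n / (sqrt n * q n (n - 1)) * inverse (sqrt (real (m n) / real n)) - 1\<bar>) (admissible_sizes \<phi>)"
        unfolding eventually_admissible using eventually_gt_at_top [of 0]
        by eventually_elim (auto simp: f_def gn U_def real_sqrt_divide)
    qed
  qed
  then obtain \<delta> where \<delta>: "(\<delta> \<longlongrightarrow> 0) (admissible_sizes \<phi>)" "\<And>n y. y \<in> S n \<Longrightarrow> \<bar>f n y\<bar> \<le> \<delta> n"
    by blast
  have "\<bar>q m (m + s) / q n (n - 1) - 1\<bar> \<le> \<delta> n"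
    if "n - K n \<le> m" "m \<le> n" "s \<le> 1" "period dvd m + s" for n m s
    using \<delta>(2) [of "(m, s)" n] that by (auto simp: S_def f_def)
  then show ?thesis using \<delta>(1) by blast
qed

text \<open>A convergent sequence is bounded. With \<open>real m + 1\<close> under the root the
  estimate includes \<open>m = 0\<close>, which occurs when a block fills the whole word.\<close>

lemma q_upper: "\<exists>C>0. \<forall>m. q m m \<le> C / sqrt (real m + 1) \<and> q m (m - 1) \<le> C / sqrt (real m + 1)"
proof -
  obtain C0 C1 where C: "0 < C0" "\<And>m. \<bar>J m 0\<bar> \<le> C0" "0 < C1" "\<And>m. \<bar>J m 1\<bar> \<le> C1"
    using J_tendsto [THEN convergentI, THEN convergent_imp_Bseq] unfolding Bseq_def by (metis real_norm_def)
  define C where "C = 2 * (C0 + C1 + 1)"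
  have "q m j \<le> C / sqrt (real m + 1)" if j: "j = m \<or> j = m - 1" for m j
  proof (cases "m = 0 \<or> \<not> period dvd j")
    case True
    then have "q m j \<le> 1" "m = 0 \<or> q m j = 0" using q_le_1 period_dvd by auto
    then show ?thesis using C by (auto simp: C_def)
  next
    case False
    then have "sqrt m * q m j = J m (real m - real j)" using sqrt_q_eq by simp
    also have "\<dots> \<le> C0 + C1 + 1"
      using j False C(1,3) C(2) [of m] C(4) [of m] by (auto simp: of_nat_diff)
    finally have le: "sqrt m * q m j \<le> C0 + C1 + 1" .
    have "sqrt (real m + 1) * q m j \<le> sqrt (4 * m) * q m j"
      using False q_nonneg by (intro mult_right_mono) auto
    also have "\<dots> = 2 * (sqrt m * q m j)" by (simp add: real_sqrt_mult)
    also have "\<dots> \<le> C" using le by (simp add: C_def)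
    finally show ?thesis by (simp add: pos_le_divide_eq mult.commute)
  qed
  then show ?thesis using C(1,3) by (intro exI [of _ C]) (auto simp: C_def)
qed

text \<open>Here \<open>n - k\<close> may be small, so the local limit says nothing about the ratio.
  Upper bounds of the right order are summed instead.\<close>

lemma large_blocks:
  "\<exists>C. eventually (\<lambda>n. \<forall>K\<ge>1. (\<Sum>k\<in>{K<..n}. size_prob k * (q (n - k) (n - k) / q n (n - 1)))
      \<le> C * (1 / sqrt K + 1 / sqrt n)) (admissible_sizes \<phi>)"
proof -
  obtain C where C: "0 < C" "\<And>m. q m m \<le> C / sqrt (real m + 1)" "\<And>m. q m (m - 1) \<le> C / sqrt (real m + 1)"
    using q_upper by blast
  have "eventually (\<lambda>n. \<kappa> / 2 < sqrt n * q n (n - 1)) (admissible_sizes \<phi>)"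
    using tendsto_sqrt_q_admissible kappa_pos by (intro order_tendstoD) auto
  moreover have "eventually (\<lambda>n. 0 < n) (admissible_sizes \<phi>)"
    using eventually_gt_at_top [of 0] admissible_le by (rule filter_leD [rotated])
  ultimately have "eventually (\<lambda>n. \<forall>K\<ge>1. (\<Sum>k\<in>{K<..n}. size_prob k * (q (n - k) (n - k) / q n (n - 1)))
      \<le> (C\<^sup>2 * (2 / \<kappa>) * 12) * (1 / sqrt K + 1 / sqrt n)) (admissible_sizes \<phi>)"
  proof eventually_elim
    case (elim n)
    have qn: "0 < q n (n - 1)" using less_trans [OF _ elim(1), of 0] kappa_pos elim(2) by (simp add: zero_less_mult_iff)
    have inv: "1 / q n (n - 1) \<le> 2 / \<kappa> * sqrt n"
      using elim kappa_pos qn by (simp add: field_simps)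
    show ?case
    proof (intro allI impI)
      fix K :: nat assume K: "1 \<le> K"
      have "(\<Sum>k\<in>{K<..n}. size_prob k * (q (n - k) (n - k) / q n (n - 1))) \<le>
        (\<Sum>k\<in>{K<..n}. C\<^sup>2 * (2 / \<kappa>) * (2 * (1 / (real k * sqrt k)) + 4 / n * (1 / sqrt (real (n - k) + 1))))"
      proof (rule sum_mono)
        fix k assume k: "k \<in> {K<..n}"
        have size_prob: "size_prob k \<le> C * (1 / (real k * sqrt k))"
        proof -
          have "size_prob k \<le> (C / sqrt (real k + 1)) / real k"
            unfolding size_prob_def using C(3) by (intro divide_right_mono) auto
          also have "\<dots> \<le> (C / sqrt (real k)) / real k"
            using C(1) k by (intro divide_right_mono divide_left_mono) auto
          finally show ?thesis by (simp add: mult.commute)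
        qed
        have "size_prob k * (q (n - k) (n - k) / q n (n - 1)) = size_prob k * q (n - k) (n - k) * (1 / q n (n - 1))" by simp
        also have "\<dots> \<le> (C * (1 / (real k * sqrt k))) * (C / sqrt (real (n - k) + 1)) * (2 / \<kappa> * sqrt n)"
          using size_prob C inv size_prob_nonneg q_nonneg kappa_pos by (intro mult_mono mult_nonneg_nonneg) auto
        also have "\<dots> = C\<^sup>2 * (2 / \<kappa>) * ((1 / (real k * sqrt k)) * (1 / sqrt (real (n - k) + 1)) * sqrt n)"
          by (simp only: divide_inverse power2_eq_square mult_ac mult_1_left mult_1_right)
        also have "\<dots> \<le> C\<^sup>2 * (2 / \<kappa>) * (2 * (1 / (real k * sqrt k)) + 4 / n * (1 / sqrt (real (n - k) + 1)))"
        proof (intro mult_left_mono)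
          define x y where "x = 1 / (real k * sqrt k)" and "y = 1 / sqrt (real (n - k) + 1)"
          have xy: "0 \<le> x" "0 \<le> y" by (auto simp: x_def y_def)
          have "x * y * sqrt n \<le> 2 * x + 4 / n * y"
          \<comment> \<open>Either \<open>n - k\<close> or \<open>k\<close> is at least of order
            \<open>n\<close>, and the corresponding factor absorbs \<open>sqrt n\<close>. The first
            case yields the term with \<open>sqrt K\<close>, the second the term with
            \<open>sqrt n\<close>.\<close>
          proof (cases "2 * k \<le> n")
            case True
            then have "real n \<le> 4 * (real (n - k) + 1)" by (simp add: of_nat_diff)
            then have "sqrt n \<le> sqrt (4 * (real (n - k) + 1))" by (rule real_sqrt_le_mono)
            then have "sqrt n \<le> 2 * sqrt (real (n - k) + 1)" by (simp only: real_sqrt_mult real_sqrt_four)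
            then have "y * sqrt n \<le> 2" by (simp add: y_def divide_le_eq)
            then have "x * (y * sqrt n) \<le> x * 2" using xy by (intro mult_left_mono)
            moreover have "0 \<le> 4 / n * y" using xy by simp
            ultimately show ?thesis by (simp only: mult.assoc mult.commute [of x 2])
          next
            case False
            then have "sqrt n \<le> sqrt (4 * k)" by (intro real_sqrt_le_mono) linarith
            then have s: "sqrt n \<le> 2 * sqrt k" by (simp add: real_sqrt_mult)
            have "x * sqrt n \<le> 4 / n"
            proof -
              have "sqrt n * real n \<le> (2 * sqrt k) * (2 * real k)"
                using False s by (intro mult_mono) auto
              then show ?thesis using elim(2) k by (simp add: x_def field_simps)
            qed
            then have "x * sqrt n * y \<le> 4 / n * y" using xy by (intro mult_right_mono)
            then show ?thesis using xy by (simp add: mult.commute mult.left_commute)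
          qed
          then show "(1 / (real k * sqrt k)) * (1 / sqrt (real (n - k) + 1)) * sqrt n \<le>
            2 * (1 / (real k * sqrt k)) + 4 / n * (1 / sqrt (real (n - k) + 1))"
            by (simp only: x_def y_def)
        qed (use kappa_pos in auto)
        finally show "size_prob k * (q (n - k) (n - k) / q n (n - 1)) \<le>
          C\<^sup>2 * (2 / \<kappa>) * (2 * (1 / (real k * sqrt k)) + 4 / n * (1 / sqrt (real (n - k) + 1)))" .
      qed
      also have "\<dots> = C\<^sup>2 * (2 / \<kappa>) * (2 * (\<Sum>k\<in>{K<..n}. 1 / (real k * sqrt k)) +
          4 / n * (\<Sum>k\<in>{K<..n}. 1 / sqrt (real (n - k) + 1)))"
        by (simp only: sum_distrib_left [symmetric] sum.distrib)
      also have "\<dots> \<le> C\<^sup>2 * (2 / \<kappa>) * (2 * (2 / sqrt K) + 4 / n * (2 * sqrt n))"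
      proof (intro mult_left_mono add_mono)
        show "(\<Sum>k\<in>{K<..n}. 1 / (real k * sqrt k)) \<le> 2 / sqrt K"
          by (rule sum_inverse_three_halves_le [OF K])
        have "(\<Sum>k\<in>{K<..n}. 1 / sqrt (real (n - k) + 1)) \<le> (\<Sum>k\<in>{1..n}. 1 / sqrt (real (n - k) + 1))"
          using K by (intro sum_mono2) auto
        also have "\<dots> = (\<Sum>k=1..n. 1 / sqrt (real k))"
          by (rule sum.reindex_bij_witness [of _ "\<lambda>k. n + 1 - k" "\<lambda>k. n + 1 - k"])
            (auto simp: of_nat_diff Suc_diff_le)
        also have "\<dots> \<le> 2 * sqrt n" by (rule sum_inverse_sqrt_le)
        finally show "(\<Sum>k\<in>{K<..n}. 1 / sqrt (real (n - k) + 1)) \<le> 2 * sqrt n" .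
      qed (use kappa_pos in auto)
      also have "4 / n * (2 * sqrt n) = 8 * (1 / sqrt n)"
        using elim(2) by (simp add: field_simps)
      also have "C\<^sup>2 * (2 / \<kappa>) * (2 * (2 / sqrt K) + 8 * (1 / sqrt n)) \<le> C\<^sup>2 * (2 / \<kappa>) * (12 * (1 / sqrt K + 1 / sqrt n))"
      proof (rule mult_left_mono)
        have "4 * x + 8 * y \<le> 12 * (x + y)" if "0 \<le> x" "0 \<le> y" for x y :: real
          using that by simp
        from this [of "1 / sqrt K" "1 / sqrt n"]
        show "2 * (2 / sqrt K) + 8 * (1 / sqrt n) \<le> 12 * (1 / sqrt K + 1 / sqrt n)" by simp
      qed (use kappa_pos in simp)
      finally show "(\<Sum>k\<in>{K<..n}. size_prob k * (q (n - k) (n - k) / q n (n - 1))) \<le>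
          C\<^sup>2 * (2 / \<kappa>) * 12 * (1 / sqrt K + 1 / sqrt n)" by (simp add: mult.assoc)
    qed
  qed
  then show ?thesis by blast
qed

section \<open>Tail sums of the size distribution\<close>

text \<open>The least number \<open>\<ge> k\<close> that is the size of a tree up to divisibility by the period, for \<open>k \<ge> 1\<close>;
  the sums of \<^term>\<open>size_prob\<close> over intervals are compared with telescoping sums along these numbers.\<close>

definition "next_size k = 1 + period * ((k + period - 2) div period)"

lemma next_size:
  assumes "1 \<le> k"
  shows "k \<le> next_size k" "next_size k \<le> k + period"
    "period dvd k - 1 \<Longrightarrow> next_size k = k \<and> next_size (Suc k) = k + period"
    "\<not> period dvd k - 1 \<Longrightarrow> next_size (Suc k) = next_size k"
proof -
  obtain i where k: "k = Suc i" using assms by (cases k) auto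
  obtain d where d: "period = Suc d" using period_pos by (cases period) auto
  define a b where "a = i div Suc d" and "b = i mod Suc d"
  have i: "i = Suc d * a + b" "b < Suc d" by (simp_all only: a_def b_def mult_div_mod_eq mod_less_divisor zero_less_Suc)
  have n1: "next_size k = 1 + Suc d * (a + (b + d) div Suc d)"
  proof -
    have "Suc i + Suc d - 2 = Suc d * a + (b + d)" using i(1) by simp
    then show ?thesis unfolding next_size_def k d by (simp only: div_mult_self4 nat.distinct not_False_eq_True)
  qed
  have n2: "next_size (Suc k) = 1 + Suc d * (a + 1)"
  proof -
    have "Suc (Suc i) + Suc d - 2 = Suc d * (a + 1) + b" using i(1) by simp
    moreover have "b div Suc d = 0" using i(2) by simp
    ultimately show ?thesis
      unfolding next_size_def k d by (simp only: div_mult_self4 nat.distinct not_False_eq_True add_0_right)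
  qed
  have "period dvd k - 1 \<longleftrightarrow> b = 0" by (simp add: k d b_def dvd_eq_mod_eq_0)
  moreover have "(b + d) div Suc d = (if b = 0 then 0 else 1)"
    using i(2) by (cases b) (auto simp: div_add_self2 div_if)
  ultimately show "k \<le> next_size k" "next_size k \<le> k + period"
    "period dvd k - 1 \<Longrightarrow> next_size k = k \<and> next_size (Suc k) = k + period"
    "\<not> period dvd k - 1 \<Longrightarrow> next_size (Suc k) = next_size k"
    using i(2) unfolding n1 n2 by (auto simp: k d i(1) algebra_simps)
qed

text \<open>A discrete antiderivative adapted to the lattice: \<open>G k - G (Suc k)\<close> is
  about \<open>period / k powr (3/2)\<close> if \<open>period\<close> divides \<open>k - 1\<close>,
  and zero otherwise.\<close>

definition "G k = 2 / sqrt (next_size k)"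

text \<open>The error is relative to the telescoping differences, so it survives summation over any
  range. Off the lattice both sides vanish.\<close>

lemma size_prob_approx:
  assumes "0 < \<epsilon>"
  shows "\<exists>N\<ge>1. \<forall>k\<ge>N. 0 \<le> G k - G (Suc k) \<and>
     \<bar>size_prob k - \<kappa> / period * (G k - G (Suc k))\<bar> \<le> \<epsilon> * (G k - G (Suc k))"
proof -
  define D where "D k = 2 / sqrt (real k) - 2 / sqrt (real k + period)" for k :: nat
  have "(\<lambda>k. real k * sqrt k * D k) \<longlonglongrightarrow> period"
    unfolding D_def using period_pos by (intro three_halves_asymp) simp
  from tendsto_divide [OF J_tendsto [of 1] this]
  have "(\<lambda>k. J k 1 / (real k * sqrt k * D k)) \<longlonglongrightarrow> \<kappa> / period" using period_pos by simp
  then have "eventually (\<lambda>k. \<bar>J k 1 / (real k * sqrt k * D k) - \<kappa> / period\<bar> < \<epsilon>) sequentially"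
    using assms by (auto simp: tendsto_iff dist_real_def)
  then obtain N where N: "\<And>k. N \<le> k \<Longrightarrow> \<bar>J k 1 / (real k * sqrt k * D k) - \<kappa> / period\<bar> < \<epsilon>"
    by (auto simp: eventually_sequentially)
  have "0 \<le> G k - G (Suc k) \<and>
     \<bar>size_prob k - \<kappa> / period * (G k - G (Suc k))\<bar> \<le> \<epsilon> * (G k - G (Suc k))" if "max 1 N \<le> k" for k
  proof (cases "period dvd k - 1")
    case True
    have k: "0 < k" using that by simp
    have D: "0 < D k" using k period_pos by (simp add: D_def field_simps)
    have G: "G k - G (Suc k) = D k" using next_size(3) [of k] True k by (simp add: G_def D_def)
    have "sqrt k * q k (k - 1) = J k 1" using sqrt_q_eq [OF True, of k] k by (simp add: of_nat_diff)
    then have "size_prob k = J k 1 / (real k * sqrt k)" using k by (simp add: size_prob_def field_simps)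
    then have "size_prob k - \<kappa> / period * D k = (J k 1 / (real k * sqrt k * D k) - \<kappa> / period) * D k"
      using D by (simp add: field_simps)
    moreover have "\<bar>(J k 1 / (real k * sqrt k * D k) - \<kappa> / period) * D k\<bar> \<le> \<epsilon> * D k"
      unfolding abs_mult using N [of k] that D by (intro mult_mono) auto
    ultimately show ?thesis using D by (simp add: G)
  next
    case False
    then have "q k (k - 1) = 0" using period_dvd by blast
    then show ?thesis using next_size(4) [of k] False that by (simp add: size_prob_def G_def)
  qed
  then show ?thesis by (intro exI [of _ "max 1 N"]) simp
qed

text \<open>After telescoping, only the two end points remain, and the upper one is negligible
  because \<open>a n\<close> is of smaller order than \<open>b n\<close>.\<close>

lemma tail_sum:
  fixes a b :: "nat \<Rightarrow> nat"
  assumes a: "filterlim a at_top sequentially" and ab: "(\<lambda>n. real (a n) / real (b n)) \<longlonglongrightarrow> 0"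
    and le: "eventually (\<lambda>n. a n \<le> b n) sequentially"
  shows "(\<lambda>n. sqrt (a n) * (\<Sum>k=a n..b n. size_prob k)) \<longlonglongrightarrow> 2 * \<kappa> / period"
proof -
  define X where "X n = sqrt (a n) * (G (a n) - G (Suc (b n)))" for n
  have a_pos: "eventually (\<lambda>n. 1 \<le> a n) sequentially" using a by (simp add: filterlim_at_top)
  have a_real: "filterlim (\<lambda>n. real (a n)) at_top sequentially"
    by (rule filterlim_compose [OF filterlim_real_sequentially a])
  have X1: "(\<lambda>n. sqrt (a n) * G (a n)) \<longlonglongrightarrow> 2"
  proof (rule tendsto_sandwich)
    show "eventually (\<lambda>n. sqrt (real (a n)) * (2 / sqrt (real (a n) + period)) \<le> sqrt (a n) * G (a n)) sequentially"
      using a_pos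
    proof eventually_elim
      case (elim n)
      have "real (next_size (a n)) \<le> real (a n) + period" "0 < next_size (a n)"
        using next_size(1,2) [OF elim] elim by linarith+
      then show ?case unfolding G_def by (intro mult_left_mono divide_left_mono) auto
    qed
    show "eventually (\<lambda>n. sqrt (a n) * G (a n) \<le> 2) sequentially"
      using a_pos
    proof eventually_elim
      case (elim n)
      have "sqrt (a n) \<le> sqrt (next_size (a n))" "0 < next_size (a n)" using next_size(1) [OF elim] elim by auto
      then show ?case by (simp add: G_def divide_le_eq)
    qed
    have "((\<lambda>x. sqrt x * (2 / sqrt (x + period))) \<longlongrightarrow> 2) at_top" by (rule sqrt_shift_asymp)
    then show "(\<lambda>n. sqrt (real (a n)) * (2 / sqrt (real (a n) + period))) \<longlonglongrightarrow> 2"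
      by (rule filterlim_compose [OF _ a_real])
  qed simp
  have X2: "(\<lambda>n. sqrt (a n) * G (Suc (b n))) \<longlonglongrightarrow> 0"
  proof (rule Lim_null_comparison)
    have "(\<lambda>n. 2 * sqrt (real (a n) / real (b n))) \<longlonglongrightarrow> 2 * sqrt 0" by (intro tendsto_intros ab)
    then show "(\<lambda>n. 2 * sqrt (real (a n) / real (b n))) \<longlonglongrightarrow> 0" by simp
    show "eventually (\<lambda>n. norm (sqrt (a n) * G (Suc (b n))) \<le> 2 * sqrt (real (a n) / real (b n))) sequentially"
      using a_pos le
    proof eventually_elim
      case (elim n)
      have "b n \<le> next_size (Suc (b n))" using next_size(1) [of "Suc (b n)"] by simp
      then have "2 / sqrt (next_size (Suc (b n))) \<le> 2 / sqrt (b n)"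
        using elim by (intro divide_left_mono) auto
      then have "sqrt (a n) * (2 / sqrt (next_size (Suc (b n)))) \<le> sqrt (a n) * (2 / sqrt (b n))"
        by (intro mult_left_mono) auto
      then show ?case by (simp add: G_def real_sqrt_divide mult.commute)
    qed
  qed
  have X: "X \<longlonglongrightarrow> 2"
    using tendsto_diff [OF X1 X2] by (simp add: X_def [abs_def] right_diff_distrib)
  have diff: "(\<lambda>n. sqrt (a n) * (\<Sum>k=a n..b n. size_prob k) - \<kappa> / period * X n) \<longlonglongrightarrow> 0"
  proof (rule LIMSEQ_I)
    fix r :: real assume r: "0 < r"
    obtain N where N: "1 \<le> N" "\<And>k. N \<le> k \<Longrightarrow> 0 \<le> G k - G (Suc k) \<and>
       \<bar>size_prob k - \<kappa> / period * (G k - G (Suc k))\<bar> \<le> r / 4 * (G k - G (Suc k))"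
      using size_prob_approx [of "r / 4"] r by auto
    have "eventually (\<lambda>n. N \<le> a n) sequentially" using a by (simp add: filterlim_at_top)
    moreover have "eventually (\<lambda>n. X n < 3) sequentially" using X by (rule order_tendstoD) simp
    ultimately have "eventually (\<lambda>n. norm (sqrt (a n) * (\<Sum>k=a n..b n. size_prob k) - \<kappa> / period * X n - 0) < r) sequentially"
      using le
    proof eventually_elim
      case (elim n)
      have tele: "(\<Sum>k=a n..b n. G k - G (Suc k)) = G (a n) - G (Suc (b n))"
        using sum_telescope'' [of "a n" "Suc (b n)" "\<lambda>k. - G k"] elim(3)
        using sum_Suc_diff [of "a n" "b n" "\<lambda>k. - G k"] by simp
      have "\<bar>(\<Sum>k=a n..b n. size_prob k) - \<kappa> / period * (G (a n) - G (Suc (b n)))\<bar>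
          = \<bar>\<Sum>k=a n..b n. size_prob k - \<kappa> / period * (G k - G (Suc k))\<bar>"
        by (subst sum_subtractf, subst sum_distrib_left [symmetric], subst tele, rule refl)
      also have "\<dots> \<le> (\<Sum>k=a n..b n. r / 4 * (G k - G (Suc k)))"
        using N(2) elim(1) by (intro order_trans [OF sum_abs] sum_mono) auto
      also have "\<dots> = r / 4 * (G (a n) - G (Suc (b n)))"
        by (subst sum_distrib_left [symmetric], subst tele, rule refl)
      finally have "sqrt (a n) * \<bar>(\<Sum>k=a n..b n. size_prob k) - \<kappa> / period * (G (a n) - G (Suc (b n)))\<bar>
          \<le> sqrt (a n) * (r / 4 * (G (a n) - G (Suc (b n))))"
        by (rule mult_left_mono) simp
      also have "\<dots> = r / 4 * X n" by (simp add: X_def)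
      also have "\<dots> < r" using elim(2) r by simp
      finally have "\<bar>sqrt (a n) * ((\<Sum>k=a n..b n. size_prob k) - \<kappa> / period * (G (a n) - G (Suc (b n))))\<bar> < r"
        by (simp add: abs_mult)
      then show ?case by (simp add: X_def right_diff_distrib mult.left_commute)
    qed
    then show "\<exists>no. \<forall>n\<ge>no. norm (sqrt (a n) * (\<Sum>k=a n..b n. size_prob k) - \<kappa> / period * X n - 0) < r"
      by (simp add: eventually_sequentially)
  qed
  have "(\<lambda>n. sqrt (a n) * (\<Sum>k=a n..b n. size_prob k)) \<longlonglongrightarrow> 0 + \<kappa> / period * 2"
    by (rule tendsto_of_diff [OF diff]) (intro tendsto_intros X)
  then show ?thesis by (simp add: mult.commute)
qed

end

section \<open>The number of distinct fringe subtrees for fixed size\<close>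

lemma no_trees_without_leaves:
  assumes "\<phi> 0 = 0" shows "family_trees \<phi> n = {}"
proof -
  have "\<not> family_member \<phi> t" for t
  proof (induction t)
    case (Node k ts)
    then show ?case using assms by (cases ts) auto
  qed
  then show ?thesis by (simp add: family_trees_def)
qed

section \<open>Averages over a finite set\<close>

definition mean :: "'a set \<Rightarrow> ('a \<Rightarrow> real) \<Rightarrow> real" where
  "mean A f = (\<Sum>t\<in>A. f t) / card A"

lemma mean_mono: "(\<And>t. t \<in> A \<Longrightarrow> f t \<le> g t) \<Longrightarrow> mean A f \<le> mean A g"
  unfolding mean_def by (intro divide_right_mono sum_mono) auto

lemma mean_add: "mean A (\<lambda>t. f t + g t) = mean A f + mean A g"
  by (simp add: mean_def sum.distrib add_divide_distrib)

lemma mean_diff: "mean A (\<lambda>t. f t - g t) = mean A f - mean A g"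
  by (simp add: mean_def sum_subtractf diff_divide_distrib)

lemma mean_cmult: "mean A (\<lambda>t. c * f t) = c * mean A f"
  by (simp add: mean_def flip: sum_distrib_left)

lemma mean_const: "finite A \<Longrightarrow> A \<noteq> {} \<Longrightarrow> mean A (\<lambda>_. c) = c"
  by (simp add: mean_def)

lemma mean_abs_le_sqrt: "mean A (\<lambda>t. \<bar>f t\<bar>) \<le> sqrt (mean A (\<lambda>t. (f t)\<^sup>2))"
proof (cases "card A = 0")
  case True
  then show ?thesis by (simp add: mean_def)
next
  case False
  have "(\<Sum>t\<in>A. \<bar>f t\<bar>)\<^sup>2 \<le> card A * (\<Sum>t\<in>A. (f t)\<^sup>2)"
    using sum_squared_le_sum_of_squares [of "\<lambda>t. \<bar>f t\<bar>" A]
    by (cases "finite A") (simp_all add: mult.commute)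
  then have "(\<Sum>t\<in>A. \<bar>f t\<bar>)\<^sup>2 / (card A)\<^sup>2 \<le> card A * (\<Sum>t\<in>A. (f t)\<^sup>2) / (card A)\<^sup>2"
    by (intro divide_right_mono) auto
  then have "(mean A (\<lambda>t. \<bar>f t\<bar>))\<^sup>2 \<le> mean A (\<lambda>t. (f t)\<^sup>2)"
    using False by (simp add: mean_def power_divide power2_eq_square)
  then show ?thesis by (rule real_le_rsqrt)
qed

text \<open>Markov's inequality at the level \<open>sqrt (mean A f)\<close>, chosen so that
  tolerance and failure probability are the same small number.\<close>

lemma mean_Markov:
  assumes A: "finite A" "A \<noteq> {}" and f: "\<And>t. t \<in> A \<Longrightarrow> 0 \<le> f t"
  shows "1 - sqrt (mean A f) \<le> card (A \<inter> {t. f t \<le> sqrt (mean A f)}) / card A"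
proof -
  define e where "e = sqrt (mean A f)"
  define B where "B = {t \<in> A. e < f t}"
  have N: "0 < real (card A)" using A by (simp add: card_gt_0_iff)
  have m0: "0 \<le> mean A f" using f by (simp add: mean_def sum_nonneg)
  have sum: "(\<Sum>t\<in>A. f t) = e\<^sup>2 * card A" using N m0 by (simp add: e_def mean_def)
  have "0 \<le> e" using m0 by (simp add: e_def)
  have B: "finite B" "B \<subseteq> A" using A by (auto simp: B_def)
  have Be: "card B * e \<le> e\<^sup>2 * card A"
  proof -
    have "card B * e = (\<Sum>t\<in>B. e)" by simp
    also have "\<dots> \<le> (\<Sum>t\<in>B. f t)" by (intro sum_mono) (auto simp: B_def)
    also have "\<dots> \<le> (\<Sum>t\<in>A. f t)" using A B f by (intro sum_mono2) auto
    finally show ?thesis by (simp add: sum)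
  qed
  have "card B \<le> e * card A"
  proof (cases "e = 0")
    \<comment> \<open>Division by the level is impossible here, but a nonnegative function with mean
      zero vanishes and nothing exceeds the level.\<close>
    case True
    then have "\<forall>t\<in>A. f t = 0" using sum_nonneg_eq_0_iff [OF A(1), of f] f sum by simp
    then have "B = {}" using True by (auto simp: B_def)
    then show ?thesis using True by simp
  next
    case False
    then have "0 < e" using \<open>0 \<le> e\<close> by simp
    then show ?thesis using Be by (simp add: power2_eq_square mult.commute mult.left_commute)
  qed
  moreover have "card (A \<inter> {t. f t \<le> e}) = card A - card B"
  proof -
    have "A \<inter> {t. f t \<le> e} = A - B" by (auto simp: B_def)
    then show ?thesis using card_Diff_subset [OF B] by simp
  qed
  moreover have "card B \<le> card A" using A B by (intro card_mono) auto
  ultimately have "(1 - e) * card A \<le> card (A \<inter> {t. f t \<le> e})"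
    by (simp add: of_nat_diff algebra_simps)
  then show ?thesis using N by (simp add: e_def pos_le_divide_eq)
qed

context simply_generated
begin

text \<open>By criticality this is \<Phi>'(\<tau>).\<close>

definition "growth = \<Phi> / \<tau>"

lemma growth_gt_1: "1 < growth" using Phi_over_tau_gt_1 by (simp add: growth_def)

lemma ln_growth_pos: "0 < ln growth" using growth_gt_1 by simp

lemma card_words_q: "real (card (words \<phi> m j)) = q m j * \<Phi> ^ m / \<tau> ^ j"
  using tau Phi_pos by (simp add: q_def)

lemma card_words_b:
  "real (card (words \<phi> m m)) = q m m * growth ^ m"
  "real (card (words \<phi> m (Suc m))) = q m (Suc m) * growth ^ m / \<tau>"
  "0 < m \<Longrightarrow> real (card (words \<phi> m (m - 1))) = \<tau> * q m (m - 1) * growth ^ m"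
  using tau by (cases m; simp add: card_words_q growth_def power_divide)+

lemma card_family_trees_b:
  assumes "0 < k" shows "real (card (family_trees \<phi> k)) = \<tau> * size_prob k * growth ^ k"
proof -
  have "real k * real (card (family_trees \<phi> k)) = \<tau> * q k (k - 1) * growth ^ k"
    using card_words_trees [OF assms, of \<phi>] card_words_b(3) [OF assms] by simp
  then show ?thesis using assms by (simp add: size_prob_def field_simps)
qed

lemma card_family_trees_le: "real (card (family_trees \<phi> k)) \<le> \<tau> * growth ^ k"
proof (cases "k = 0")
  case True
  then have "t \<notin> family_trees \<phi> k" for t using tree_size_pos [of t] by (simp add: family_trees_def)
  then have "family_trees \<phi> k = {}" by blast
  then show ?thesis using tau growth_gt_1 by simp
next
  case False
  then have "real (card (family_trees \<phi> k)) = \<tau> * size_prob k * growth ^ k" by (intro card_family_trees_b) simp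
  also have "\<dots> \<le> \<tau> * 1 * growth ^ k"
    using size_prob_le_1 [of k] tau growth_gt_1 by (intro mult_right_mono mult_left_mono) auto
  finally show ?thesis by simp
qed

section \<open>Exact moments for a fixed size n\<close>

context
  fixes n :: nat
  assumes n: "family_trees \<phi> n \<noteq> {}"
begin

text \<open>Every tree accounts for exactly \<open>n\<close> words, hence the factor
  \<open>n\<close>.\<close>

lemma mean_eq_words:
  fixes X :: real
  assumes "real (\<Sum>t\<in>family_trees \<phi> n. f t) = X"
  shows "mean (family_trees \<phi> n) (\<lambda>t. real (f t)) = n * X / card (words \<phi> n (n - 1))"
  using assms card_words_trees [OF admissible_period(1) [OF n], of \<phi>] admissible_period(1) [OF n]
  by (simp add: mean_def)

lemma card_words_n: "real (card (words \<phi> n (n - 1))) = \<tau> * q n (n - 1) * growth ^ n"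
  by (rule card_words_b(3) [OF admissible_period(1) [OF n]])

lemma words_n_pos: "0 < real (card (words \<phi> n (n - 1)))"
  unfolding card_words_n using admissible_period(3) [OF n] tau growth_gt_1 by simp

lemma ratio_one:
  assumes "0 < k" "k \<le> n"
  shows "real (card (family_trees \<phi> k) * card (words \<phi> (n - k) (n - k))) / card (words \<phi> n (n - 1)) =
    size_prob k * (q (n - k) (n - k) / q n (n - 1))"
proof -
  have "growth ^ n = growth ^ k * growth ^ (n - k)" using assms by (simp flip: power_add)
  then show ?thesis
    unfolding card_words_n using assms tau growth_gt_1 by (simp add: card_family_trees_b card_words_b(1))
qed

lemma ratio_two:
  assumes "0 < k" "0 < l" "k + l \<le> n"
  shows "real (card (family_trees \<phi> k) * card (family_trees \<phi> l) * card (words \<phi> (n - k - l) (n - k - l + 1)))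
      / card (words \<phi> n (n - 1)) =
    size_prob k * size_prob l * (q (n - k - l) (n - k - l + 1) / q n (n - 1))"
proof -
  have "growth ^ n = growth ^ k * growth ^ l * growth ^ (n - k - l)" using assms by (simp flip: power_add)
  then show ?thesis
    unfolding card_words_n using assms tau growth_gt_1 by (simp add: card_family_trees_b card_words_b(2))
qed

text \<open>Two blocks are removed but only one is chosen freely, so one factor
  \<open>\<tau> * growth ^ k\<close> remains in the denominator.\<close>

lemma ratio_twin:
  assumes "0 < k" "2 * k \<le> n"
  shows "real (card (family_trees \<phi> k) * card (words \<phi> (n - 2 * k) (n - 2 * k + 1))) / card (words \<phi> n (n - 1)) =
    size_prob k / (\<tau> * growth ^ k) * (q (n - 2 * k) (n - 2 * k + 1) / q n (n - 1))"
proof -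
  have "growth ^ n = growth ^ k * growth ^ k * growth ^ (n - 2 * k)" using assms by (simp flip: power_add)
  then show ?thesis
    unfolding card_words_n using assms tau growth_gt_1 by (simp add: card_family_trees_b card_words_b(2))
qed

lemma mean_cyc_pos:
  assumes "A \<subseteq> {1..n}"
  shows "mean (family_trees \<phi> n) (\<lambda>t. real (card (cyc_pos A t))) =
    n * (\<Sum>k\<in>A. size_prob k * (q (n - k) (n - k) / q n (n - 1)))"
proof -
  have "real (\<Sum>t\<in>family_trees \<phi> n. card (cyc_pos A t)) =
      (\<Sum>k\<in>A. real (card (family_trees \<phi> k) * card (words \<phi> (n - k) (n - k))))"
  proof -
    have "A \<subseteq> {..n}" using assms by auto
    then have "(\<Sum>t\<in>family_trees \<phi> n. card (cyc_pos A t)) =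
        (\<Sum>k\<in>A. card {w \<in> words \<phi> n (n - 1). starts k w})"
      by (rule sum_card_cyc_pos [OF admissible_period(1) [OF n]])
    also have "\<dots> = (\<Sum>k\<in>A. card (family_trees \<phi> k) * card (words \<phi> (n - k) (n - k)))"
      using assms by (intro sum.cong card_starts) auto
    finally show ?thesis by simp
  qed
  from mean_eq_words [OF this]
  have "mean (family_trees \<phi> n) (\<lambda>t. real (card (cyc_pos A t))) = n *
      (\<Sum>k\<in>A. real (card (family_trees \<phi> k) * card (words \<phi> (n - k) (n - k))) / card (words \<phi> n (n - 1)))"
    by (simp only: sum_divide_distrib [symmetric] times_divide_eq_right)
  also have "\<dots> = n * (\<Sum>k\<in>A. size_prob k * (q (n - k) (n - k) / q n (n - 1)))"
    using assms by (intro arg_cong2 [where f = "(*)"] sum.cong ratio_one) auto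
  finally show ?thesis .
qed

section \<open>Moment bounds when all blocks have size at most K\<close>

context
  fixes K :: nat and \<delta> :: real
  assumes K: "2 * K \<le> n" and \<delta>: "0 \<le> \<delta>"
    "\<And>m s. n - 2 * K \<le> m \<Longrightarrow> m \<le> n \<Longrightarrow> s \<le> 1 \<Longrightarrow> period dvd m + s \<Longrightarrow>
       \<bar>q m (m + s) / q n (n - 1) - 1\<bar> \<le> \<delta>"
begin

text \<open>Off the lattice the numerator is zero, so the upper bound holds for all \<open>m\<close>
  in the window.\<close>

lemma ratio_le:
  assumes "n - 2 * K \<le> m" "m \<le> n" "s \<le> 1" shows "q m (m + s) / q n (n - 1) \<le> 1 + \<delta>"
proof (cases "period dvd m + s")
  case True
  then show ?thesis using \<delta>(2) [OF assms] by linarith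
next
  case False
  then have "q m (m + s) = 0" using period_dvd by blast
  then show ?thesis using \<delta>(1) by simp
qed

lemma mean_cyc_pos_le:
  assumes "A \<subseteq> {1..K}"
  shows "mean (family_trees \<phi> n) (\<lambda>t. real (card (cyc_pos A t))) \<le> (1 + \<delta>) * (n * (\<Sum>k\<in>A. size_prob k))"
proof -
  have "mean (family_trees \<phi> n) (\<lambda>t. real (card (cyc_pos A t))) =
    n * (\<Sum>k\<in>A. size_prob k * (q (n - k) (n - k) / q n (n - 1)))"
    using assms K by (intro mean_cyc_pos) auto
  also have "\<dots> \<le> n * (\<Sum>k\<in>A. size_prob k * (1 + \<delta>))"
  proof (intro mult_left_mono sum_mono)
    fix k assume "k \<in> A"
    then have "n - 2 * K \<le> n - k" using assms by (intro diff_le_mono2) auto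
    then show "q (n - k) (n - k) / q n (n - 1) \<le> 1 + \<delta>"
      using ratio_le [of "n - k" 0] by simp
  qed (use size_prob_nonneg in auto)
  also have "\<dots> = (1 + \<delta>) * (n * (\<Sum>k\<in>A. size_prob k))"
    by (subst sum_distrib_right [symmetric]) (simp add: mult_ac)
  finally show ?thesis .
qed

lemma mean_cyc_pos_ge:
  assumes "A \<subseteq> {1..K}"
  shows "(1 - \<delta>) * (n * (\<Sum>k\<in>A. size_prob k)) \<le> mean (family_trees \<phi> n) (\<lambda>t. real (card (cyc_pos A t)))"
proof -
  have "(1 - \<delta>) * (n * (\<Sum>k\<in>A. size_prob k)) = n * (\<Sum>k\<in>A. size_prob k * (1 - \<delta>))"
    by (subst sum_distrib_right [symmetric]) (simp add: mult_ac)
  also have "\<dots> \<le> n * (\<Sum>k\<in>A. size_prob k * (q (n - k) (n - k) / q n (n - 1)))"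
  proof (intro mult_left_mono [of _ _ "real n"] sum_mono)
    fix k assume k: "k \<in> A"
    then have kn: "1 \<le> k" "k \<le> K" "k \<le> n" using assms K by auto
    show "size_prob k * (1 - \<delta>) \<le> size_prob k * (q (n - k) (n - k) / q n (n - 1))"
    proof (cases "period dvd k - 1")
      case True
      \<comment> \<open>Sizes of trees are congruent to 1 modulo the period, so \<open>n - k\<close>
        is a multiple of it and the local limit applies. For other \<open>k\<close> the weight
        \<open>size_prob k\<close> is zero.\<close>
      have "n - k = (n - 1) - (k - 1)" using kn by simp
      then have "period dvd n - k" using True admissible_period(2) [OF n] by (simp only: dvd_diff_nat)
      moreover have "n - 2 * K \<le> n - k" using kn by (intro diff_le_mono2) simp
      ultimately have "1 - \<delta> \<le> q (n - k) (n - k) / q n (n - 1)"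
        using \<delta>(2) [of "n - k" 0] by simp
      then show ?thesis using size_prob_nonneg by (intro mult_left_mono)
    next
      case False
      then have "size_prob k = 0" using period_dvd by (auto simp: size_prob_def)
      then show ?thesis by simp
    qed
  qed auto
  also have "\<dots> = mean (family_trees \<phi> n) (\<lambda>t. real (card (cyc_pos A t)))"
    using assms K by (intro mean_cyc_pos [symmetric]) auto
  finally show ?thesis .
qed

lemma mean_cyc_pos_squared:
  assumes "A \<subseteq> {1..K}"
  shows "mean (family_trees \<phi> n) (\<lambda>t. (real (card (cyc_pos A t)))\<^sup>2) \<le>
    (2 * real K + 1) * n + (1 + \<delta>) * (n * (\<Sum>k\<in>A. size_prob k))\<^sup>2"
proof -
  let ?W = "real (card (words \<phi> n (n - 1)))"
  let ?c = "\<lambda>k l. card (family_trees \<phi> k) * card (family_trees \<phi> l) * card (words \<phi> (n - k - l) (n - k - l + 1))"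
  have A: "finite A" "A \<subseteq> {..K}" using assms by (auto intro: finite_subset)
  have "mean (family_trees \<phi> n) (\<lambda>t. real ((card (cyc_pos A t))\<^sup>2)) =
      n * real (\<Sum>t\<in>family_trees \<phi> n. (card (cyc_pos A t))\<^sup>2) / ?W"
    by (rule mean_eq_words) (rule refl)
  also have "\<dots> \<le> n * real ((2 * K + 1) * card (words \<phi> n (n - 1)) + n * (\<Sum>k\<in>A. \<Sum>l\<in>A. ?c k l)) / ?W"
    using sum_card_cyc_pos_squared [OF admissible_period(1) [OF n] A, of \<phi>]
    by (intro divide_right_mono mult_left_mono of_nat_mono) auto
  also have "\<dots> = (2 * real K + 1) * n + n * n * ((\<Sum>k\<in>A. \<Sum>l\<in>A. real (?c k l)) / ?W)"
    using words_n_pos by (simp add: field_simps)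
  also have "\<dots> \<le> (2 * real K + 1) * n + n * n * ((1 + \<delta>) * (\<Sum>k\<in>A. size_prob k)\<^sup>2)"
  proof (intro add_left_mono mult_left_mono)
    have "(\<Sum>k\<in>A. \<Sum>l\<in>A. real (?c k l)) / ?W = (\<Sum>k\<in>A. \<Sum>l\<in>A. real (?c k l) / ?W)"
      by (simp only: sum_divide_distrib)
    also have "\<dots> \<le> (\<Sum>k\<in>A. \<Sum>l\<in>A. size_prob k * size_prob l * (1 + \<delta>))"
    proof (intro sum_mono)
      fix k l assume "k \<in> A" "l \<in> A"
      then have kl: "0 < k" "0 < l" "k \<le> K" "l \<le> K" using assms by auto
      have "real (?c k l) / ?W = size_prob k * size_prob l * (q (n - k - l) (n - k - l + 1) / q n (n - 1))"
        using kl K by (intro ratio_two) auto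
      also have "\<dots> \<le> size_prob k * size_prob l * (1 + \<delta>)"
        using kl K size_prob_nonneg by (intro mult_left_mono ratio_le) auto
      finally show "real (?c k l) / ?W \<le> size_prob k * size_prob l * (1 + \<delta>)" .
    qed
    also have "(\<Sum>k\<in>A. \<Sum>l\<in>A. size_prob k * size_prob l * (1 + \<delta>)) = (1 + \<delta>) * (\<Sum>k\<in>A. size_prob k)\<^sup>2"
      by (simp add: power2_eq_square sum_product sum_distrib_left mult_ac)
    finally show "(\<Sum>k\<in>A. \<Sum>l\<in>A. real (?c k l)) / ?W \<le> (1 + \<delta>) * (\<Sum>k\<in>A. size_prob k)\<^sup>2" .
  qed auto
  finally show ?thesis
    by (simp add: power_mult_distrib power2_eq_square mult_ac)
qed

lemma mean_twins:
  assumes "1 \<le> k1"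
  shows "mean (family_trees \<phi> n) (\<lambda>t. real (\<Sum>i<n. card (twins {k1..K} (rotate i (dfs t))))) \<le>
    n * n * ((real K + 1) * (1 + \<delta>) / (\<tau> * growth ^ k1))"
proof -
  let ?W = "real (card (words \<phi> n (n - 1)))"
  let ?c = "\<lambda>k. card (family_trees \<phi> k) * card (words \<phi> (n - 2 * k) (n - 2 * k + 1))"
  have "mean (family_trees \<phi> n) (\<lambda>t. real (\<Sum>i<n. card (twins {k1..K} (rotate i (dfs t))))) =
      n * real (\<Sum>t\<in>family_trees \<phi> n. \<Sum>i<n. card (twins {k1..K} (rotate i (dfs t)))) / ?W"
    by (rule mean_eq_words) (rule refl)
  also have "\<dots> \<le> n * real (n * (\<Sum>k=k1..K. ?c k)) / ?W"
    using sum_twins_le [OF admissible_period(1) [OF n], of "{k1..K}" \<phi>]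
    by (intro divide_right_mono mult_left_mono of_nat_mono) auto
  also have "\<dots> = n * n * ((\<Sum>k=k1..K. real (?c k)) / ?W)" by simp
  also have "(\<Sum>k=k1..K. real (?c k)) / ?W = (\<Sum>k=k1..K. real (?c k) / ?W)"
    by (simp only: sum_divide_distrib)
  also have "\<dots> \<le> (\<Sum>k=k1..K. (1 + \<delta>) / (\<tau> * growth ^ k1))"
  proof (rule sum_mono)
    fix k assume "k \<in> {k1..K}"
    then have k: "0 < k" "k1 \<le> k" "k \<le> K" using assms by auto
    have "real (?c k) / ?W = size_prob k / (\<tau> * growth ^ k) * (q (n - 2 * k) (n - 2 * k + 1) / q n (n - 1))"
      using k K by (intro ratio_twin) auto
    also have "\<dots> \<le> 1 / (\<tau> * growth ^ k1) * (1 + \<delta>)"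
    proof (rule mult_mono)
      have "\<tau> * growth ^ k1 \<le> \<tau> * growth ^ k"
        using tau growth_gt_1 k by (intro mult_left_mono power_increasing) auto
      then show "size_prob k / (\<tau> * growth ^ k) \<le> 1 / (\<tau> * growth ^ k1)"
        using size_prob_le_1 size_prob_nonneg tau growth_gt_1 by (intro frac_le) auto
      have "n - 2 * K \<le> n - 2 * k" using k by (intro diff_le_mono2) simp
      then show "q (n - 2 * k) (n - 2 * k + 1) / q n (n - 1) \<le> 1 + \<delta>" by (intro ratio_le) auto
    qed (use q_nonneg tau growth_gt_1 in auto)
    finally show "real (?c k) / ?W \<le> (1 + \<delta>) / (\<tau> * growth ^ k1)" by simp
  qed
  also have "\<dots> = real (card {k1..K}) * ((1 + \<delta>) / (\<tau> * growth ^ k1))" by simp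
  also have "\<dots> \<le> (real K + 1) * ((1 + \<delta>) / (\<tau> * growth ^ k1))"
    using \<delta>(1) tau growth_gt_1 assms by (intro mult_right_mono divide_nonneg_nonneg) (auto simp: of_nat_diff)
  finally show ?thesis by (simp add: mult_left_mono)
qed

text \<open>Only the count for sizes from \<open>k1\<close> to \<open>K\<close> is controlled by a
  second moment, taken about the target \<open>x\<close> so that bias and fluctuation are treated
  together. All other quantities enter through their means; the sizes between \<open>k0\<close> and
  \<open>k1\<close> cost just a difference of two means.\<close>

lemma mean_deviation:
  assumes k: "1 \<le> k0" "k0 \<le> k1" and x: "0 \<le> x"
  defines "S0 \<equiv> real n * (\<Sum>k=k0..K. size_prob k)" and "S1 \<equiv> real n * (\<Sum>k=k1..K. size_prob k)"
    and "T \<equiv> real n * (\<Sum>k\<in>{K<..n}. size_prob k * (q (n - k) (n - k) / q n (n - 1)))"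
  shows "mean (family_trees \<phi> n) (\<lambda>t. \<bar>real (num_distinct_fringe t) - x\<bar>) \<le>
    sqrt ((2 * real K + 1) * n + (1 + \<delta>) * S1\<^sup>2 - 2 * x * ((1 - \<delta>) * S1) + x\<^sup>2) +
    (real K + real n * n * ((real K + 1) * (1 + \<delta>) / (\<tau> * growth ^ k1)) + k0 * (\<tau> * growth ^ k0) + T +
     ((1 + \<delta>) * S0 - (1 - \<delta>) * S1))"
proof -
  let ?F = "family_trees \<phi> n"
  define Z0 Z1 Z2 Tw where "Z0 t = real (card (cyc_pos {k0..K} t))" and "Z1 t = real (card (cyc_pos {k1..K} t))"
    and "Z2 t = real (card (cyc_pos {K<..n} t))" and "Tw t = real (\<Sum>i<n. card (twins {k1..K} (rotate i (dfs t))))" for t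
  define M where "M = real (\<Sum>k<k0. card (family_trees \<phi> k))"
  have F: "finite ?F" by (rule finite_card_family_trees)
  have M: "M \<le> k0 * (\<tau> * growth ^ k0)"
  proof -
    have "M \<le> (\<Sum>k<k0. \<tau> * growth ^ k0)"
      unfolding M_def of_nat_sum
    proof (rule sum_mono)
      fix k assume "k \<in> {..<k0}"
      then have "\<tau> * growth ^ k \<le> \<tau> * growth ^ k0" using tau growth_gt_1 by (intro mult_left_mono power_increasing) auto
      then show "real (card (family_trees \<phi> k)) \<le> \<tau> * growth ^ k0" using card_family_trees_le [of k] by linarith
    qed
    then show ?thesis by simp
  qed
  \<comment> \<open>The number of distinct fringe subtrees lies between \<open>Z1 - K - Tw\<close>
    and \<open>Z1 + (Z0 - Z1) + M + Z2\<close>. As all corrections are nonnegative, their sum covers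
    both directions.\<close>
  have "mean ?F (\<lambda>t. \<bar>real (num_distinct_fringe t) - x\<bar>) \<le>
      mean ?F (\<lambda>t. \<bar>Z1 t - x\<bar> + (real K + Tw t + M + Z2 t + (Z0 t - Z1 t)))"
  proof (rule mean_mono)
    fix t assume t: "t \<in> ?F"
    have "num_distinct_fringe t \<le> M + Z0 t + Z2 t"
      using num_distinct_fringe_le [OF t, of k0 K] unfolding M_def Z0_def Z2_def by linarith
    moreover have "Z1 t \<le> num_distinct_fringe t + K + Tw t"
    proof -
      have "card (cyc_pos {k1..K} t) \<le> num_distinct_fringe t + K + (\<Sum>i<n. card (twins {k1..K} (rotate i (dfs t))))"
        using t by (intro num_distinct_fringe_ge) (auto simp: family_trees_def)
      then show ?thesis unfolding Z1_def Tw_def by linarith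
    qed
    moreover have "Z1 t \<le> Z0 t"
    proof -
      have "cyc_pos {k1..K} t \<subseteq> cyc_pos {k0..K} t" using k by (auto simp: cyc_pos_def)
      then show ?thesis unfolding Z1_def Z0_def by (intro of_nat_mono card_mono) auto
    qed
    moreover have "0 \<le> M" "0 \<le> Tw t" "0 \<le> Z2 t" by (auto simp: M_def Tw_def Z2_def sum_nonneg)
    ultimately show "\<bar>real (num_distinct_fringe t) - x\<bar> \<le>
        \<bar>Z1 t - x\<bar> + (real K + Tw t + M + Z2 t + (Z0 t - Z1 t))" by linarith
  qed
  also have "\<dots> = mean ?F (\<lambda>t. \<bar>Z1 t - x\<bar>) + (real K + mean ?F Tw + M + mean ?F Z2 + (mean ?F Z0 - mean ?F Z1))"
    by (simp only: mean_add mean_diff mean_const [OF F n])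
  also have "\<dots> \<le> sqrt ((2 * real K + 1) * n + (1 + \<delta>) * S1\<^sup>2 - 2 * x * ((1 - \<delta>) * S1) + x\<^sup>2) +
    (real K + real n * n * ((real K + 1) * (1 + \<delta>) / (\<tau> * growth ^ k1)) + k0 * (\<tau> * growth ^ k0) + T +
     ((1 + \<delta>) * S0 - (1 - \<delta>) * S1))"
  proof (intro add_mono diff_mono order.refl M)
    have A: "{k0..K} \<subseteq> {1..K}" "{k1..K} \<subseteq> {1..K}" using k by auto
    have Z1: "(1 - \<delta>) * S1 \<le> mean ?F Z1"
      using mean_cyc_pos_ge [OF A(2)] by (simp add: S1_def Z1_def [abs_def])
    then show "(1 - \<delta>) * S1 \<le> mean ?F Z1" .
    show "mean ?F Z0 \<le> (1 + \<delta>) * S0"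
      using mean_cyc_pos_le [OF A(1)] by (simp add: S0_def Z0_def [abs_def])
    show "mean ?F Z2 \<le> T"
    proof -
      have "{K<..n} \<subseteq> {1..n}" by auto
      from mean_cyc_pos [OF this] show ?thesis by (simp add: T_def Z2_def [abs_def])
    qed
    show "mean ?F Tw \<le> real n * n * ((real K + 1) * (1 + \<delta>) / (\<tau> * growth ^ k1))"
      using mean_twins [of k1] k by (simp add: Tw_def [abs_def])
    have "mean ?F (\<lambda>t. (Z1 t - x)\<^sup>2) = mean ?F (\<lambda>t. (Z1 t)\<^sup>2 - 2 * x * Z1 t + x\<^sup>2)"
      by (simp add: power2_diff algebra_simps)
    also have "\<dots> = mean ?F (\<lambda>t. (Z1 t)\<^sup>2) - 2 * x * mean ?F Z1 + x\<^sup>2"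
      by (simp only: mean_add mean_diff mean_const [OF F n] mean_cmult)
    also have "\<dots> \<le> ((2 * real K + 1) * n + (1 + \<delta>) * S1\<^sup>2) - 2 * x * ((1 - \<delta>) * S1) + x\<^sup>2"
    proof (intro add_mono diff_mono order.refl mult_left_mono Z1)
      show "mean ?F (\<lambda>t. (Z1 t)\<^sup>2) \<le> (2 * real K + 1) * n + (1 + \<delta>) * S1\<^sup>2"
        using mean_cyc_pos_squared [OF A(2)] by (simp only: S1_def Z1_def [abs_def])
    qed (use x in auto)
    finally show "mean ?F (\<lambda>t. \<bar>Z1 t - x\<bar>) \<le>
        sqrt ((2 * real K + 1) * n + (1 + \<delta>) * S1\<^sup>2 - 2 * x * ((1 - \<delta>) * S1) + x\<^sup>2)"
      using mean_abs_le_sqrt [of ?F "\<lambda>t. Z1 t - x"] by (meson order_trans real_sqrt_le_mono)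
  qed
  finally show ?thesis .
qed

end

end

end

section \<open>Asymptotics\<close>

lemma tendsto_between:
  fixes f g h :: "nat \<Rightarrow> real"
  assumes "eventually (\<lambda>n. g n \<le> f n \<and> f n \<le> h n) F" "(g \<longlongrightarrow> c) F" "(h \<longlongrightarrow> c) F"
  shows "(f \<longlongrightarrow> c) F"
  using assms by (intro tendsto_sandwich [of g f F h c]) (auto elim: eventually_mono)

text \<open>With growth rate exp \<beta>, the number of trees of size k is comparable to n around k
  = ln n / \<beta>. A shift by the square root of ln n gains a factor exp (sqrt (ln n)), which beats
  every power of ln n, and is still of smaller order than ln n, so that both cuts have the same
  asymptotics.\<close>

definition cut_low :: "real \<Rightarrow> nat \<Rightarrow> nat" where
  "cut_low \<beta> n = nat \<lfloor>(ln (real n) - sqrt (ln (real n))) / \<beta>\<rfloor>"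

definition cut_high :: "real \<Rightarrow> nat \<Rightarrow> nat" where
  "cut_high \<beta> n = nat \<lceil>(ln (real n) + sqrt (ln (real n))) / \<beta>\<rceil>"

text \<open>Large enough that sizes beyond it contribute only O(n / ln n), which is below the main
  term, and small enough for the window of the ratio estimate to be o(n).\<close>

definition cut_max :: "nat \<Rightarrow> nat" where
  "cut_max n = nat \<lfloor>(ln (real n))\<^sup>2\<rfloor>"

lemma cut_max_bounds: "(ln (real n))\<^sup>2 - 1 \<le> cut_max n" "cut_max n \<le> (ln (real n))\<^sup>2"
  using zero_le_power2 [of "ln (real n)"] unfolding cut_max_def by linarith+

lemma cut_max_ln: "filterlim (\<lambda>n. real (cut_max n) / ln (real n)) at_top sequentially"
proof (rule filterlim_at_top_mono)
  show "filterlim (\<lambda>n::nat. ((ln (real n))\<^sup>2 - 1) / ln (real n)) at_top sequentially" by real_asymp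
  have "eventually (\<lambda>n::nat. 0 < ln (real n)) sequentially" by real_asymp
  then show "eventually (\<lambda>n. ((ln (real n))\<^sup>2 - 1) / ln (real n) \<le> cut_max n / ln (real n)) sequentially"
    by eventually_elim (use cut_max_bounds in \<open>auto intro!: divide_right_mono\<close>)
qed

lemma cut_max_small: "(\<lambda>n. real (2 * cut_max n) / real n) \<longlonglongrightarrow> 0"
proof (rule tendsto_between)
  show "eventually (\<lambda>n. 0 \<le> real (2 * cut_max n) / real n \<and>
      real (2 * cut_max n) / real n \<le> 2 * (ln (real n))\<^sup>2 / real n) sequentially"
    using cut_max_bounds(2) by (intro always_eventually) (auto intro!: divide_right_mono)
  show "(\<lambda>n::nat. 2 * (ln (real n))\<^sup>2 / real n) \<longlonglongrightarrow> 0" by real_asymp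
qed simp

text \<open>Relative to the main term, these come from overlapping pairs in the second moment,
  blocks that wrap around, equal pairs, trees below the lower cut, and blocks above
  \<open>cut_max\<close>, in this order.\<close>

lemma error_terms_tendsto_0:
  fixes c :: real
  assumes "0 < c"
  shows "(\<lambda>n::nat. (2 * (ln (real n))\<^sup>2 + 1) * ln (real n) / (c\<^sup>2 * real n)) \<longlonglongrightarrow> 0" (is ?A)
    and "(\<lambda>n::nat. (ln (real n))\<^sup>2 * sqrt (ln (real n)) / (c * real n)) \<longlonglongrightarrow> 0" (is ?B)
    and "(\<lambda>n::nat. ((ln (real n))\<^sup>2 + 1) * sqrt (ln (real n)) * exp (- sqrt (ln (real n))) / c) \<longlonglongrightarrow> 0" (is ?C)
    and "(\<lambda>n::nat. ln (real n) * sqrt (ln (real n)) * exp (- sqrt (ln (real n)))) \<longlonglongrightarrow> 0" (is ?D)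
    and "(\<lambda>n::nat. sqrt (ln (real n)) * (1 / sqrt ((ln (real n))\<^sup>2 - 1) + 1 / sqrt (real n))) \<longlonglongrightarrow> 0" (is ?E)
proof -
  show ?A using assms by real_asymp
  show ?B using assms by real_asymp
  show ?C using assms by real_asymp
  show ?D by real_asymp
  show ?E by real_asymp
qed

context
  fixes \<beta> :: real
  assumes \<beta>: "0 < \<beta>"
begin

lemma cut_low_bounds:
  "eventually (\<lambda>n. (ln (real n) - sqrt (ln (real n))) / \<beta> - 1 \<le> cut_low \<beta> n \<and>
     cut_low \<beta> n \<le> (ln (real n) - sqrt (ln (real n))) / \<beta>) sequentially"
proof -
  have "eventually (\<lambda>n::nat. 0 \<le> ln (real n) - sqrt (ln (real n))) sequentially" by real_asymp
  then show ?thesis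
  proof eventually_elim
    case (elim n)
    then have "0 \<le> (ln (real n) - sqrt (ln (real n))) / \<beta>" using \<beta> by simp
    then show ?case unfolding cut_low_def by linarith
  qed
qed

lemma cut_high_bounds:
  "eventually (\<lambda>n. (ln (real n) + sqrt (ln (real n))) / \<beta> \<le> cut_high \<beta> n \<and>
     cut_high \<beta> n \<le> (ln (real n) + sqrt (ln (real n))) / \<beta> + 1) sequentially"
proof -
  have "eventually (\<lambda>n::nat. 0 \<le> ln (real n) + sqrt (ln (real n))) sequentially" by real_asymp
  then show ?thesis
  proof eventually_elim
    case (elim n)
    then have "0 \<le> (ln (real n) + sqrt (ln (real n))) / \<beta>" using \<beta> by simp
    then show ?case unfolding cut_high_def by linarith
  qed
qed

lemma cut_low_large: "eventually (\<lambda>n. 2 \<le> (ln (real n) - sqrt (ln (real n))) / \<beta>) sequentially"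
  using \<beta> by real_asymp

lemma cut_low_tendsto: "(\<lambda>n. real (cut_low \<beta> n) / ln (real n)) \<longlonglongrightarrow> inverse \<beta>"
proof (rule tendsto_between)
  have "eventually (\<lambda>n::nat. 0 < ln (real n)) sequentially" by real_asymp
  with cut_low_bounds show "eventually (\<lambda>n. ((ln (real n) - sqrt (ln (real n))) / \<beta> - 1) / ln (real n) \<le> cut_low \<beta> n / ln (real n) \<and>
      cut_low \<beta> n / ln (real n) \<le> ((ln (real n) - sqrt (ln (real n))) / \<beta>) / ln (real n)) sequentially"
    by eventually_elim (intro conjI divide_right_mono; auto)
  show "(\<lambda>n::nat. ((ln (real n) - sqrt (ln (real n))) / \<beta> - 1) / ln (real n)) \<longlonglongrightarrow> inverse \<beta>"
    using \<beta> by real_asymp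
  show "(\<lambda>n::nat. ((ln (real n) - sqrt (ln (real n))) / \<beta>) / ln (real n)) \<longlonglongrightarrow> inverse \<beta>"
    using \<beta> by real_asymp
qed

lemma cut_high_tendsto: "(\<lambda>n. real (cut_high \<beta> n) / ln (real n)) \<longlonglongrightarrow> inverse \<beta>"
proof (rule tendsto_between)
  have "eventually (\<lambda>n::nat. 0 < ln (real n)) sequentially" by real_asymp
  with cut_high_bounds show "eventually (\<lambda>n. ((ln (real n) + sqrt (ln (real n))) / \<beta>) / ln (real n) \<le> cut_high \<beta> n / ln (real n) \<and>
      cut_high \<beta> n / ln (real n) \<le> ((ln (real n) + sqrt (ln (real n))) / \<beta> + 1) / ln (real n)) sequentially"
    by eventually_elim (intro conjI divide_right_mono; auto)
  show "(\<lambda>n::nat. ((ln (real n) + sqrt (ln (real n))) / \<beta>) / ln (real n)) \<longlonglongrightarrow> inverse \<beta>"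
    using \<beta> by real_asymp
  show "(\<lambda>n::nat. ((ln (real n) + sqrt (ln (real n))) / \<beta> + 1) / ln (real n)) \<longlonglongrightarrow> inverse \<beta>"
    using \<beta> by real_asymp
qed

end

section \<open>The main term and the relative error\<close>

context simply_generated
begin

definition "limit_const = 2 * \<kappa> / period * sqrt (ln growth)"

lemma limit_const_pos: "0 < limit_const" using kappa_pos period_pos ln_growth_pos by (simp add: limit_const_def)

text \<open>The period in \<open>\<kappa>\<close> cancels against the spacing of the tree sizes, so
  no trace of it is left in the constant.\<close>

lemma fringe_const_eq: "fringe_const \<phi> \<tau> = limit_const"
proof -
  have "fringe_const \<phi> \<tau> = 2 / \<tau> * sqrt (\<Phi> * ln growth) / sqrt (2 * pi * (\<Phi> * \<sigma>2 / \<tau>\<^sup>2))"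
    by (simp only: fringe_const_def Phi_deriv Phi_deriv2 growth_def flip: \<Phi>_def)
  also have "\<dots> = 2 * sqrt (ln growth) / sqrt (2 * pi * \<sigma>2)"
    using tau Phi_pos by (simp add: real_sqrt_mult real_sqrt_divide field_simps)
  also have "\<dots> = limit_const" using period_pos by (simp add: limit_const_def \<kappa>_def)
  finally show ?thesis .
qed

definition "main_term n = limit_const * (real n / sqrt (ln (real n)))"

text \<open>Only the leading order of the lower end matters, so both cuts lead to the same main term
  and the range between them is negligible.\<close>

lemma block_sum_tendsto:
  fixes a :: "nat \<Rightarrow> nat"
  assumes a: "(\<lambda>n. real (a n) / ln (real n)) \<longlonglongrightarrow> 1 / ln growth"
  shows "(\<lambda>n. real n * (\<Sum>k=a n..cut_max n. size_prob k) / main_term n) \<longlonglongrightarrow> 1"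
proof -
  have ln_pos: "eventually (\<lambda>n::nat. 0 < ln (real n)) sequentially" by real_asymp
  have ln_top: "filterlim (\<lambda>n::nat. ln (real n)) at_top sequentially" by real_asymp
  have a_top: "filterlim a at_top sequentially"
  proof -
    have "filterlim (\<lambda>n. real (a n) / ln (real n) * ln (real n)) at_top sequentially"
      using ln_growth_pos by (intro filterlim_tendsto_pos_mult_at_top [OF a] ln_top) simp
    then have "filterlim (\<lambda>n. real (a n)) at_top sequentially"
      by (rule filterlim_mono_eventually) (use ln_pos in \<open>auto elim: eventually_mono\<close>)
    then show ?thesis by (simp add: filterlim_sequentially_iff_filterlim_real)
  qed
  have ratio: "(\<lambda>n. real (a n) / real (cut_max n)) \<longlonglongrightarrow> 0"
  proof (rule Lim_transform_eventually)
    show "(\<lambda>n. real (a n) / ln (real n) / (real (cut_max n) / ln (real n))) \<longlonglongrightarrow> 0"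
      by (rule tendsto_divide_0 [OF a filterlim_at_top_imp_at_infinity [OF cut_max_ln]])
    show "eventually (\<lambda>n. real (a n) / ln (real n) / (real (cut_max n) / ln (real n)) = real (a n) / real (cut_max n)) sequentially"
      using ln_pos by eventually_elim simp
  qed
  have a_pos: "eventually (\<lambda>n. 1 \<le> a n) sequentially" using a_top by (simp add: filterlim_at_top)
  have "eventually (\<lambda>n. 0 < real (cut_max n) / ln (real n)) sequentially"
    using cut_max_ln by (simp add: filterlim_at_top_dense)
  then have "eventually (\<lambda>n. 0 < cut_max n) sequentially"
    by eventually_elim (auto intro: Nat.gr0I)
  moreover have "eventually (\<lambda>n. real (a n) / real (cut_max n) < 1) sequentially"
    using ratio by (rule order_tendstoD) simp
  ultimately have le: "eventually (\<lambda>n. a n \<le> cut_max n) sequentially"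
    by eventually_elim (auto simp: divide_less_eq)
  have "(\<lambda>n. sqrt (a n) * (\<Sum>k=a n..cut_max n. size_prob k) / (sqrt (real (a n) / ln (real n)) * limit_const)) \<longlonglongrightarrow>
      2 * \<kappa> / period / (sqrt (1 / ln growth) * limit_const)"
    using ln_growth_pos limit_const_pos by (intro tendsto_intros tail_sum a_top ratio le a) auto
  also have "2 * \<kappa> / period / (sqrt (1 / ln growth) * limit_const) = 1"
    using ln_growth_pos kappa_pos period_pos by (simp add: limit_const_def real_sqrt_divide)
  finally have lim: "(\<lambda>n. sqrt (a n) * (\<Sum>k=a n..cut_max n. size_prob k) / (sqrt (real (a n) / ln (real n)) * limit_const)) \<longlonglongrightarrow> 1" .
  show ?thesis
  proof (rule Lim_transform_eventually [OF lim])
    show "eventually (\<lambda>n. sqrt (a n) * (\<Sum>k=a n..cut_max n. size_prob k) / (sqrt (real (a n) / ln (real n)) * limit_const) =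
        real n * (\<Sum>k=a n..cut_max n. size_prob k) / main_term n) sequentially"
      using ln_pos a_pos eventually_gt_at_top [of 0]
      by eventually_elim (use limit_const_pos in \<open>simp add: main_term_def real_sqrt_divide\<close>)
  qed
qed

definition "dev n = mean (family_trees \<phi> n) (\<lambda>t. \<bar>real (num_distinct_fringe t) - main_term n\<bar>) / main_term n"

lemma dev_tendsto_0: "(dev \<longlongrightarrow> 0) (admissible_sizes \<phi>)"
proof -
  let ?F = "admissible_sizes \<phi>"
  define K where "K = cut_max"
  define k0 where "k0 = cut_low (ln growth)"
  define k1 where "k1 = cut_high (ln growth)"
  obtain \<delta>' where \<delta>': "(\<delta>' \<longlongrightarrow> 0) ?F" "\<And>n m s. n - 2 * K n \<le> m \<Longrightarrow> m \<le> n \<Longrightarrow> s \<le> 1 \<Longrightarrow> period dvd m + s \<Longrightarrow>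
       \<bar>q m (m + s) / q n (n - 1) - 1\<bar> \<le> \<delta>' n"
    using ratio_uniform [OF cut_max_small] unfolding K_def by blast
  define \<delta> where "\<delta> n = \<bar>\<delta>' n\<bar>" for n
  have \<delta>: "(\<delta> \<longlongrightarrow> 0) ?F" "\<And>n. 0 \<le> \<delta> n" "\<And>n m s. n - 2 * K n \<le> m \<Longrightarrow> m \<le> n \<Longrightarrow> s \<le> 1 \<Longrightarrow> period dvd m + s \<Longrightarrow>
       \<bar>q m (m + s) / q n (n - 1) - 1\<bar> \<le> \<delta> n"
    using tendsto_rabs [OF \<delta>'(1)] order_trans [OF \<delta>'(2) abs_ge_self] by (simp_all add: \<delta>_def [abs_def])
  obtain C where C: "eventually (\<lambda>n. \<forall>K\<ge>1. (\<Sum>k\<in>{K<..n}. size_prob k * (q (n - k) (n - k) / q n (n - 1)))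
      \<le> C * (1 / sqrt K + 1 / sqrt n)) ?F"
    using large_blocks by blast
  define S0 where "S0 n = real n * (\<Sum>k=k0 n..K n. size_prob k)" for n
  define S1 where "S1 n = real n * (\<Sum>k=k1 n..K n. size_prob k)" for n
  define T where "T n = real n * (\<Sum>k\<in>{K n<..n}. size_prob k * (q (n - k) (n - k) / q n (n - 1)))" for n
  define r0 where "r0 n = S0 n / main_term n" for n
  define r1 where "r1 n = S1 n / main_term n" for n
  have r0: "(r0 \<longlongrightarrow> 1) ?F"
    unfolding r0_def S0_def K_def k0_def
    by (rule tendsto_mono [OF admissible_le block_sum_tendsto [OF cut_low_tendsto [OF ln_growth_pos, unfolded inverse_eq_divide]]])
  have r1: "(r1 \<longlongrightarrow> 1) ?F"
    unfolding r1_def S1_def K_def k1_def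
    by (rule tendsto_mono [OF admissible_le block_sum_tendsto [OF cut_high_tendsto [OF ln_growth_pos, unfolded inverse_eq_divide]]])
  define l :: "nat \<Rightarrow> real" where "l n = ln (real n)" for n
  define bound where "bound n =
      sqrt ((2 * (l n)\<^sup>2 + 1) * l n / (limit_const\<^sup>2 * n) + (1 + \<delta> n) * (r1 n)\<^sup>2 - 2 * ((1 - \<delta> n) * r1 n) + 1) +
      ((l n)\<^sup>2 * sqrt (l n) / (limit_const * n) + (1 + \<delta> n) * (((l n)\<^sup>2 + 1) * sqrt (l n) * exp (- sqrt (l n)) / (\<tau> * limit_const)) +
       l n * sqrt (l n) * exp (- sqrt (l n)) * (\<tau> / (ln growth * limit_const)) +
       \<bar>C\<bar> / limit_const * (sqrt (l n) * (1 / sqrt ((l n)\<^sup>2 - 1) + 1 / sqrt n)) +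
       ((1 + \<delta> n) * r0 n - (1 - \<delta> n) * r1 n))" for n
  \<comment> \<open>The root tends to sqrt (1 - 2 + 1): second moment, mixed term and square of the
    target agree to leading order.\<close>
  have "(bound \<longlongrightarrow> sqrt (0 + (1 + 0) * 1\<^sup>2 - 2 * ((1 - 0) * 1) + 1) +
      (0 + (1 + 0) * 0 + 0 * (\<tau> / (ln growth * limit_const)) + \<bar>C\<bar> / limit_const * 0 + ((1 + 0) * 1 - (1 - 0) * 1))) ?F"
    unfolding bound_def
  proof (intro tendsto_intros \<delta>(1) r0 r1)
    show "((\<lambda>n. (2 * (l n)\<^sup>2 + 1) * l n / (limit_const\<^sup>2 * n)) \<longlongrightarrow> 0) ?F"
      unfolding l_def by (rule tendsto_mono [OF admissible_le error_terms_tendsto_0(1) [OF limit_const_pos]])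
    show "((\<lambda>n. (l n)\<^sup>2 * sqrt (l n) / (limit_const * n)) \<longlongrightarrow> 0) ?F"
      unfolding l_def by (rule tendsto_mono [OF admissible_le error_terms_tendsto_0(2) [OF limit_const_pos]])
    show "((\<lambda>n. ((l n)\<^sup>2 + 1) * sqrt (l n) * exp (- sqrt (l n)) / (\<tau> * limit_const)) \<longlongrightarrow> 0) ?F"
      unfolding l_def by (rule tendsto_mono [OF admissible_le error_terms_tendsto_0(3) [OF mult_pos_pos [OF tau limit_const_pos]]])
    show "((\<lambda>n. l n * sqrt (l n) * exp (- sqrt (l n))) \<longlongrightarrow> 0) ?F"
      unfolding l_def by (rule tendsto_mono [OF admissible_le error_terms_tendsto_0(4) [OF limit_const_pos]])
    show "((\<lambda>n. sqrt (l n) * (1 / sqrt ((l n)\<^sup>2 - 1) + 1 / sqrt n)) \<longlongrightarrow> 0) ?F"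
      unfolding l_def by (rule tendsto_mono [OF admissible_le error_terms_tendsto_0(5) [OF limit_const_pos]])
  qed
  then have bound: "(bound \<longlongrightarrow> 0) ?F" by simp
  have seq: "eventually (\<lambda>n. 1 < l n \<and> 0 < n \<and> 2 * K n \<le> n \<and> 1 \<le> K n \<and> 1 \<le> k0 n \<and> k0 n \<le> k1 n \<and>
      k0 n \<le> (l n - sqrt (l n)) / ln growth \<and> (l n + sqrt (l n)) / ln growth \<le> k1 n) sequentially"
  proof -
    have "eventually (\<lambda>n::nat. 2 < ln (real n)) sequentially" by real_asymp
    moreover have "eventually (\<lambda>n::nat. 2 * (ln (real n))\<^sup>2 \<le> real n) sequentially" by real_asymp
    ultimately show ?thesis
      using cut_low_large [OF ln_growth_pos] cut_low_bounds [OF ln_growth_pos] cut_high_bounds [OF ln_growth_pos]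
    proof eventually_elim
      case (elim n)
      have "0 < n" using elim(1) by (cases n) auto
      moreover have "2 * K n \<le> n" using elim(2) cut_max_bounds(2) [of n] by (simp add: K_def)
      moreover have "1 \<le> K n"
      proof -
        have "2 * 2 < ln (real n) * ln (real n)" using elim(1) by (intro mult_strict_mono) auto
        then show ?thesis using cut_max_bounds(1) [of n] by (simp add: K_def power2_eq_square)
      qed
      moreover have "1 \<le> k0 n" using elim(3,4) by (simp add: k0_def)
      moreover have "(ln (real n) - sqrt (ln (real n))) / ln growth \<le> (ln (real n) + sqrt (ln (real n))) / ln growth"
        using elim(1) ln_growth_pos by (intro divide_right_mono) auto
      then have "k0 n \<le> k1 n" using elim(4,5) by (simp add: k0_def k1_def)
      ultimately show ?case using elim by (simp add: k0_def k1_def l_def)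
    qed
  qed
  have ev: "eventually (\<lambda>n. family_trees \<phi> n \<noteq> {} \<and> 1 < l n \<and> 0 < n \<and> 2 * K n \<le> n \<and> 1 \<le> K n \<and> 1 \<le> k0 n \<and> k0 n \<le> k1 n \<and>
      k0 n \<le> (l n - sqrt (l n)) / ln growth \<and> (l n + sqrt (l n)) / ln growth \<le> k1 n) ?F"
    unfolding eventually_admissible using seq by eventually_elim simp
  have "eventually (\<lambda>n. norm (dev n) \<le> bound n) ?F"
    using ev C
  proof eventually_elim
    case (elim n)
    note n = elim(1) [THEN conjunct1]
    have l: "1 < l n" and n0: "0 < n" and KK: "2 * K n \<le> n" "1 \<le> K n" and k: "1 \<le> k0 n" "k0 n \<le> k1 n"
      and kl: "k0 n \<le> (l n - sqrt (l n)) / ln growth" "(l n + sqrt (l n)) / ln growth \<le> k1 n"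
      using elim(1) by auto
    have xn: "0 < main_term n" using limit_const_pos l n0 by (simp add: main_term_def flip: l_def)
    have exp_l: "exp (l n) = n" using n0 by (simp add: l_def)
    have b_exp: "growth ^ j = exp (j * ln growth)" for j using growth_gt_1 by (simp add: exp_of_nat_mult)
    have Kl: "K n \<le> (l n)\<^sup>2" "(l n)\<^sup>2 - 1 \<le> K n" using cut_max_bounds by (auto simp: K_def l_def)
    define V where "V = (2 * real (K n) + 1) * n + (1 + \<delta> n) * (S1 n)\<^sup>2 - 2 * main_term n * ((1 - \<delta> n) * S1 n) + (main_term n)\<^sup>2"
    have "mean (family_trees \<phi> n) (\<lambda>t. \<bar>real (num_distinct_fringe t) - main_term n\<bar>) \<le> sqrt V +
      (real (K n) + real n * n * ((real (K n) + 1) * (1 + \<delta> n) / (\<tau> * growth ^ k1 n)) + k0 n * (\<tau> * growth ^ k0 n) + T n +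
       ((1 + \<delta> n) * S0 n - (1 - \<delta> n) * S1 n))"
      unfolding V_def S0_def S1_def T_def
      using n KK(1) \<delta>(2) \<delta>(3) k xn by (intro mean_deviation) auto
    then have "dev n \<le> (sqrt V +
      (real (K n) + real n * n * ((real (K n) + 1) * (1 + \<delta> n) / (\<tau> * growth ^ k1 n)) + k0 n * (\<tau> * growth ^ k0 n) + T n +
       ((1 + \<delta> n) * S0 n - (1 - \<delta> n) * S1 n))) / main_term n"
      unfolding dev_def using xn by (intro divide_right_mono) auto
    also have "\<dots> = sqrt (V / (main_term n)\<^sup>2) +
      (real (K n) / main_term n + real n * n * ((real (K n) + 1) * (1 + \<delta> n) / (\<tau> * growth ^ k1 n)) / main_term n +
       k0 n * (\<tau> * growth ^ k0 n) / main_term n + T n / main_term n + ((1 + \<delta> n) * r0 n - (1 - \<delta> n) * r1 n))"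
      using xn by (simp add: real_sqrt_divide add_divide_distrib diff_divide_distrib r0_def r1_def)
    also have "\<dots> \<le> bound n"
      unfolding bound_def
    proof (intro add_mono real_sqrt_le_mono order.refl)
      have "V / (main_term n)\<^sup>2 = (2 * real (K n) + 1) * n / (main_term n)\<^sup>2 + (1 + \<delta> n) * (r1 n)\<^sup>2 - 2 * ((1 - \<delta> n) * r1 n) + 1"
        using xn by (simp add: V_def r1_def add_divide_distrib diff_divide_distrib power_divide power2_eq_square)
      moreover have "(2 * real (K n) + 1) * n / (main_term n)\<^sup>2 \<le> (2 * (l n)\<^sup>2 + 1) * l n / (limit_const\<^sup>2 * n)"
      proof -
        have "n / (main_term n)\<^sup>2 = l n / (limit_const\<^sup>2 * n)"
          using limit_const_pos l n0 by (simp add: main_term_def power_mult_distrib power_divide flip: l_def) (simp add: field_simps power2_eq_square)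
        moreover have "(2 * real (K n) + 1) * (l n / (limit_const\<^sup>2 * n)) \<le> (2 * (l n)\<^sup>2 + 1) * (l n / (limit_const\<^sup>2 * n))"
          using Kl l by (intro mult_right_mono) auto
        ultimately show ?thesis by (simp only: times_divide_eq_right [symmetric])
      qed
      ultimately show "V / (main_term n)\<^sup>2 \<le> (2 * (l n)\<^sup>2 + 1) * l n / (limit_const\<^sup>2 * n) + (1 + \<delta> n) * (r1 n)\<^sup>2 - 2 * ((1 - \<delta> n) * r1 n) + 1"
        by linarith
      have inv_x: "1 / main_term n = sqrt (l n) / (limit_const * n)" by (simp add: main_term_def l_def)
      have "real (K n) / main_term n = K n * (sqrt (l n) / (limit_const * n))" using inv_x by (metis times_divide_eq_right mult.right_neutral)
      also have "\<dots> \<le> (l n)\<^sup>2 * (sqrt (l n) / (limit_const * n))"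
        using Kl l limit_const_pos by (intro mult_right_mono) auto
      finally show "real (K n) / main_term n \<le> (l n)\<^sup>2 * sqrt (l n) / (limit_const * n)" by simp
      show "real n * n * ((real (K n) + 1) * (1 + \<delta> n) / (\<tau> * growth ^ k1 n)) / main_term n \<le>
          (1 + \<delta> n) * (((l n)\<^sup>2 + 1) * sqrt (l n) * exp (- sqrt (l n)) / (\<tau> * limit_const))"
      proof -
        \<comment> \<open>Of the two factors \<open>n\<close> for pairs of positions, the main term
          cancels one and \<open>growth ^ k1 n\<close> the other, with exp (sqrt (l n)) to
          spare.\<close>
        have "l n + sqrt (l n) \<le> k1 n * ln growth" using kl(2) ln_growth_pos by (simp add: divide_le_eq)
        then have "n * exp (sqrt (l n)) \<le> growth ^ k1 n" unfolding b_exp exp_l [symmetric] by (simp flip: exp_add)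
        then have "1 / growth ^ k1 n \<le> 1 / (n * exp (sqrt (l n)))" using n0 growth_gt_1 by (intro divide_left_mono) auto
        then have bk: "n * (1 / growth ^ k1 n) \<le> exp (- sqrt (l n))"
          using n0 by (simp add: exp_minus field_simps)
        have "real n * n * ((real (K n) + 1) * (1 + \<delta> n) / (\<tau> * growth ^ k1 n)) / main_term n =
            real n * n * ((real (K n) + 1) * (1 + \<delta> n) / (\<tau> * growth ^ k1 n)) * (1 / main_term n)" by simp
        also have "\<dots> = (1 + \<delta> n) * (((real (K n) + 1) * sqrt (l n) * (n * (1 / growth ^ k1 n))) / (\<tau> * limit_const))"
          unfolding inv_x using n0 by (simp add: mult_ac)
        also have "\<dots> \<le> (1 + \<delta> n) * (((l n)\<^sup>2 + 1) * sqrt (l n) * exp (- sqrt (l n)) / (\<tau> * limit_const))"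
          using bk Kl l \<delta>(2) [of n] tau limit_const_pos growth_gt_1
          by (intro mult_left_mono divide_right_mono mult_mono) auto
        finally show ?thesis .
      qed
      show "k0 n * (\<tau> * growth ^ k0 n) / main_term n \<le> l n * sqrt (l n) * exp (- sqrt (l n)) * (\<tau> / (ln growth * limit_const))"
      proof -
        have k0: "k0 n * ln growth \<le> l n - sqrt (l n)" using kl(1) ln_growth_pos by (simp add: le_divide_eq)
        \<comment> \<open>At the lower cut the number of trees falls short of \<open>n\<close> by
          the same factor exp (sqrt (l n)).\<close>
        then have "growth ^ k0 n \<le> exp (l n - sqrt (l n))" unfolding b_exp by simp
        then have bk: "growth ^ k0 n \<le> n * exp (- sqrt (l n))" by (simp add: exp_diff exp_l exp_minus divide_inverse)
        have "0 \<le> sqrt (l n)" using l by simp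
        then have "k0 n * ln growth \<le> l n" using k0 by linarith
        then have "k0 n \<le> l n / ln growth" using ln_growth_pos by (simp add: le_divide_eq)
        then have "k0 n * (\<tau> * growth ^ k0 n) \<le> l n / ln growth * (\<tau> * (n * exp (- sqrt (l n))))"
          using bk tau l ln_growth_pos growth_gt_1 by (intro mult_mono mult_left_mono) auto
        then have "k0 n * (\<tau> * growth ^ k0 n) / main_term n \<le> l n / ln growth * (\<tau> * (n * exp (- sqrt (l n)))) / main_term n"
          using xn by (intro divide_right_mono) auto
        also have "\<dots> = l n / ln growth * (\<tau> * (n * exp (- sqrt (l n)))) * (1 / main_term n)" by simp
        also have "\<dots> = l n * sqrt (l n) * exp (- sqrt (l n)) * (\<tau> / (ln growth * limit_const))"
          unfolding inv_x using n0 by simp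
        finally show ?thesis .
      qed
      show "T n / main_term n \<le> \<bar>C\<bar> / limit_const * (sqrt (l n) * (1 / sqrt ((l n)\<^sup>2 - 1) + 1 / sqrt n))"
      proof -
        have l2: "0 < (l n)\<^sup>2 - 1" using l by (simp add: one_less_power)
        have "T n \<le> n * (C * (1 / sqrt (K n) + 1 / sqrt n))"
          unfolding T_def using elim(2) KK(2) by (intro mult_left_mono) auto
        also have "\<dots> \<le> n * (\<bar>C\<bar> * (1 / sqrt ((l n)\<^sup>2 - 1) + 1 / sqrt n))"
        proof (intro mult_left_mono mult_mono add_mono order.refl)
          show "1 / sqrt (K n) \<le> 1 / sqrt ((l n)\<^sup>2 - 1)"
            using l2 Kl(2) by (intro divide_left_mono) auto
        qed (use l2 in auto)
        finally have "T n / main_term n \<le> n * (\<bar>C\<bar> * (1 / sqrt ((l n)\<^sup>2 - 1) + 1 / sqrt n)) / main_term n"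
          using xn by (intro divide_right_mono) auto
        also have "\<dots> = n * (\<bar>C\<bar> * (1 / sqrt ((l n)\<^sup>2 - 1) + 1 / sqrt n)) * (1 / main_term n)" by simp
        also have "\<dots> = \<bar>C\<bar> / limit_const * (sqrt (l n) * (1 / sqrt ((l n)\<^sup>2 - 1) + 1 / sqrt n))"
          unfolding inv_x using n0 by simp
        finally show ?thesis .
      qed
    qed
    finally have "dev n \<le> bound n" .
    moreover have "0 \<le> dev n" using xn by (simp add: dev_def mean_def sum_nonneg)
    ultimately show ?case by simp
  qed
  then show ?thesis by (rule Lim_null_comparison [OF _ bound])
qed

lemma eventually_main_term_pos: "eventually (\<lambda>n. family_trees \<phi> n \<noteq> {} \<and> 0 < main_term n) (admissible_sizes \<phi>)"
proof -
  have "eventually (\<lambda>n::nat. 0 < real n / sqrt (ln (real n))) sequentially" by real_asymp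
  then show ?thesis
    unfolding eventually_admissible by eventually_elim (use limit_const_pos in \<open>auto simp only: main_term_def intro: mult_pos_pos\<close>)
qed

lemma expectation_asymp:
  "(\<lambda>n. measure_pmf.expectation (random_tree \<phi> n) (\<lambda>t. real (num_distinct_fringe t)))
     \<sim>[admissible_sizes \<phi>] main_term"
proof (rule asymp_equivI')
  let ?E = "\<lambda>n. measure_pmf.expectation (random_tree \<phi> n) (\<lambda>t. real (num_distinct_fringe t))"
  have "((\<lambda>n. ?E n / main_term n - 1) \<longlongrightarrow> 0) (admissible_sizes \<phi>)"
  proof (rule Lim_null_comparison [OF _ dev_tendsto_0])
    show "eventually (\<lambda>n. norm (?E n / main_term n - 1) \<le> dev n) (admissible_sizes \<phi>)"
      using eventually_main_term_pos
    proof eventually_elim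
      case (elim n)
      let ?F = "family_trees \<phi> n"
      have F: "finite ?F" "?F \<noteq> {}" using elim finite_card_family_trees(1) by auto
      have "?E n = mean ?F (\<lambda>t. real (num_distinct_fringe t))"
        using F by (simp add: random_tree_def integral_pmf_of_set mean_def)
      then have "?E n - main_term n = mean ?F (\<lambda>t. real (num_distinct_fringe t) - main_term n)"
        by (simp add: mean_diff mean_const [OF F])
      also have "\<bar>\<dots>\<bar> \<le> mean ?F (\<lambda>t. \<bar>real (num_distinct_fringe t) - main_term n\<bar>)"
        by (simp add: mean_def divide_right_mono)
      finally have "\<bar>?E n - main_term n\<bar> / main_term n \<le> dev n"
        unfolding dev_def using elim by (intro divide_right_mono) auto
      moreover have "\<bar>?E n - main_term n\<bar> / main_term n = \<bar>?E n / main_term n - 1\<bar>"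
      proof -
        have "?E n / main_term n - 1 = (?E n - main_term n) / main_term n" using elim by (simp add: diff_divide_distrib)
        then show ?thesis using elim by (simp add: abs_divide)
      qed
      ultimately show ?case by simp
    qed
  qed
  then show "((\<lambda>n. ?E n / main_term n) \<longlongrightarrow> 1) (admissible_sizes \<phi>)" by (rule Lim_null [THEN iffD2])
qed

lemma concentration:
  "((\<lambda>n. measure_pmf.prob (random_tree \<phi> n)
      {t. \<bar>real (num_distinct_fringe t) - main_term n\<bar> \<le> sqrt (dev n) * main_term n}) \<longlongrightarrow> 1) (admissible_sizes \<phi>)"
proof (rule tendsto_sandwich)
  let ?p = "\<lambda>n. measure_pmf.prob (random_tree \<phi> n)
      {t. \<bar>real (num_distinct_fringe t) - main_term n\<bar> \<le> sqrt (dev n) * main_term n}"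
  have "((\<lambda>n. 1 - sqrt (dev n)) \<longlongrightarrow> 1 - sqrt 0) (admissible_sizes \<phi>)"
    by (intro tendsto_intros dev_tendsto_0)
  then show "((\<lambda>n. 1 - sqrt (dev n)) \<longlongrightarrow> 1) (admissible_sizes \<phi>)" by simp
  show "eventually (\<lambda>n. 1 - sqrt (dev n) \<le> ?p n) (admissible_sizes \<phi>)"
    using eventually_main_term_pos
  proof eventually_elim
    case (elim n)
    let ?F = "family_trees \<phi> n"
    define f where "f t = \<bar>real (num_distinct_fringe t) - main_term n\<bar> / main_term n" for t
    have F: "finite ?F" "?F \<noteq> {}" using elim finite_card_family_trees(1) by auto
    have dev: "dev n = mean ?F f"
      by (simp add: dev_def f_def mean_def sum_divide_distrib [symmetric])
    have "1 - sqrt (mean ?F f) \<le> card (?F \<inter> {t. f t \<le> sqrt (mean ?F f)}) / card ?F"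
      using F elim by (intro mean_Markov) (auto simp: f_def)
    also have "{t. f t \<le> sqrt (mean ?F f)} = {t. \<bar>real (num_distinct_fringe t) - main_term n\<bar> \<le> sqrt (dev n) * main_term n}"
      using elim by (simp add: f_def dev pos_divide_le_eq)
    finally show ?case using F by (simp add: random_tree_def measure_pmf_of_set dev)
  qed
  show "eventually (\<lambda>n. ?p n \<le> 1) (admissible_sizes \<phi>)" by simp
qed simp

end

theorem theorem8:
  fixes \<phi> :: "nat \<Rightarrow> nat" and \<tau> :: real and \<xi> :: "nat pmf"
  assumes tau: "0 < \<tau>" "ereal \<tau> \<le> fps_conv_radius (weight_fps \<phi>)"
    and summable: "summable (\<lambda>m. fps_nth (weight_fps \<phi>) m * \<tau> ^ m)"
      "summable (\<lambda>m. fps_nth (fps_deriv (weight_fps \<phi>)) m * \<tau> ^ m)"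
    and critical: "\<tau> * eval_fps (fps_deriv (weight_fps \<phi>)) \<tau> = eval_fps (weight_fps \<phi>) \<tau>"
    and offspring: "\<And>m. pmf \<xi> m = real (\<phi> m) * \<tau> ^ m / eval_fps (weight_fps \<phi>) \<tau>"
    and variance_finite:
      "integrable (measure_pmf \<xi>) (\<lambda>m. (real m - measure_pmf.expectation \<xi> real)\<^sup>2)"
  shows
    "(\<lambda>n. measure_pmf.expectation (random_tree \<phi> n) (\<lambda>t. real (num_distinct_fringe t)))
       \<sim>[admissible_sizes \<phi>] (\<lambda>n. fringe_const \<phi> \<tau> * (real n / sqrt (ln (real n))))
     \<and>
     (\<exists>\<epsilon> :: nat \<Rightarrow> real. (\<epsilon> \<longlongrightarrow> 0) (admissible_sizes \<phi>) \<and>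
       ((\<lambda>n. measure_pmf.prob (random_tree \<phi> n)
              {t. \<bar>real (num_distinct_fringe t) - fringe_const \<phi> \<tau> * (real n / sqrt (ln (real n)))\<bar>
                    \<le> \<epsilon> n * (fringe_const \<phi> \<tau> * (real n / sqrt (ln (real n))))})
          \<longlongrightarrow> 1) (admissible_sizes \<phi>))"
proof (cases "\<phi> 0 = 0")
  case True
  \<comment> \<open>Every finite tree has a leaf. Without types for leaves there are no admissible
    sizes, and limits along the trivial filter hold vacuously.\<close>
  have bot: "admissible_sizes \<phi> = bot"
    by (simp add: admissible_sizes_def no_trees_without_leaves [of \<phi>, OF True])
  show ?thesis unfolding bot by (auto simp: asymp_equiv_def)
next
  case False
  then interpret simply_generated \<phi> \<tau> \<xi>
    using assms by unfold_locales auto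
  have "((\<lambda>n. sqrt (dev n)) \<longlongrightarrow> sqrt 0) (admissible_sizes \<phi>)"
    by (intro tendsto_intros dev_tendsto_0)
  then show ?thesis
    using expectation_asymp concentration unfolding fringe_const_eq main_term_def [abs_def]
    by (intro conjI exI [of _ "\<lambda>n. sqrt (dev n)"]) simp_all
qed

end
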